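(* Let $\Gamma\rightrightarrows M$ be an arbitrary Lie groupoid of class $C^\infty$, and let $\mathcal G=\mathrm{Bis}_c^\infty(\Gamma)$ be the group of all compactly supported smooth bisections of $\Gamma$ (and a fortiori the same holds for $\mathcal G=\mathrm{Bis}^\infty(\Gamma)$, the group of all smooth bisections). Let $(x_1,\ldots,x_n)\in M^n$ be a pairwise distinct $n$-tuple, let $L_i=\beta(\Gamma^o_{x_i})$, and assume that for each $i=1,\ldots,n$ either $\dim(L_i)\ge 2$, or $x_j\notin L_i$ for all $j\ne i$. Then for any $(\gamma_1,\ldots,\gamma_n)\in\mathcal R(x_1,\ldots,x_n)$ and for any $V_1,\ldots,V_n$ such that $V_i$ is an open neighborhood of $L_i$ in $M$, there exists $\sigma\in\mathcal G$ such that $\sigma(x_i)=\gamma_i$ for each $i$ and $\operatorname{supp}(\beta\circ\sigma)\subseteq V_1\cup\cdots\cup V_n$. In particular, for every $\gamma\in\Gamma^o$ and every open neighborhood $V$ in $M$ of $L_{\alpha(\gamma)}=\beta(\Gamma^o_{\alpha(\gamma)})$ there is $\sigma\in\mathrm{Bis}_c^\infty(\Gamma)$ with $\sigma(\alpha(\gamma))=\gamma$ and $\operatorname{supp}(\beta\circ\sigma)\subseteq V$.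
   Context: $\Gamma\rightrightarrows M$ is a smooth Lie groupoid with manifold of units $M$, source map $\alpha$, target map $\beta$, and unit inclusion $\iota_M:M\hookrightarrow\Gamma$; the product $\gamma.\gamma'$ is defined when $\alpha(\gamma)=\beta(\gamma')$. A bisection is a smooth map $\sigma:M\to\Gamma$ with $\alpha\circ\sigma=\mathrm{id}_M$ and $\beta\circ\sigma$ a diffeomorphism of $M$; the set $\mathrm{Bis}^\infty(\Gamma)$ of all bisections is a group under $(\sigma\star\tau)(x)=\sigma(\beta(\tau(x))).\tau(x)$, with unit $\iota_M$. $\operatorname{supp}(\sigma)$ is the closure of $\{x\in M:\sigma(x)\ne\iota_M(x)\}$, and $\sigma$ is compactly supported if this set is compact; for a diffeomorphism $f$ of $M$, $\operatorname{supp}(f)$ is the closure of $\{x:f(x)\ne x\}$. $\Gamma_x=\alpha^{-1}(x)$, $\Gamma_x^o$ is the connected component of (the unit at) $x$ in $\Gamma_x$, and $\Gamma^o=\bigcup_{x\in M}\Gamma_x^o$. The sets $\beta(\Gamma_x^o)$ are the leaves of the (generalized) foliation $\mathcal F_\Gamma$ of $M$ determined by $\Gamma$, and $\dim(L_i)$ is the dimension of the leaf. For a pairwise distinct tuple, $$\mathcal R(x_1,\ldots,x_n)=\{(\gamma_1,\ldots,\gamma_n)\in\Gamma^o_{x_1}\times\cdots\times\Gamma^o_{x_n}:\ \beta(\gamma_i)\ne\beta(\gamma_j)\text{ for all } i\ne j\}.$$ *)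

theory Defs
  imports "HOL-Analysis.Analysis" "HOL-Algebra.Group"
begin

section \<open>Smooth maps between open subsets of finite-dimensional spaces\<close>

text \<open>
  Model spaces of manifolds are finite-dimensional real normed vector spaces rather than types of
  class \<open>euclidean_space\<close>: the latter have positive dimension, which would exclude
  zero-dimensional manifolds (for instance a one-point space of units).
\<close>

definition finite_dimensional :: "'e::real_normed_vector itself \<Rightarrow> bool" where
  "finite_dimensional _ \<longleftrightarrow> (\<exists>B::'e set. finite B \<and> span B = UNIV)"

text \<open>
  In finite dimensions, \<open>f\<close> is \<open>n\<close> times continuously differentiable on an open set iff
  all its iterated directional derivatives of order at most \<open>n\<close> are continuous.
\<close>

primrec Ck_on :: "nat \<Rightarrow> 'a::real_normed_vector set \<Rightarrow> ('a \<Rightarrow> 'b::real_normed_vector) \<Rightarrow> bool" where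
  "Ck_on 0 S f \<longleftrightarrow> continuous_on S f"
| "Ck_on (Suc n) S f \<longleftrightarrow>
     (\<forall>x\<in>S. f differentiable (at x)) \<and> (\<forall>v. Ck_on n S (\<lambda>x. frechet_derivative f (at x) v))"

definition smooth_on :: "'a::real_normed_vector set \<Rightarrow> ('a \<Rightarrow> 'b::real_normed_vector) \<Rightarrow> bool" where
  "smooth_on S f \<longleftrightarrow> open S \<and> (\<forall>n. Ck_on n S f)"

section \<open>Smooth manifolds\<close>

text \<open>A chart is a domain together with a map, only whose values on the domain matter.\<close>

type_synonym ('m, 'e) chart = "'m set \<times> ('m \<Rightarrow> 'e)"

definition is_chart :: "('m::topological_space, 'e::real_normed_vector) chart \<Rightarrow> bool" where
  "is_chart = (\<lambda>(U, \<phi>). open U \<and> open (\<phi> ` U) \<and> (\<exists>\<psi>. homeomorphism U (\<phi> ` U) \<phi> \<psi>))"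

definition smooth_compatible ::
    "('m::topological_space, 'e::real_normed_vector) chart \<Rightarrow> ('m, 'e) chart \<Rightarrow> bool" where
  "smooth_compatible = (\<lambda>(U, \<phi>) (V, \<psi>).
     smooth_on (\<phi> ` (U \<inter> V)) (\<psi> \<circ> inv_into U \<phi>) \<and>
     smooth_on (\<psi> ` (U \<inter> V)) (\<phi> \<circ> inv_into V \<psi>))"

text \<open>
  The manifold is the whole type \<open>'m\<close>. No separation or countability axiom is included here;
  these are expressed by the sort of \<open>'m\<close> where they are wanted.
\<close>

definition smooth_atlas :: "('m::topological_space, 'e::real_normed_vector) chart set \<Rightarrow> bool" where
  "smooth_atlas A \<longleftrightarrow>
     finite_dimensional TYPE('e) \<and>
     (\<forall>c\<in>A. is_chart c) \<and>
     (\<Union>c\<in>A. fst c) = UNIV \<and>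
     (\<forall>c\<in>A. \<forall>d\<in>A. smooth_compatible c d)"

text \<open>The charts of the maximal atlas determined by \<open>A\<close>.\<close>

definition smooth_charts ::
    "('m::topological_space, 'e::real_normed_vector) chart set \<Rightarrow> ('m, 'e) chart set" where
  "smooth_charts A = {c. is_chart c \<and> (\<forall>d\<in>A. smooth_compatible c d)}"

definition prod_atlas ::
    "('m, 'e) chart set \<Rightarrow> ('n, 'f) chart set \<Rightarrow> ('m \<times> 'n, 'e \<times> 'f) chart set" where
  "prod_atlas A B = {(U \<times> V, map_prod \<phi> \<psi>) | U \<phi> V \<psi>. (U, \<phi>) \<in> A \<and> (V, \<psi>) \<in> B}"

text \<open>
  Smoothness of \<open>f\<close> on an arbitrary subset \<open>S\<close>: locally, in charts, \<open>f\<close> is the restriction of a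
  smooth map \<open>h\<close> defined on an open set. For \<open>S\<close> open, this is ordinary smoothness; for \<open>S\<close> an
  embedded submanifold, it is smoothness with respect to the submanifold structure.
\<close>

definition smooth_map_on ::
    "('m::topological_space, 'e::real_normed_vector) chart set \<Rightarrow>
     ('n::topological_space, 'f::real_normed_vector) chart set \<Rightarrow> 'm set \<Rightarrow> ('m \<Rightarrow> 'n) \<Rightarrow> bool" where
  "smooth_map_on A B S f \<longleftrightarrow>
     (\<forall>p\<in>S. \<exists>(U, \<phi>)\<in>A. \<exists>(V, \<psi>)\<in>B. \<exists>W h.
        open W \<and> p \<in> W \<and> W \<subseteq> U \<and> f ` (S \<inter> W) \<subseteq> V \<and>
        smooth_on (\<phi> ` W) h \<and> (\<forall>q\<in>S \<inter> W. \<psi> (f q) = h (\<phi> q)))"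

abbreviation smooth_map ::
    "('m::topological_space, 'e::real_normed_vector) chart set \<Rightarrow>
     ('n::topological_space, 'f::real_normed_vector) chart set \<Rightarrow> ('m \<Rightarrow> 'n) \<Rightarrow> bool" where
  "smooth_map A B f \<equiv> smooth_map_on A B UNIV f"

definition diffeomorphism ::
    "('m::topological_space, 'e::real_normed_vector) chart set \<Rightarrow>
     ('n::topological_space, 'f::real_normed_vector) chart set \<Rightarrow> ('m \<Rightarrow> 'n) \<Rightarrow> bool" where
  "diffeomorphism A B f \<longleftrightarrow> bij f \<and> smooth_map A B f \<and> smooth_map B A (inv_into UNIV f)"

definition submersion ::
    "('m::topological_space, 'e::real_normed_vector) chart set \<Rightarrow>
     ('n::topological_space, 'f::real_normed_vector) chart set \<Rightarrow> ('m \<Rightarrow> 'n) \<Rightarrow> bool" where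
  "submersion A B f \<longleftrightarrow>
     smooth_map A B f \<and>
     (\<forall>p. \<exists>(U, \<phi>)\<in>A. \<exists>(V, \<psi>)\<in>B. p \<in> U \<and> f p \<in> V \<and>
        surj (frechet_derivative (\<psi> \<circ> f \<circ> inv_into U \<phi>) (at (\<phi> p))))"

section \<open>Weakly embedded submanifolds and their dimension\<close>

definition embedded_submanifold ::
    "('m::topological_space, 'e::real_normed_vector) chart set \<Rightarrow> 'm set \<Rightarrow> nat \<Rightarrow> bool" where
  "embedded_submanifold A S k \<longleftrightarrow>
     (\<forall>p\<in>S. \<exists>(U, \<phi>)\<in>smooth_charts A. \<exists>E. p \<in> U \<and> subspace E \<and> dim E = k \<and>
        \<phi> ` (S \<inter> U) = \<phi> ` U \<inter> E)"

text \<open>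
  The topology \<open>T\<close>, in general finer than the subspace topology, makes its underlying set a
  \<open>k\<close>-dimensional immersed submanifold: an injective immersion is locally an embedding, and the
  differentiable structure is determined by \<open>T\<close>.
\<close>

definition immersed_submanifold ::
    "('m::topological_space, 'e::real_normed_vector) chart set \<Rightarrow> 'm topology \<Rightarrow> nat \<Rightarrow> bool" where
  "immersed_submanifold A T k \<longleftrightarrow>
     (\<forall>p\<in>topspace T. \<exists>W. openin T W \<and> p \<in> W \<and> embedded_submanifold A W k \<and>
        subtopology T W = subtopology euclidean W)"

text \<open>
  A leaf of a generalized foliation is a weakly embedded submanifold: an immersed submanifold \<open>L\<close>
  such that every continuous map from a locally connected space \<open>N\<close> into the ambient manifold with
  image in \<open>L\<close> is continuous into \<open>L\<close>. Such a structure on a given set \<open>L\<close> is unique, so the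
  following says that \<open>k\<close> is the dimension of \<open>L\<close>. Restricting \<open>N\<close> to spaces whose
  points have type \<open>'m\<close> loses nothing: replace \<open>N\<close> by the image of the map with the quotient
  topology, which is again locally connected.
\<close>

definition leaf_dim_is ::
    "('m::topological_space, 'e::real_normed_vector) chart set \<Rightarrow> 'm set \<Rightarrow> nat \<Rightarrow> bool" where
  "leaf_dim_is A L k \<longleftrightarrow>
     (\<exists>T. topspace T = L \<and> immersed_submanifold A T k \<and>
        (\<forall>(N::'m topology) f. locally_connected_space N \<and> continuous_map N euclidean f \<and>
           f ` topspace N \<subseteq> L \<longrightarrow> continuous_map N T f))"

section \<open>Lie groupoids\<close>

text \<open>The value of \<open>comp\<close> is relevant only on composable pairs.\<close>

record ('g, 'm, 'h, 'e) groupoid_data =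
  arrow_atlas :: "('g, 'h) chart set"
  unit_atlas :: "('m, 'e) chart set"
  src :: "'g \<Rightarrow> 'm"
  tgt :: "'g \<Rightarrow> 'm"
  unit_arrow :: "'m \<Rightarrow> 'g"
  comp :: "'g \<Rightarrow> 'g \<Rightarrow> 'g"
  inv_arrow :: "'g \<Rightarrow> 'g"

definition composable :: "('g, 'm, 'h, 'e) groupoid_data \<Rightarrow> ('g \<times> 'g) set" where
  "composable \<Gamma> = {(g, h). src \<Gamma> g = tgt \<Gamma> h}"

definition is_groupoid :: "('g, 'm, 'h, 'e) groupoid_data \<Rightarrow> bool" where
  "is_groupoid \<Gamma> \<longleftrightarrow>
     (\<forall>x. src \<Gamma> (unit_arrow \<Gamma> x) = x \<and> tgt \<Gamma> (unit_arrow \<Gamma> x) = x) \<and>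
     (\<forall>(g, h)\<in>composable \<Gamma>.
        src \<Gamma> (comp \<Gamma> g h) = src \<Gamma> h \<and> tgt \<Gamma> (comp \<Gamma> g h) = tgt \<Gamma> g) \<and>
     (\<forall>g h k. (g, h) \<in> composable \<Gamma> \<and> (h, k) \<in> composable \<Gamma> \<longrightarrow>
        comp \<Gamma> (comp \<Gamma> g h) k = comp \<Gamma> g (comp \<Gamma> h k)) \<and>
     (\<forall>g. comp \<Gamma> g (unit_arrow \<Gamma> (src \<Gamma> g)) = g \<and> comp \<Gamma> (unit_arrow \<Gamma> (tgt \<Gamma> g)) g = g) \<and>
     (\<forall>g. src \<Gamma> (inv_arrow \<Gamma> g) = tgt \<Gamma> g \<and> tgt \<Gamma> (inv_arrow \<Gamma> g) = src \<Gamma> g \<and>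
        comp \<Gamma> (inv_arrow \<Gamma> g) g = unit_arrow \<Gamma> (src \<Gamma> g) \<and>
        comp \<Gamma> g (inv_arrow \<Gamma> g) = unit_arrow \<Gamma> (tgt \<Gamma> g))"

text \<open>
  The manifold of units is Hausdorff and second countable. As usual for Lie groupoids, the space
  of arrows need not be. Since source and target are submersions, the set of composable pairs is
  an embedded submanifold of the product, on which multiplication is required to be smooth.
\<close>

definition lie_groupoid ::
    "('g::topological_space, 'm::{t2_space, second_countable_topology},
      'h::real_normed_vector, 'e::real_normed_vector) groupoid_data \<Rightarrow> bool" where
  "lie_groupoid \<Gamma> \<longleftrightarrow>
     is_groupoid \<Gamma> \<and>
     smooth_atlas (arrow_atlas \<Gamma>) \<and>
     smooth_atlas (unit_atlas \<Gamma>) \<and>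
     submersion (arrow_atlas \<Gamma>) (unit_atlas \<Gamma>) (src \<Gamma>) \<and>
     submersion (arrow_atlas \<Gamma>) (unit_atlas \<Gamma>) (tgt \<Gamma>) \<and>
     smooth_map (unit_atlas \<Gamma>) (arrow_atlas \<Gamma>) (unit_arrow \<Gamma>) \<and>
     smooth_map (arrow_atlas \<Gamma>) (arrow_atlas \<Gamma>) (inv_arrow \<Gamma>) \<and>
     smooth_map_on (prod_atlas (arrow_atlas \<Gamma>) (arrow_atlas \<Gamma>)) (arrow_atlas \<Gamma>)
       (composable \<Gamma>) (\<lambda>(g, h). comp \<Gamma> g h)"

section \<open>Bisections\<close>

definition bisections ::
    "('g::topological_space, 'm::topological_space,
      'h::real_normed_vector, 'e::real_normed_vector) groupoid_data \<Rightarrow> ('m \<Rightarrow> 'g) set" where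
  "bisections \<Gamma> =
     {\<sigma>. smooth_map (unit_atlas \<Gamma>) (arrow_atlas \<Gamma>) \<sigma> \<and> src \<Gamma> \<circ> \<sigma> = id \<and>
         diffeomorphism (unit_atlas \<Gamma>) (unit_atlas \<Gamma>) (tgt \<Gamma> \<circ> \<sigma>)}"

definition bisection_supp ::
    "('g, 'm::topological_space, 'h, 'e) groupoid_data \<Rightarrow> ('m \<Rightarrow> 'g) \<Rightarrow> 'm set" where
  "bisection_supp \<Gamma> \<sigma> = closure {x. \<sigma> x \<noteq> unit_arrow \<Gamma> x}"

definition diffeo_supp :: "('m::topological_space \<Rightarrow> 'm) \<Rightarrow> 'm set" where
  "diffeo_supp f = closure {x. f x \<noteq> x}"

definition Bis ::
    "('g::topological_space, 'm::topological_space,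
      'h::real_normed_vector, 'e::real_normed_vector) groupoid_data \<Rightarrow> ('m \<Rightarrow> 'g) monoid" where
  "Bis \<Gamma> =
     \<lparr>carrier = bisections \<Gamma>,
      monoid.mult = (\<lambda>\<sigma> \<tau> x. comp \<Gamma> (\<sigma> (tgt \<Gamma> (\<tau> x))) (\<tau> x)),
      one = unit_arrow \<Gamma>\<rparr>"

definition Bis_c ::
    "('g::topological_space, 'm::topological_space,
      'h::real_normed_vector, 'e::real_normed_vector) groupoid_data \<Rightarrow> ('m \<Rightarrow> 'g) monoid" where
  "Bis_c \<Gamma> = (Bis \<Gamma>)\<lparr>carrier := {\<sigma> \<in> bisections \<Gamma>. compact (bisection_supp \<Gamma> \<sigma>)}\<rparr>"

section \<open>Identity components and leaves\<close>

definition src_fibre :: "('g, 'm, 'h, 'e) groupoid_data \<Rightarrow> 'm \<Rightarrow> 'g set" where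
  "src_fibre \<Gamma> x = {g. src \<Gamma> g = x}"

definition src_fibre_o :: "('g::topological_space, 'm, 'h, 'e) groupoid_data \<Rightarrow> 'm \<Rightarrow> 'g set" where
  "src_fibre_o \<Gamma> x = connected_component_set (src_fibre \<Gamma> x) (unit_arrow \<Gamma> x)"

definition arrows_o :: "('g::topological_space, 'm, 'h, 'e) groupoid_data \<Rightarrow> 'g set" where
  "arrows_o \<Gamma> = (\<Union>x. src_fibre_o \<Gamma> x)"

definition leaf :: "('g::topological_space, 'm, 'h, 'e) groupoid_data \<Rightarrow> 'm \<Rightarrow> 'm set" where
  "leaf \<Gamma> x = tgt \<Gamma> ` src_fibre_o \<Gamma> x"

text \<open>Tuples are functions on \<open>nat\<close>, of which only the values at \<open>1, \<dots>, n\<close> matter.\<close>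

definition arrow_tuples ::
    "('g::topological_space, 'm, 'h, 'e) groupoid_data \<Rightarrow> nat \<Rightarrow> (nat \<Rightarrow> 'm) \<Rightarrow> (nat \<Rightarrow> 'g) set" where
  "arrow_tuples \<Gamma> n x =
     {\<gamma>. (\<forall>i\<in>{1..n}. \<gamma> i \<in> src_fibre_o \<Gamma> (x i)) \<and>
         (\<forall>i\<in>{1..n}. \<forall>j\<in>{1..n}. i \<noteq> j \<longrightarrow> tgt \<Gamma> (\<gamma> i) \<noteq> tgt \<Gamma> (\<gamma> j))}"

end

theory Submission
  imports Defs
begin

text \<open>
  Write \<open>\<alpha>, \<beta>, \<iota>\<close> for source, target and units, and \<open>\<Gamma>\<^sup>o\<^sub>x\<close> for the identity component of the source fibre over
  \<open>x\<close>. Two arrows \<open>g, g'\<close> of a fibre are \<open>reachable\<close> from each other over an open set \<open>X\<close> if some bisection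
  \<open>\<sigma>\<close> with compact support in \<open>X\<close> and values in identity components satisfies \<open>\<sigma> (\<beta> g) \<cdot> g = g'\<close>. These
  bisections form a group, so reachability is an equivalence relation. Its classes are open in the part
  of the fibre lying over \<open>X\<close>: by right translation this is a statement about arrows \<open>g\<close> near a unit
  \<open>\<iota> p\<close>. There, in a chart in which the source map is linear, the units form a section \<open>\<zeta>\<close>, and
  \<open>\<zeta> + \<eta> t\<close>, with a bump function \<open>\<eta>\<close> around \<open>p\<close> and a small vector \<open>t\<close> tangent to the fibre, is again a
  section; choosing \<open>t\<close> suitably it passes through \<open>g\<close>. Composed with the target map it is the identity
  plus a contraction, hence a diffeomorphism (lemma \<open>local_bisections\<close>). As open equivalence classes
  exhaust a connected set, any two arrows of a connected part of a fibre over \<open>X\<close> are reachable.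
  
  For several points the arrows are corrected one after the other. Once \<open>\<sigma>\<close> maps \<open>x\<^sub>1, \<dots>, x\<^sub>m\<close> to their
  arrows, the next arrow has to be changed by a bisection supported away from the finite set \<open>F\<close> of
  targets already attained, so what is needed is reachability over \<open>X - F\<close> between two arrows of the
  connected fibre whose targets avoid \<open>F\<close> (lemma \<open>reach_avoiding\<close>). If the leaf misses \<open>F\<close>, this is the
  above. Otherwise it suffices that every arrow \<open>g\<close> has small neighbourhoods in the fibre that stay
  connected when the arrows with target \<open>\<beta> g\<close> are removed (predicate \<open>punctured\<close>).
  
  This local property holds at \<open>g\<close> if \<open>\<beta>\<close> restricted to the fibre has rank at least two at \<open>g\<close>, because two
  independent coordinates of \<open>\<beta>\<close> then cut out a linear subspace of codimension two in a suitable chart;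
  and if it holds at one arrow of \<open>\<Gamma>\<^sup>o\<^sub>x\<close> it holds at all of them, because left multiplication by bisections
  acts transitively. So if it fails, the rank is at most one on all of \<open>\<Gamma>\<^sup>o\<^sub>x\<close>, some open piece of the
  fibre is mapped into a curve or a point, and by homogeneity every arrow has such a neighbourhood.
  Since \<open>\<Gamma>\<^sup>o\<^sub>x\<close> is a countable union of compact sets (products of arrows from compact neighbourhoods of
  countably many units), the leaf is a countable union of curves. All its smooth planar images are then
  null sets, which is impossible for a set that contains a submanifold of dimension at least two
  (lemma \<open>leaf_dim_imp_punctured\<close>).
  
  The tools come first: smooth maps of finite-dimensional normed spaces and their inverse function theorem,
  bump functions, and the calculus of charts.
\<close>

section \<open>Finite-dimensional normed spaces\<close>

text \<open>
  The coefficient vectors of maximum norm one form a compact set in the product topology on functions,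
  on which the norm of the linear combination has a positive minimum by independence; the bound
  follows by homogeneity.
\<close>

lemma coefficients_bounded_by_norm:
  fixes B :: "'a::real_normed_vector set"
  assumes "finite B" "independent B"
  shows "\<exists>C>0. \<forall>u. \<forall>b\<in>B. \<bar>u b\<bar> \<le> C * norm (\<Sum>b\<in>B. u b *\<^sub>R b)"
proof (cases "B = {}")
  case True
  then show ?thesis by (auto intro: exI[of _ 1])
next
  case False
  let ?N = "\<lambda>u::'a \<Rightarrow> real. norm (\<Sum>b\<in>B. u b *\<^sub>R b)"
  define K where "K = (PiE UNIV (\<lambda>b. if b \<in> B then {-1..1::real} else {0}) :: ('a \<Rightarrow> real) set)"
  define S where "S = K \<inter> (\<Union>b\<in>B. {u. \<bar>u b\<bar> = 1})"
  have "compactin (product_topology (\<lambda>_. euclidean) UNIV) K"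
    unfolding K_def by (subst compactin_PiE) auto
  then have "compact K" by (simp add: euclidean_product_topology)
  moreover have "closed (\<Union>b\<in>B. {u::'a \<Rightarrow> real. \<bar>u b\<bar> = 1})"
  proof (intro closed_UN ballI assms)
    fix b assume "b \<in> B"
    have "continuous_on UNIV (\<lambda>u::'a \<Rightarrow> real. \<bar>u b\<bar>)" by (intro continuous_intros) simp
    then show "closed {u::'a \<Rightarrow> real. \<bar>u b\<bar> = 1}" by (rule closed_Collect_eq) simp
  qed
  ultimately have "compact S" unfolding S_def by blast
  moreover have "S \<noteq> {}"
  proof -
    obtain b where "b \<in> B" using False by blast
    then have "(\<lambda>x. if x = b then 1 else 0) \<in> S" by (auto simp: S_def K_def)
    then show ?thesis by blast
  qed
  moreover have "continuous_on S ?N"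
    by (rule continuous_on_subset[of UNIV]) (intro continuous_intros continuous_on_product_coordinates | simp)+
  ultimately obtain u0 where u0: "u0 \<in> S" "\<And>u. u \<in> S \<Longrightarrow> ?N u0 \<le> ?N u"
    using continuous_attains_inf[of S ?N] by blast
  define m where "m = ?N u0"
  have "m > 0"
  proof (rule ccontr)
    assume "\<not> m > 0"
    then have z: "(\<Sum>b\<in>B. u0 b *\<^sub>R b) = 0" unfolding m_def by auto
    obtain b where "b \<in> B" "\<bar>u0 b\<bar> = 1" using u0(1) by (auto simp: S_def)
    then show False using assms z unfolding real_vector.independent_explicit_finite_subsets
      by (metis abs_zero order_refl zero_neq_one)
  qed
  have "\<bar>u b\<bar> \<le> (1 / m) * ?N u" if b: "b \<in> B" for u b
  proof -
    define M where "M = Max ((\<lambda>b. \<bar>u b\<bar>) ` B)"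
    have M: "\<bar>u x\<bar> \<le> M" if "x \<in> B" for x using that assms(1) unfolding M_def by auto
    have "M \<in> (\<lambda>b. \<bar>u b\<bar>) ` B" unfolding M_def using assms(1) False by (intro Max_in) auto
    then obtain b1 where b1: "b1 \<in> B" "\<bar>u b1\<bar> = M" by auto
    show ?thesis
    proof (cases "M = 0")
      case True
      then show ?thesis using M[OF b] \<open>m > 0\<close> by auto
    next
      case False
      then have Mp: "M > 0" using M[OF b] by linarith
      define w where "w x = (if x \<in> B then u x / M else 0)" for x
      have wB: "\<bar>w x\<bar> \<le> 1" if "x \<in> B" for x using M[OF that] Mp by (simp add: w_def that)
      have "w x \<in> (if x \<in> B then {-1..1} else {0})" for x
      proof (cases "x \<in> B")
        case True
        then show ?thesis using abs_le_D1[OF wB[OF True]] abs_le_D2[OF wB[OF True]] by simp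
      qed (simp add: w_def)
      then have "w \<in> K" unfolding K_def by (simp add: PiE_iff)
      moreover have "\<bar>w b1\<bar> = 1" using b1 Mp by (simp add: w_def)
      ultimately have "w \<in> S" using b1(1) unfolding S_def by blast
      then have "m \<le> ?N w" using u0(2) unfolding m_def by blast
      also have "(\<Sum>b\<in>B. w b *\<^sub>R b) = (1 / M) *\<^sub>R (\<Sum>b\<in>B. u b *\<^sub>R b)"
        by (simp add: w_def scaleR_sum_right)
      finally have "m * M \<le> ?N u" using Mp by (simp add: field_simps)
      then have "M \<le> (1 / m) * ?N u" using \<open>m > 0\<close> by (simp add: field_simps)
      then show ?thesis using M[OF b] by linarith
    qed
  qed
  then show ?thesis using \<open>m > 0\<close> by (intro exI[of _ "1/m"]) auto
qed

text \<open>
  In the absence of an inner product, this takes the place of an orthonormal basis.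
\<close>

lemma finite_dimensional_coordinates:
  assumes "finite_dimensional TYPE('a::real_normed_vector)"
  obtains B :: "'a::real_normed_vector set" and c :: "'a \<Rightarrow> 'a \<Rightarrow> real" where
    "finite B" "independent B" "span B = UNIV" "\<And>b. bounded_linear (c b)"
    "\<And>v. (\<Sum>b\<in>B. c b v *\<^sub>R b) = v"
proof -
  obtain B0 :: "'a set" where B0: "finite B0" "span B0 = UNIV"
    using assms unfolding finite_dimensional_def by blast
  obtain B where B: "B \<subseteq> B0" "independent B" "span B = span B0"
    by (metis maximal_independent_subset span_mono span_span subset_antisym)
  have finB: "finite B" using B0 B finite_subset by blast
  have spanB: "span B = UNIV" using B B0 by simp
  define c where "c b v = (if b \<in> B then representation B v b else 0)" for b v
  have rep: "(\<Sum>b\<in>B. c b v *\<^sub>R b) = v" for v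
    using sum_representation_eq[OF B(2) _ finB order_refl, of v] spanB by (simp add: c_def)
  obtain C where C: "C > 0" "\<And>u b. b \<in> B \<Longrightarrow> \<bar>u b\<bar> \<le> C * norm (\<Sum>b\<in>B. u b *\<^sub>R b)"
    using coefficients_bounded_by_norm[OF finB B(2)] by blast
  have "bounded_linear (c b)" for b
  proof (cases "b \<in> B")
    case True
    show ?thesis
    proof (rule bounded_linear_intro[of _ C])
      show "c b (x + y) = c b x + c b y" for x y
        using True by (simp add: c_def representation_add[OF B(2)] spanB)
      show "c b (r *\<^sub>R x) = r *\<^sub>R c b x" for r x
        using True by (simp add: c_def representation_scale[OF B(2)] spanB)
      show "norm (c b x) \<le> norm x * C" for x
        using C(2)[OF True, of "\<lambda>b. c b x"] by (simp add: rep mult.commute)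
    qed
  next
    case False
    then have "c b = (\<lambda>_. 0)" by (auto simp: c_def)
    then show ?thesis by simp
  qed
  then show ?thesis using that finB B(2) spanB rep by blast
qed

lemma linear_eq_sum_coordinates:
  assumes "linear l" "\<And>v. (\<Sum>b\<in>B. c b v *\<^sub>R b) = v"
  shows "l v = (\<Sum>b\<in>B. c b v *\<^sub>R l b)"
  using linear_sum[OF assms(1), of "\<lambda>b. c b v *\<^sub>R b" B] assms(2)[of v] linear_cmul[OF assms(1)] by simp

lemma finite_dimensional_bounded_linear:
  fixes f :: "'a::real_normed_vector \<Rightarrow> 'b::real_normed_vector"
  assumes "finite_dimensional TYPE('a)" "linear f"
  shows "bounded_linear f"
proof -
  obtain B :: "'a set" and c where B: "finite B" "\<And>b. bounded_linear (c b)" "\<And>v. (\<Sum>b\<in>B. c b v *\<^sub>R b) = v"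
    using finite_dimensional_coordinates[OF assms(1)] by metis
  have "f v = (\<Sum>b\<in>B. c b v *\<^sub>R f b)" for v
    by (rule linear_eq_sum_coordinates[OF assms(2) B(3)])
  then have "f = (\<lambda>v. \<Sum>b\<in>B. c b v *\<^sub>R f b)" by blast
  moreover have "bounded_linear (\<lambda>v. \<Sum>b\<in>B. c b v *\<^sub>R f b)"
    by (intro bounded_linear_sum bounded_linear_scaleR_const B(2))
  ultimately show ?thesis by metis
qed

lemma finite_dimensional_cball_compact:
  assumes "finite_dimensional TYPE('a::real_normed_vector)"
  shows "compact (cball (x::'a::real_normed_vector) r)"
proof -
  obtain B :: "'a set" and c where B: "finite B" "\<And>b. bounded_linear (c b)" "\<And>v. (\<Sum>b\<in>B. c b v *\<^sub>R b) = v"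
    using finite_dimensional_coordinates[OF assms] by metis
  obtain C where C: "\<And>b v. norm (c b v) \<le> norm v * C b"
    using bounded_linear.bounded[OF B(2)] by metis
  define M where "M b = (norm x + \<bar>r\<bar>) * \<bar>C b\<bar>" for b
  define K where "K = (PiE UNIV (\<lambda>b. {- M b..M b}) :: ('a \<Rightarrow> real) set)"
  have "compactin (product_topology (\<lambda>_. euclidean) UNIV) K"
    unfolding K_def by (subst compactin_PiE) auto
  then have "compact K" by (simp add: euclidean_product_topology)
  moreover have "continuous_on K (\<lambda>u. \<Sum>b\<in>B. u b *\<^sub>R b)"
    by (rule continuous_on_subset[of UNIV]) (intro continuous_intros continuous_on_product_coordinates | simp)+
  ultimately have com: "compact ((\<lambda>u. \<Sum>b\<in>B. u b *\<^sub>R b) ` K)" by (rule compact_continuous_image[rotated])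
  have "cball x r \<subseteq> (\<lambda>u. \<Sum>b\<in>B. u b *\<^sub>R b) ` K"
  proof
    fix v assume "v \<in> cball x r"
    then have "norm v \<le> norm x + \<bar>r\<bar>"
      using norm_triangle_sub[of v x] by (simp add: dist_norm norm_minus_commute)
    have "\<bar>c b v\<bar> \<le> M b" for b
    proof -
      have "\<bar>c b v\<bar> \<le> norm v * \<bar>C b\<bar>"
        using order_trans[OF C[of b v] mult_left_mono[OF abs_ge_self norm_ge_zero]] by simp
      also have "\<dots> \<le> M b" unfolding M_def using \<open>norm v \<le> norm x + \<bar>r\<bar>\<close> by (rule mult_right_mono) simp
      finally show ?thesis .
    qed
    then have "c b v \<in> {- M b..M b}" for b using abs_le_D1[of "c b v" "M b"] abs_le_D2[of "c b v" "M b"] by (simp add: minus_le_iff)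
    then have "(\<lambda>b. c b v) \<in> K" by (simp add: K_def PiE_iff)
    then show "v \<in> (\<lambda>u. \<Sum>b\<in>B. u b *\<^sub>R b) ` K" by (rule image_eqI[rotated]) (simp add: B(3))
  qed
  then have "cball x r = cball x r \<inter> (\<lambda>u. \<Sum>b\<in>B. u b *\<^sub>R b) ` K" by (rule inf.absorb1[symmetric])
  then show ?thesis using closed_Int_compact[OF closed_cball com, of x r] by (simp only:)
qed

lemma finite_dimensional_inj_imp_bij:
  fixes f :: "'a::real_normed_vector \<Rightarrow> 'a"
  assumes "finite_dimensional TYPE('a)" "linear f" "\<And>v. f v = 0 \<Longrightarrow> v = 0"
  shows "bij f"
proof -
  obtain B :: "'a set" where B: "finite B" "independent B" "span B = UNIV"
    using finite_dimensional_coordinates[OF assms(1)] by metis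
  interpret fd: finite_dimensional_vector_space scaleR B
    by unfold_locales (use B in \<open>auto simp: algebra_simps dependent_raw_def span_raw_def\<close>)
  have "inj f" using assms(2,3) linear_injective_0 by blast
  moreover then have "surj f" using fd.linear_inj_imp_surj assms(2) unfolding linear_def by blast
  ultimately show ?thesis by (simp add: bij_def)
qed

text \<open>
  Spans of the two coordinate embeddings generate the product; needed to straighten pairs of maps.
\<close>

lemma finite_dimensional_prod:
  assumes "finite_dimensional TYPE('a::real_normed_vector)" "finite_dimensional TYPE('b::real_normed_vector)"
  shows "finite_dimensional TYPE('a::real_normed_vector \<times> 'b::real_normed_vector)"
proof -
  obtain B :: "'a set" where B: "finite B" "span B = UNIV" using assms(1) unfolding finite_dimensional_def by blast
  obtain C :: "'b set" where C: "finite C" "span C = UNIV" using assms(2) unfolding finite_dimensional_def by blast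
  have "span (B \<times> {0} \<union> {0} \<times> C) = UNIV"
  proof -
    have "(x, y) \<in> span (B \<times> {0} \<union> {0} \<times> C)" for x y
    proof -
      have "linear (\<lambda>x::'a. (x, 0::'b))" by (auto intro!: linearI)
      then have "(\<lambda>x. (x, 0)) ` span B \<subseteq> span (B \<times> {0} \<union> {0} \<times> C)"
        by (simp add: linear_span_image[symmetric]) (auto intro!: span_mono)
      moreover have "linear (\<lambda>y::'b. (0::'a, y))" by (auto intro!: linearI)
      then have "(\<lambda>y. (0, y)) ` span C \<subseteq> span (B \<times> {0} \<union> {0} \<times> C)"
        by (simp add: linear_span_image[symmetric]) (auto intro!: span_mono)
      ultimately have "(x, 0) + (0, y) \<in> span (B \<times> {0} \<union> {0} \<times> C)"
        using B C by (intro span_add) auto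
      then show ?thesis by simp
    qed
    then show ?thesis by auto
  qed
  then show ?thesis unfolding finite_dimensional_def using B C by (intro exI[of _ "B \<times> {0} \<union> {0} \<times> C"]) auto
qed

lemma finite_dimensional_euclidean: "finite_dimensional TYPE('a::euclidean_space)"
  unfolding finite_dimensional_def by (rule exI[of _ Basis]) auto

abbreviation D :: "('a::real_normed_vector \<Rightarrow> 'b::real_normed_vector) \<Rightarrow> 'a \<Rightarrow> 'a \<Rightarrow> 'b" where
  "D f x \<equiv> frechet_derivative f (at x)"

section \<open>Calculus of smooth maps\<close>

text \<open>
  On an open set derivatives depend only on the values there, although \<open>frechet_derivative\<close> sees the
  function on the whole type.
\<close>

lemma Ck_on_cong:
  assumes "open S" "\<And>x. x \<in> S \<Longrightarrow> f x = g x" "Ck_on n S f"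
  shows "Ck_on n S g"
  using assms(2,3)
proof (induction n arbitrary: f g)
  case 0
  then show ?case by (simp cong: continuous_on_cong)
next
  case (Suc n)
  have d: "f differentiable (at x)" if "x \<in> S" for x using Suc.prems that by simp
  have eq: "D f x = D g x" if "x \<in> S" for x
    by (rule frechet_derivative_transform_within_open[OF d[OF that] assms(1) that Suc.prems(1)])
  have "g differentiable (at x)" if "x \<in> S" for x
    using frechet_derivative_works[THEN iffD1, OF d[OF that]] assms(1) that Suc.prems(1)
    by (intro differentiableI) (rule has_derivative_transform_within_open)
  moreover have "Ck_on n S (\<lambda>x. D g x v)" for v
    by (rule Suc.IH[of "\<lambda>x. D f x v"]) (use eq Suc.prems(2) in auto)
  ultimately show ?case by simp
qed

lemma Ck_on_SucI:
  assumes "open S" "\<And>x. x \<in> S \<Longrightarrow> (f has_derivative f' x) (at x)" "\<And>v. Ck_on n S (\<lambda>x. f' x v)"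
  shows "Ck_on (Suc n) S f"
proof -
  have "D f x = f' x" if "x \<in> S" for x using frechet_derivative_at[OF assms(2)[OF that]] by simp
  then have "Ck_on n S (\<lambda>x. D f x v)" for v
    by (intro Ck_on_cong[OF assms(1) _ assms(3)[of v]]) simp
  then show ?thesis using assms(2) by (auto simp: differentiable_def)
qed

lemma Ck_on_SucD:
  assumes "Ck_on (Suc n) S f"
  shows "x \<in> S \<Longrightarrow> (f has_derivative D f x) (at x)" "Ck_on n S (\<lambda>x. D f x v)"
  using assms by (auto simp: frechet_derivative_works)

lemma Ck_on_Suc_imp: "Ck_on (Suc n) S f \<Longrightarrow> Ck_on n S f"
proof (induction n arbitrary: f)
  case 0
  then show ?case
    by (auto intro!: continuous_at_imp_continuous_on differentiable_imp_continuous_within)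
next
  case (Suc n)
  then show ?case by simp
qed

lemma Ck_on_subset: "Ck_on n S f \<Longrightarrow> T \<subseteq> S \<Longrightarrow> Ck_on n T f"
  by (induction n arbitrary: f) (auto intro: continuous_on_subset)

lemma Ck_on_local:
  assumes "\<And>x. x \<in> S \<Longrightarrow> \<exists>W. open W \<and> x \<in> W \<and> Ck_on n W f"
  shows "Ck_on n S f"
  using assms
proof (induction n arbitrary: f)
  case 0
  show ?case unfolding Ck_on.simps
  proof (rule continuous_at_imp_continuous_on, rule ballI)
    fix x assume "x \<in> S"
    then show "isCont f x" using 0[of x] by (auto simp: continuous_on_eq_continuous_at)
  qed
next
  case (Suc n)
  show ?case unfolding Ck_on.simps
  proof (intro conjI ballI allI)
    show "f differentiable at x" if "x \<in> S" for x using Suc.prems[OF that] by auto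
    show "Ck_on n S (\<lambda>x. D f x v)" for v by (rule Suc.IH) (use Suc.prems in force)
  qed
qed

lemma Ck_on_const: "open S \<Longrightarrow> Ck_on n S (\<lambda>_. c)"
  by (induction n arbitrary: c) (auto intro!: Ck_on_SucI[where f' = "\<lambda>_ _. 0"] simp del: Ck_on.simps(2))

lemma Ck_on_bounded_linear_compose:
  assumes "open S" "bounded_linear L" "Ck_on n S f"
  shows "Ck_on n S (\<lambda>x. L (f x))"
  using assms(3)
proof (induction n arbitrary: f)
  case 0
  then show ?case using bounded_linear.continuous_on[OF assms(2)] by simp
next
  case (Suc n)
  show ?case
    by (rule Ck_on_SucI[where f' = "\<lambda>x v. L (D f x v)"], rule assms)
      (use bounded_linear.has_derivative[OF assms(2) Ck_on_SucD(1)[OF Suc.prems]] Suc.IH Ck_on_SucD(2)[OF Suc.prems] in auto)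
qed

lemma Ck_on_bounded_linear:
  assumes "open S" "bounded_linear L" shows "Ck_on n S L"
proof (cases n)
  case 0
  then show ?thesis using assms by (simp add: linear_continuous_on)
next
  case (Suc m)
  then show ?thesis
    by (auto intro!: Ck_on_SucI[where f' = "\<lambda>_. L"] assms Ck_on_const bounded_linear_imp_has_derivative simp del: Ck_on.simps(2))
qed

lemma Ck_on_add:
  assumes "open S" "Ck_on n S f" "Ck_on n S g" shows "Ck_on n S (\<lambda>x. f x + g x)"
  using assms(2,3)
proof (induction n arbitrary: f g)
  case 0
  then show ?case by (auto intro: continuous_intros)
next
  case (Suc n)
  show ?case
  proof (rule Ck_on_SucI[where f' = "\<lambda>x v. D f x v + D g x v"], rule assms)
    show "((\<lambda>x. f x + g x) has_derivative (\<lambda>v. D f x v + D g x v)) (at x)" if "x \<in> S" for x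
      by (rule has_derivative_add) (use Ck_on_SucD(1) Suc.prems that in blast)+
    show "Ck_on n S (\<lambda>x. D f x v + D g x v)" for v
      by (intro Suc.IH Ck_on_SucD(2) Suc.prems)
  qed
qed

lemma Ck_on_scaleR:
  fixes f :: "'a::real_normed_vector \<Rightarrow> real"
  assumes "open S" "Ck_on n S f" "Ck_on n S g" shows "Ck_on n S (\<lambda>x. f x *\<^sub>R g x)"
  using assms(2,3)
proof (induction n arbitrary: f g)
  case 0
  then show ?case by (auto intro: continuous_intros)
next
  case (Suc n)
  show ?case
  proof (rule Ck_on_SucI[where f' = "\<lambda>x v. f x *\<^sub>R D g x v + D f x v *\<^sub>R g x"], rule assms)
    show "((\<lambda>x. f x *\<^sub>R g x) has_derivative (\<lambda>v. f x *\<^sub>R D g x v + D f x v *\<^sub>R g x)) (at x)"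
      if "x \<in> S" for x
      by (rule has_derivative_scaleR) (use Ck_on_SucD(1) Suc.prems that in blast)+
    show "Ck_on n S (\<lambda>x. f x *\<^sub>R D g x v + D f x v *\<^sub>R g x)" for v
      by (rule Ck_on_add[OF assms(1) Suc.IH[OF Ck_on_Suc_imp[OF Suc.prems(1)] Ck_on_SucD(2)[OF Suc.prems(2)]]
            Suc.IH[OF Ck_on_SucD(2)[OF Suc.prems(1)] Ck_on_Suc_imp[OF Suc.prems(2)]]])
  qed
qed

lemma Ck_on_sum:
  assumes "open S" "\<And>i. i \<in> I \<Longrightarrow> Ck_on n S (f i)" shows "Ck_on n S (\<lambda>x. \<Sum>i\<in>I. f i x)"
  using assms(2)
  by (induction I rule: infinite_finite_induct) (auto intro: Ck_on_add Ck_on_const assms)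

text \<open>
  The chain rule gives \<open>D (g \<circ> f) x v = D g (f x) (D f x v)\<close>, which is not a directional derivative of
  \<open>g\<close> in a fixed direction. Expanding \<open>D f x v\<close> in a basis of the intermediate space turns it into a sum
  of products to which the induction hypothesis applies.
\<close>

lemma Ck_on_compose:
  fixes f :: "'a::real_normed_vector \<Rightarrow> 'b::real_normed_vector" and g :: "'b \<Rightarrow> 'c::real_normed_vector"
  assumes "finite_dimensional TYPE('b)" "open S" "open T" "f ` S \<subseteq> T" "Ck_on n S f" "Ck_on n T g"
  shows "Ck_on n S (\<lambda>x. g (f x))"
proof -
  obtain B :: "'b set" and c where B: "finite B" "\<And>b. bounded_linear (c b)" "\<And>v. (\<Sum>b\<in>B. c b v *\<^sub>R b) = v"
    using finite_dimensional_coordinates[OF assms(1)] by metis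
  show ?thesis using assms(4-6)
  proof (induction n arbitrary: f g)
    case 0
    then show ?case by (auto intro: continuous_on_compose2)
  next
    case (Suc n)
    show ?case
    proof (rule Ck_on_SucI[where f' = "\<lambda>x v. \<Sum>b\<in>B. c b (D f x v) *\<^sub>R D g (f x) b"], rule assms)
      show "((\<lambda>x. g (f x)) has_derivative (\<lambda>v. \<Sum>b\<in>B. c b (D f x v) *\<^sub>R D g (f x) b)) (at x)"
        if "x \<in> S" for x
      proof -
        have fx: "f x \<in> T" using that Suc.prems(1) by blast
        have g: "(g has_derivative D g (f x)) (at (f x))" by (rule Ck_on_SucD(1)[OF Suc.prems(3) fx])
        have "((\<lambda>x. g (f x)) has_derivative (\<lambda>v. D g (f x) (D f x v))) (at x)"
          by (rule has_derivative_compose[OF Ck_on_SucD(1)[OF Suc.prems(2) that] g])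
        moreover have *: "D g (f x) w = (\<Sum>b\<in>B. c b w *\<^sub>R D g (f x) b)" for w
          by (rule linear_eq_sum_coordinates[OF has_derivative_linear[OF g] B(3)])
        have "(\<lambda>v. D g (f x) (D f x v)) = (\<lambda>v. \<Sum>b\<in>B. c b (D f x v) *\<^sub>R D g (f x) b)" by (rule ext) (rule *)
        ultimately show ?thesis using has_derivative_eq_rhs by blast
      qed
      show "Ck_on n S (\<lambda>x. \<Sum>b\<in>B. c b (D f x v) *\<^sub>R D g (f x) b)" for v
      proof (intro Ck_on_sum Ck_on_scaleR assms)
        fix b
        show "Ck_on n S (\<lambda>x. c b (D f x v))"
          by (rule Ck_on_bounded_linear_compose[OF assms(2) B(2) Ck_on_SucD(2)[OF Suc.prems(2)]])
        show "Ck_on n S (\<lambda>x. D g (f x) b)"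
          by (rule Suc.IH[OF Suc.prems(1) Ck_on_Suc_imp[OF Suc.prems(2)] Ck_on_SucD(2)[OF Suc.prems(3)]])
      qed
    qed
  qed
qed

lemma smooth_onI: "open S \<Longrightarrow> (\<And>n. Ck_on n S f) \<Longrightarrow> smooth_on S f"
  by (simp add: smooth_on_def)

lemma smooth_on_open: "smooth_on S f \<Longrightarrow> open S"
  by (simp add: smooth_on_def)

lemma smooth_on_Ck: "smooth_on S f \<Longrightarrow> Ck_on n S f"
  by (simp add: smooth_on_def)

lemma smooth_on_has_derivative: "smooth_on S f \<Longrightarrow> x \<in> S \<Longrightarrow> (f has_derivative D f x) (at x)"
  by (rule Ck_on_SucD(1)[OF smooth_on_Ck])

lemma smooth_on_D: "smooth_on S f \<Longrightarrow> smooth_on S (\<lambda>x. D f x v)"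
  by (auto simp: smooth_on_def intro: Ck_on_SucD(2))

lemma smooth_on_continuous_on: "smooth_on S f \<Longrightarrow> continuous_on S f"
  using smooth_on_Ck[of S f 0] by simp

lemma smooth_on_subset: "smooth_on S f \<Longrightarrow> open T \<Longrightarrow> T \<subseteq> S \<Longrightarrow> smooth_on T f"
  by (auto simp: smooth_on_def intro: Ck_on_subset)

lemma smooth_on_cong: "smooth_on S f \<Longrightarrow> (\<And>x. x \<in> S \<Longrightarrow> f x = g x) \<Longrightarrow> smooth_on S g"
  unfolding smooth_on_def using Ck_on_cong[of S f g] by blast

lemma smooth_on_local:
  assumes "\<And>x. x \<in> S \<Longrightarrow> \<exists>W. x \<in> W \<and> W \<subseteq> S \<and> smooth_on W f"
  shows "smooth_on S f"
proof -
  have "open S" by (subst open_subopen) (use assms smooth_on_open in blast)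
  moreover have "Ck_on n S f" for n
    by (rule Ck_on_local) (metis assms smooth_on_def)
  ultimately show ?thesis by (rule smooth_onI)
qed

lemma smooth_on_compose:
  fixes f :: "'a::real_normed_vector \<Rightarrow> 'b::real_normed_vector"
  assumes "finite_dimensional TYPE('b)" "smooth_on T g" "smooth_on S f" "f ` S \<subseteq> T"
  shows "smooth_on S (\<lambda>x. g (f x))"
  using assms by (auto simp: smooth_on_def intro: Ck_on_compose)

lemma smooth_on_const: "open S \<Longrightarrow> smooth_on S (\<lambda>_. c)"
  by (simp add: smooth_on_def Ck_on_const)

lemma smooth_on_bounded_linear: "open S \<Longrightarrow> bounded_linear L \<Longrightarrow> smooth_on S L"
  by (simp add: smooth_on_def Ck_on_bounded_linear)

lemma smooth_on_id: "open S \<Longrightarrow> smooth_on S (\<lambda>x. x)"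
  by (rule smooth_on_bounded_linear) auto

lemma smooth_on_bounded_linear_compose:
  "bounded_linear L \<Longrightarrow> smooth_on S f \<Longrightarrow> smooth_on S (\<lambda>x. L (f x))"
  by (simp add: smooth_on_def Ck_on_bounded_linear_compose)

lemma smooth_on_add: "smooth_on S f \<Longrightarrow> smooth_on S g \<Longrightarrow> smooth_on S (\<lambda>x. f x + g x)"
  by (simp add: smooth_on_def Ck_on_add)

lemma smooth_on_scaleR:
  fixes f :: "'a::real_normed_vector \<Rightarrow> real"
  shows "smooth_on S f \<Longrightarrow> smooth_on S g \<Longrightarrow> smooth_on S (\<lambda>x. f x *\<^sub>R g x)"
  by (simp add: smooth_on_def Ck_on_scaleR)

lemma smooth_on_minus: "smooth_on S f \<Longrightarrow> smooth_on S (\<lambda>x. - f x)"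
  by (rule smooth_on_bounded_linear_compose) (rule bounded_linear_minus[OF bounded_linear_ident])

lemma smooth_on_diff: "smooth_on S f \<Longrightarrow> smooth_on S g \<Longrightarrow> smooth_on S (\<lambda>x. f x - g x)"
  using smooth_on_add[of S f "\<lambda>x. - g x"] smooth_on_minus by auto

lemma smooth_on_sum:
  "open S \<Longrightarrow> (\<And>i. i \<in> I \<Longrightarrow> smooth_on S (f i)) \<Longrightarrow> smooth_on S (\<lambda>x. \<Sum>i\<in>I. f i x)"
  by (simp add: smooth_on_def Ck_on_sum)

lemma smooth_on_Pair:
  assumes "smooth_on S f" "smooth_on S g"
  shows "smooth_on S (\<lambda>x. (f x, g x))"
proof -
  have "smooth_on S (\<lambda>x. (f x, 0) + (0, g x))"
    by (intro smooth_on_add smooth_on_bounded_linear_compose[OF _ assms(1), of "\<lambda>x. (x, 0)"]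
        smooth_on_bounded_linear_compose[OF _ assms(2), of "\<lambda>x. (0, x)"]
        bounded_linear_Pair bounded_linear_ident bounded_linear_zero)
  then show ?thesis by simp
qed

section \<open>Local Lipschitz bounds and inverses of linear families\<close>

lemma linear_bound_by_coordinates:
  fixes B :: "'a::real_normed_vector set"
  assumes "finite B" "\<And>b. bounded_linear (c b)" "\<And>v. (\<Sum>b\<in>B. c b v *\<^sub>R b) = v"
  obtains K where "\<And>b. K b > 0"
    "\<And>(l::'a \<Rightarrow> 'b::real_normed_vector) v. linear l \<Longrightarrow> norm (l v) \<le> (\<Sum>b\<in>B. K b * norm (l b)) * norm v"
proof -
  obtain K where K: "\<And>b. 0 < K b" "\<And>b v. norm (c b v) \<le> norm v * K b"
    using bounded_linear.pos_bounded[OF assms(2)] by metis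
  have "norm (l v) \<le> (\<Sum>b\<in>B. K b * norm (l b)) * norm v" if "linear l" for l :: "'a \<Rightarrow> 'b" and v
  proof -
    have "norm (l v) = norm (\<Sum>b\<in>B. c b v *\<^sub>R l b)"
      using linear_eq_sum_coordinates[OF that assms(3), of v] by simp
    also have "\<dots> \<le> (\<Sum>b\<in>B. norm (c b v *\<^sub>R l b))" by (rule norm_sum)
    also have "\<dots> \<le> (\<Sum>b\<in>B. (norm v * K b) * norm (l b))"
      using K(2) by (intro sum_mono) (simp add: mult_right_mono)
    finally show ?thesis by (simp add: sum_distrib_right sum_distrib_left mult_ac)
  qed
  then show ?thesis using that K(1) by blast
qed

text \<open>
  The operator norm of \<open>D f x\<close> is bounded by the values of \<open>D f x\<close> on a basis, which are continuous in
  \<open>x\<close>; the mean value inequality on a small ball does the rest.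
\<close>

lemma C1_locally_lipschitz:
  fixes f :: "'a::real_normed_vector \<Rightarrow> 'b::real_normed_vector"
  assumes fd: "finite_dimensional TYPE('a)" and S: "open S" "Ck_on 1 S f" "x0 \<in> S"
  obtains r C where "r > 0" "C > 0" "ball x0 r \<subseteq> S"
    "\<And>x v. x \<in> ball x0 r \<Longrightarrow> norm (D f x v) \<le> C * norm v"
    "\<And>x y. x \<in> ball x0 r \<Longrightarrow> y \<in> ball x0 r \<Longrightarrow> norm (f x - f y) \<le> C * norm (x - y)"
proof -
  obtain B :: "'a set" and c where B: "finite B" "\<And>b. bounded_linear (c b)" "\<And>v. (\<Sum>b\<in>B. c b v *\<^sub>R b) = v"
    using finite_dimensional_coordinates[OF fd] by metis
  obtain K where K: "\<And>b. K b > 0"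
    "\<And>(l::'a \<Rightarrow> 'b) v. linear l \<Longrightarrow> norm (l v) \<le> (\<Sum>b\<in>B. K b * norm (l b)) * norm v"
    using linear_bound_by_coordinates[OF B] by metis
  have der: "(f has_derivative D f x) (at x)" if "x \<in> S" for x
    using Ck_on_SucD(1)[of 0 S f x] S(2) that by simp
  have cont: "continuous_on S (\<lambda>x. D f x v)" for v
    using Ck_on_SucD(2)[of 0 S f v] S(2) by simp
  define N where "N x = (\<Sum>b\<in>B. K b * norm (D f x b))" for x
  have "continuous_on S N" unfolding N_def by (intro continuous_intros cont)
  then have "isCont N x0" using S by (simp add: continuous_on_eq_continuous_at)
  then obtain d where d: "d > 0" "\<And>x. dist x x0 < d \<Longrightarrow> dist (N x) (N x0) < 1"
    unfolding continuous_at_eps_delta by (metis zero_less_one)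
  obtain r0 where r0: "r0 > 0" "ball x0 r0 \<subseteq> S" using S open_contains_ball by blast
  define r where "r = min d r0"
  define C where "C = N x0 + 1"
  have "N x \<ge> 0" for x unfolding N_def using K(1) by (intro sum_nonneg) (simp add: less_imp_le)
  then have "C > 0" unfolding C_def by (simp add: add_nonneg_pos)
  have sub: "ball x0 r \<subseteq> S" using r0 by (auto simp: r_def)
  have bound: "norm (D f x v) \<le> C * norm v" if "x \<in> ball x0 r" for x v
  proof -
    have "norm (D f x v) \<le> N x * norm v"
      unfolding N_def by (rule K(2)) (use der sub that in \<open>blast intro: has_derivative_linear\<close>)
    moreover have "dist (N x) (N x0) < 1" by (rule d(2)) (use that in \<open>simp add: r_def dist_commute\<close>)
    then have "N x \<le> C" by (simp add: C_def dist_real_def)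
    ultimately show ?thesis using mult_right_mono[of "N x" C "norm v"] by simp
  qed
  have "norm (f x - f y) \<le> C * norm (x - y)" if "x \<in> ball x0 r" "y \<in> ball x0 r" for x y
  proof (rule differentiable_bound[of "ball x0 r" f "D f"])
    show "(f has_derivative D f x) (at x within ball x0 r)" if "x \<in> ball x0 r" for x
      using der that sub by (blast intro: has_derivative_at_withinI)
    show "onorm (D f x) \<le> C" if "x \<in> ball x0 r" for x
      by (rule onorm_bound) (use bound that \<open>C > 0\<close> in auto)
  qed (use that in auto)
  then show ?thesis using that[of r C] d(1) r0(1) \<open>C > 0\<close> sub bound by (auto simp: r_def)
qed

lemma smooth_on_derivative_locally_lipschitz:
  fixes f :: "'a::real_normed_vector \<Rightarrow> 'b::real_normed_vector"
  assumes fd: "finite_dimensional TYPE('a)" and S: "smooth_on S f" "x0 \<in> S"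
  obtains r C where "r > 0" "C > 0" "ball x0 r \<subseteq> S"
    "\<And>x y v. x \<in> ball x0 r \<Longrightarrow> y \<in> ball x0 r \<Longrightarrow> norm (D f x v - D f y v) \<le> C * norm (x - y) * norm v"
proof -
  obtain B :: "'a set" and c where B: "finite B" "\<And>b. bounded_linear (c b)" "\<And>v. (\<Sum>b\<in>B. c b v *\<^sub>R b) = v"
    using finite_dimensional_coordinates[OF fd] by metis
  obtain K where K: "\<And>b. K b > 0"
    "\<And>(l::'a \<Rightarrow> 'b) v. linear l \<Longrightarrow> norm (l v) \<le> (\<Sum>b\<in>B. K b * norm (l b)) * norm v"
    using linear_bound_by_coordinates[OF B] by metis
  have "\<exists>r C. r > 0 \<and> C > 0 \<and> (\<forall>x\<in>ball x0 r. \<forall>y\<in>ball x0 r. norm (D f x b - D f y b) \<le> C * norm (x - y))" for b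
    using C1_locally_lipschitz[OF fd smooth_on_open[OF S(1)] smooth_on_Ck[OF smooth_on_D[OF S(1)]] S(2), of b] by metis
  then obtain r C where rC: "\<And>b. r b > 0" "\<And>b. C b > 0"
    "\<And>b x y. x \<in> ball x0 (r b) \<Longrightarrow> y \<in> ball x0 (r b) \<Longrightarrow> norm (D f x b - D f y b) \<le> C b * norm (x - y)" by metis
  obtain r0 where r0: "r0 > 0" "ball x0 r0 \<subseteq> S" using S smooth_on_open open_contains_ball by blast
  define \<rho> where "\<rho> = Min (insert r0 (r ` B))"
  have \<rho>: "\<rho> > 0" "\<rho> \<le> r0" "\<And>b. b \<in> B \<Longrightarrow> \<rho> \<le> r b"
    unfolding \<rho>_def using B(1) rC(1) r0(1) by auto
  have sub: "ball x0 \<rho> \<subseteq> S" using \<rho>(2) r0(2) subset_ball[of \<rho> r0 x0] by blast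
  define C' where "C' = 1 + (\<Sum>b\<in>B. K b * C b)"
  have "(\<Sum>b\<in>B. K b * C b) \<ge> 0" using K(1) rC(2) by (intro sum_nonneg) (simp add: less_imp_le)
  then have C': "C' > 0" "(\<Sum>b\<in>B. K b * C b) \<le> C'" unfolding C'_def by simp_all
  have "norm (D f x v - D f y v) \<le> C' * norm (x - y) * norm v"
    if xy: "x \<in> ball x0 \<rho>" "y \<in> ball x0 \<rho>" for x y v
  proof -
    have "linear (\<lambda>v. D f x v - D f y v)"
      by (intro linear_compose_sub has_derivative_linear[OF smooth_on_has_derivative[OF S(1)]]) (use xy sub in blast)+
    then have "norm (D f x v - D f y v) \<le> (\<Sum>b\<in>B. K b * norm (D f x b - D f y b)) * norm v" by (rule K(2))
    also have "(\<Sum>b\<in>B. K b * norm (D f x b - D f y b)) \<le> (\<Sum>b\<in>B. K b * (C b * norm (x - y)))"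
    proof (intro sum_mono mult_left_mono)
      show "norm (D f x b - D f y b) \<le> C b * norm (x - y)" if "b \<in> B" for b
        by (rule rC(3)) (use xy \<rho>(3)[OF that] in auto)
    qed (simp add: K(1) less_imp_le)
    also have "\<dots> = (\<Sum>b\<in>B. K b * C b) * norm (x - y)" by (simp add: sum_distrib_right mult.assoc)
    also have "\<dots> \<le> C' * norm (x - y)" using C'(2) by (rule mult_right_mono) simp
    finally show ?thesis by (simp add: mult_right_mono)
  qed
  then show ?thesis using that[of \<rho> C'] \<rho>(1) C'(1) sub by blast
qed

text \<open>
  The product rule for a factor that vanishes at the point only needs continuity of the other factor.
  It yields the derivative of an inverse without assuming the inverse differentiable.
\<close>

lemma has_derivative_vanishing_scaleR:
  fixes \<phi> :: "'a::real_normed_vector \<Rightarrow> real" and \<psi> :: "'a \<Rightarrow> 'b::real_normed_vector"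
  assumes "(\<phi> has_derivative \<phi>') (at x)" "\<phi> x = 0" "isCont \<psi> x"
  shows "((\<lambda>y. \<phi> y *\<^sub>R \<psi> y) has_derivative (\<lambda>u. \<phi>' u *\<^sub>R \<psi> x)) (at x)"
proof -
  have "((\<lambda>y. \<phi> y *\<^sub>R (\<psi> y - \<psi> x)) has_derivative (\<lambda>u. 0)) (at x)"
    unfolding has_derivative_at_alt
  proof (intro conjI allI impI)
    fix e :: real assume "e > 0"
    obtain K where K: "K > 0" "\<And>u. norm (\<phi>' u) \<le> norm u * K"
      using bounded_linear.pos_bounded[OF has_derivative_bounded_linear[OF assms(1)]] by blast
    obtain d1 where d1: "d1 > 0" "\<And>y. norm (y - x) < d1 \<Longrightarrow> norm (\<phi> y - \<phi> x - \<phi>' (y - x)) \<le> 1 * norm (y - x)"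
      using assms(1) unfolding has_derivative_at_alt by (meson zero_less_one)
    have "e / (K + 1) > 0" using \<open>e > 0\<close> K by simp
    then obtain d2 where d2: "d2 > 0" "\<And>y. dist y x < d2 \<Longrightarrow> dist (\<psi> y) (\<psi> x) < e / (K + 1)"
      using assms(3) unfolding continuous_at_eps_delta by metis
    have "norm (\<phi> y *\<^sub>R (\<psi> y - \<psi> x) - \<phi> x *\<^sub>R (\<psi> x - \<psi> x) - 0) \<le> e * norm (y - x)" if "norm (y - x) < min d1 d2" for y
    proof -
      have "\<bar>\<phi> y\<bar> \<le> norm (\<phi>' (y - x)) + norm (\<phi> y - \<phi> x - \<phi>' (y - x))"
        using norm_triangle_ineq[of "\<phi>' (y - x)" "\<phi> y - \<phi> x - \<phi>' (y - x)"] assms(2) by simp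
      also have "\<dots> \<le> norm (y - x) * K + 1 * norm (y - x)" using K(2) d1(2) that by (intro add_mono) auto
      finally have 1: "\<bar>\<phi> y\<bar> \<le> (K + 1) * norm (y - x)" by (simp add: algebra_simps)
      have 2: "norm (\<psi> y - \<psi> x) \<le> e / (K + 1)" using d2(2)[of y] that by (simp add: dist_norm)
      have "\<bar>\<phi> y\<bar> * norm (\<psi> y - \<psi> x) \<le> ((K + 1) * norm (y - x)) * (e / (K + 1))"
        using 1 2 by (rule mult_mono) (use K in auto)
      also have "\<dots> = e * norm (y - x)" using K by simp
      finally show ?thesis by simp
    qed
    then show "\<exists>d>0. \<forall>y. norm (y - x) < d \<longrightarrow> norm (\<phi> y *\<^sub>R (\<psi> y - \<psi> x) - \<phi> x *\<^sub>R (\<psi> x - \<psi> x) - 0) \<le> e * norm (y - x)"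
      using d1(1) d2(1) by (intro exI[of _ "min d1 d2"]) auto
  qed auto
  moreover have "((\<lambda>y. \<phi> y *\<^sub>R \<psi> x) has_derivative (\<lambda>u. \<phi>' u *\<^sub>R \<psi> x)) (at x)"
    by (rule bounded_linear.has_derivative[OF bounded_linear_scaleR_left assms(1)])
  ultimately have "((\<lambda>y. \<phi> y *\<^sub>R (\<psi> y - \<psi> x) + \<phi> y *\<^sub>R \<psi> x) has_derivative (\<lambda>u. 0 + \<phi>' u *\<^sub>R \<psi> x)) (at x)"
    by (rule has_derivative_add)
  then show ?thesis by (simp add: scaleR_diff_right)
qed

lemma bij_linear_inv:
  fixes l :: "'a::real_normed_vector \<Rightarrow> 'a"
  assumes "finite_dimensional TYPE('a)" "linear l" "bij l"
  shows "bounded_linear (inv_into UNIV l)" "l (inv_into UNIV l v) = v" "inv_into UNIV l (l v) = v"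
proof -
  show *: "l (inv_into UNIV l v) = v" for v using assms(3) by (simp add: bij_is_surj surj_f_inv_f)
  show inv: "inv_into UNIV l (l v) = v" for v using assms(3) by (simp add: bij_is_inj inv_f_f)
  have "linear (inv_into UNIV l)"
  proof (rule linearI)
    show "inv_into UNIV l (x + y) = inv_into UNIV l x + inv_into UNIV l y" for x y
      using inv[of "inv_into UNIV l x + inv_into UNIV l y"] by (simp add: linear_add[OF assms(2)] *)
    show "inv_into UNIV l (r *\<^sub>R x) = r *\<^sub>R inv_into UNIV l x" for r x
      using inv[of "r *\<^sub>R inv_into UNIV l x"] by (simp add: linear_cmul[OF assms(2)] *)
  qed
  then show "bounded_linear (inv_into UNIV l)" by (rule finite_dimensional_bounded_linear[OF assms(1)])
qed

text \<open>
  Let \<open>a b b'\<close> be the matrix entries of the family \<open>A\<close> and \<open>h v x\<close> the solution \<open>w\<close> of \<open>A x w = v\<close>. Then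
  \<open>h v x - h v x0\<close> is the sum of the terms \<open>c b' (h v x0) * (a b b' x - a b b' x0) * (- h b x)\<close>. Since each
  \<open>h b\<close> is continuous, this expresses the derivative of \<open>h v\<close> by the maps \<open>h b\<close>, the coordinates of \<open>h v\<close>
  and the derivatives of the entries, and smoothness follows by induction on the order.
\<close>

lemma smooth_on_inv_linear_family:
  fixes A :: "'x::real_normed_vector \<Rightarrow> 'a::real_normed_vector \<Rightarrow> 'a"
  assumes fd: "finite_dimensional TYPE('a)" and S: "open S"
    and lin: "\<And>x. x \<in> S \<Longrightarrow> linear (A x)" and bij: "\<And>x. x \<in> S \<Longrightarrow> bij (A x)"
    and sm: "\<And>v. smooth_on S (\<lambda>x. A x v)"
  shows "smooth_on S (\<lambda>x. inv_into UNIV (A x) v)"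
proof -
  obtain B :: "'a set" and c where B: "finite B" "\<And>b. bounded_linear (c b)" "\<And>v. (\<Sum>b\<in>B. c b v *\<^sub>R b) = v"
    using finite_dimensional_coordinates[OF fd] by metis
  obtain Kc where Kc: "\<And>b. Kc b > 0"
    "\<And>(l::'a \<Rightarrow> 'a) v. linear l \<Longrightarrow> norm (l v) \<le> (\<Sum>b\<in>B. Kc b * norm (l b)) * norm v"
    using linear_bound_by_coordinates[OF B] by metis
  define h where "h v x = inv_into UNIV (A x) v" for v x
  define a where "a b b' x = c b (A x b')" for b b' x
  note invA = bij_linear_inv[OF fd lin bij]
  have sma: "smooth_on S (a b b')" for b b'
    unfolding a_def by (rule smooth_on_bounded_linear_compose[OF B(2) sm])
  have cont: "isCont (h v) x0" if x0: "x0 \<in> S" for v x0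
  proof -
    obtain K where K: "K > 0" "\<And>w. norm (inv_into UNIV (A x0) w) \<le> norm w * K"
      using bounded_linear.pos_bounded[OF invA(1)[OF x0 x0]] by blast
    define \<epsilon> where "\<epsilon> x = (\<Sum>b\<in>B. Kc b * norm (A x b - A x0 b))" for x
    have cA: "isCont (\<lambda>x. A x w) x0" for w
      using smooth_on_continuous_on[OF sm] S x0 by (simp add: continuous_on_eq_continuous_at)
    have "isCont \<epsilon> x0" unfolding \<epsilon>_def by (intro continuous_intros cA)
    then have "(\<epsilon> \<longlongrightarrow> 0) (at x0)" by (simp add: isCont_def \<epsilon>_def)
    then have e1: "\<forall>\<^sub>F x in at x0. \<epsilon> x < 1 / (2 * K)" using K(1) by (intro order_tendstoD(2)[of \<epsilon> 0]) auto
    have e2: "\<forall>\<^sub>F x in at x0. x \<in> S" using S x0 by (intro eventually_at_in_open') auto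
    have "\<forall>\<^sub>F x in at x0. norm (h v x - h v x0) \<le> 2 * K * norm (v - A x (h v x0))"
      using e1 e2
    proof eventually_elim
      case (elim x)
      have low: "norm w \<le> 2 * K * norm (A x w)" for w
      proof -
        have "norm w = norm (inv_into UNIV (A x0) (A x0 w))" using invA(3)[OF x0 x0] by simp
        also have "\<dots> \<le> norm (A x0 w) * K" by (rule K(2))
        also have "norm (A x0 w) \<le> norm (A x w) + norm (A x w - A x0 w)"
          using norm_triangle_ineq4[of "A x w" "A x w - A x0 w"] by simp
        also have "norm (A x w - A x0 w) \<le> \<epsilon> x * norm w" unfolding \<epsilon>_def
          by (rule Kc(2)) (intro linear_compose_sub lin x0 elim)
        also have "\<epsilon> x * norm w \<le> 1 / (2 * K) * norm w" using elim(1) by (intro mult_right_mono) auto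
        finally have "norm w \<le> (norm (A x w) + 1 / (2 * K) * norm w) * K" using K(1) by simp
        then show ?thesis using K(1) by (simp add: field_simps)
      qed
      have "A x (h v x - h v x0) = v - A x (h v x0)"
        using invA(2)[OF elim(2) elim(2)] by (simp add: h_def linear_diff[OF lin[OF elim(2)]])
      then show ?case using low[of "h v x - h v x0"] by simp
    qed
    moreover have "((\<lambda>x. 2 * K * norm (v - A x (h v x0))) \<longlongrightarrow> 2 * K * norm (v - A x0 (h v x0))) (at x0)"
      using cA[of "h v x0"] unfolding isCont_def by (intro tendsto_intros)
    then have "((\<lambda>x. 2 * K * norm (v - A x (h v x0))) \<longlongrightarrow> 0) (at x0)"
      using invA(2)[OF x0 x0] by (simp add: h_def)
    ultimately have "((\<lambda>x. h v x - h v x0) \<longlongrightarrow> 0) (at x0)" by (rule Lim_null_comparison)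
    then show ?thesis unfolding isCont_def by (simp add: LIM_zero_iff)
  qed
  have eq: "h v x = h v x0 + (\<Sum>b\<in>B. \<Sum>b'\<in>B. c b' (h v x0) *\<^sub>R ((a b b' x - a b b' x0) *\<^sub>R (- h b x)))"
    if x: "x \<in> S" and x0: "x0 \<in> S" for v x x0
  proof -
    have li: "linear (inv_into UNIV (A x))" using invA(1)[OF x x] by (rule bounded_linear.linear)
    have "h v x - h v x0 = inv_into UNIV (A x) (A x (h v x - h v x0))" using invA(3)[OF x x] by simp
    also have "A x (h v x - h v x0) = A x0 (h v x0) - A x (h v x0)"
      using invA(2)[OF x x] invA(2)[OF x0 x0] by (simp add: h_def linear_diff[OF lin[OF x]])
    also have "A x0 (h v x0) - A x (h v x0) = (\<Sum>b'\<in>B. c b' (h v x0) *\<^sub>R (A x0 b' - A x b'))"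
      by (rule linear_eq_sum_coordinates[OF linear_compose_sub[OF lin[OF x0] lin[OF x]] B(3)])
    also have "\<dots> = (\<Sum>b'\<in>B. c b' (h v x0) *\<^sub>R (\<Sum>b\<in>B. (a b b' x0 - a b b' x) *\<^sub>R b))"
    proof (rule sum.cong[OF refl])
      fix b'
      have "A x0 b' - A x b' = (\<Sum>b\<in>B. c b (A x0 b' - A x b') *\<^sub>R b)" by (simp add: B(3))
      then show "c b' (h v x0) *\<^sub>R (A x0 b' - A x b') = c b' (h v x0) *\<^sub>R (\<Sum>b\<in>B. (a b b' x0 - a b b' x) *\<^sub>R b)"
        by (simp add: a_def linear_diff[OF bounded_linear.linear[OF B(2)]])
    qed
    also have "inv_into UNIV (A x) \<dots> = (\<Sum>b'\<in>B. \<Sum>b\<in>B. c b' (h v x0) *\<^sub>R ((a b b' x - a b b' x0) *\<^sub>R (- h b x)))"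
      by (simp add: linear_sum[OF li] linear_cmul[OF li] h_def scaleR_sum_right flip: scaleR_minus_left)
    also have "\<dots> = (\<Sum>b\<in>B. \<Sum>b'\<in>B. c b' (h v x0) *\<^sub>R ((a b b' x - a b b' x0) *\<^sub>R (- h b x)))"
      by (rule sum.swap)
    finally show ?thesis by (simp add: algebra_simps)
  qed
  have der: "(h v has_derivative (\<lambda>u. \<Sum>b\<in>B. \<Sum>b'\<in>B. c b' (h v x0) *\<^sub>R (D (a b b') x0 u *\<^sub>R (- h b x0)))) (at x0)"
    if x0: "x0 \<in> S" for v x0
  proof -
    have t: "((\<lambda>x. c b' (h v x0) *\<^sub>R ((a b b' x - a b b' x0) *\<^sub>R (- h b x))) has_derivative
        (\<lambda>u. c b' (h v x0) *\<^sub>R (D (a b b') x0 u *\<^sub>R (- h b x0)))) (at x0)" for b b'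
    proof (rule has_derivative_scaleR_right[OF has_derivative_vanishing_scaleR])
      have "(a b b' has_derivative D (a b b') x0) (at x0)" by (rule smooth_on_has_derivative[OF sma x0])
      from has_derivative_diff[OF this has_derivative_const[of "a b b' x0"]]
      show "((\<lambda>x. a b b' x - a b b' x0) has_derivative D (a b b') x0) (at x0)" by simp
    qed (use cont[OF x0] in \<open>auto intro: continuous_intros\<close>)
    have "((\<lambda>x. h v x0 + (\<Sum>b\<in>B. \<Sum>b'\<in>B. c b' (h v x0) *\<^sub>R ((a b b' x - a b b' x0) *\<^sub>R (- h b x)))) has_derivative
        (\<lambda>u. 0 + (\<Sum>b\<in>B. \<Sum>b'\<in>B. c b' (h v x0) *\<^sub>R (D (a b b') x0 u *\<^sub>R (- h b x0))))) (at x0)"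
      by (rule has_derivative_add[OF has_derivative_const has_derivative_sum[OF has_derivative_sum[OF t]]])
    then have "((\<lambda>x. h v x0 + (\<Sum>b\<in>B. \<Sum>b'\<in>B. c b' (h v x0) *\<^sub>R ((a b b' x - a b b' x0) *\<^sub>R (- h b x)))) has_derivative
        (\<lambda>u. \<Sum>b\<in>B. \<Sum>b'\<in>B. c b' (h v x0) *\<^sub>R (D (a b b') x0 u *\<^sub>R (- h b x0)))) (at x0)" by simp
    then show ?thesis
      by (rule has_derivative_transform_within_open[OF _ S x0]) (rule eq[OF _ x0, symmetric])
  qed
  have "Ck_on n S (h v)" for n v
  proof (induction n arbitrary: v)
    case 0
    then show ?case by (auto intro!: continuous_at_imp_continuous_on cont)
  next
    case (Suc n)
    show ?case
    proof (rule Ck_on_SucI[OF S der])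
      fix u
      show "Ck_on n S (\<lambda>x. \<Sum>b\<in>B. \<Sum>b'\<in>B. c b' (h v x) *\<^sub>R (D (a b b') x u *\<^sub>R (- h b x)))"
      proof (intro Ck_on_sum Ck_on_scaleR S)
        fix b b'
        show "Ck_on n S (\<lambda>x. c b' (h v x))" by (rule Ck_on_bounded_linear_compose[OF S B(2) Suc])
        show "Ck_on n S (\<lambda>x. D (a b b') x u)" by (rule smooth_on_Ck[OF smooth_on_D[OF sma]])
        show "Ck_on n S (\<lambda>x. - h b x)"
          by (rule Ck_on_bounded_linear_compose[OF S bounded_linear_minus[OF bounded_linear_ident] Suc])
      qed
    qed
  qed
  then show ?thesis using S unfolding h_def by (intro smooth_onI)
qed

text \<open>
  The derivative of \<open>g\<close> at \<open>y\<close> is the inverse of \<open>D f (g y)\<close>, which is as often differentiable in \<open>y\<close> as \<open>g\<close>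
  itself; this bootstraps continuity to smoothness.
\<close>

lemma smooth_on_inverse:
  fixes f :: "'a::real_normed_vector \<Rightarrow> 'a"
  assumes fd: "finite_dimensional TYPE('a)" and f: "smooth_on S f" and bij: "\<And>x. x \<in> S \<Longrightarrow> bij (D f x)"
    and T: "open T" "continuous_on T g" "g ` T \<subseteq> S" "\<And>y. y \<in> T \<Longrightarrow> f (g y) = y"
  shows "smooth_on T g"
proof -
  have S: "open S" by (rule smooth_on_open[OF f])
  have lin: "linear (D f x)" if "x \<in> S" for x
    by (rule has_derivative_linear[OF smooth_on_has_derivative[OF f that]])
  note invD = bij_linear_inv[OF fd lin bij]
  have sm: "smooth_on S (\<lambda>x. inv_into UNIV (D f x) v)" for v
    by (rule smooth_on_inv_linear_family[OF fd S lin bij smooth_on_D[OF f]])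
  have der: "(g has_derivative inv_into UNIV (D f (g y))) (at y)" if y: "y \<in> T" for y
  proof -
    have gy: "g y \<in> S" using T(3) y by blast
    show ?thesis
    proof (rule has_derivative_inverse_basic[OF smooth_on_has_derivative[OF f gy] invD(1)[OF gy gy] _ _ T(1) y T(4)])
      show "inv_into UNIV (D f (g y)) \<circ> D f (g y) = id" using invD(3)[OF gy gy] by auto
      show "continuous (at y) g" using T y by (simp add: continuous_on_eq_continuous_at)
    qed
  qed
  have "Ck_on n T g" for n
  proof (induction n)
    case 0
    then show ?case using T(2) by simp
  next
    case (Suc n)
    show ?case
      by (rule Ck_on_SucI[OF T(1) der Ck_on_compose[OF fd T(1) S T(3) Suc smooth_on_Ck[OF sm]]])
  qed
  then show ?thesis using T(1) by (intro smooth_onI)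
qed

text \<open>
  A map that increases distances from \<open>x\<close> by a factor bounded below cannot vanish to first order in any
  direction.
\<close>

lemma expanding_imp_derivative_inj:
  fixes f :: "'a::real_normed_vector \<Rightarrow> 'b::real_normed_vector"
  assumes "(f has_derivative f') (at x)" "open U" "x \<in> U" "m > 0"
    "\<And>y. y \<in> U \<Longrightarrow> norm (f y - f x) \<ge> m * norm (y - x)" "f' v = 0"
  shows "v = 0"
proof (rule ccontr)
  assume "v \<noteq> 0"
  obtain d where d: "d > 0" "\<And>y. norm (y - x) < d \<Longrightarrow> norm (f y - f x - f' (y - x)) \<le> m / 2 * norm (y - x)"
    using assms(1,4) unfolding has_derivative_at_alt by (meson half_gt_zero)
  obtain r where r: "r > 0" "ball x r \<subseteq> U" using assms(2,3) open_contains_ball by blast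
  define s where "s = min d r / (2 * norm v)"
  have s: "s > 0" using \<open>v \<noteq> 0\<close> d(1) r(1) by (simp add: s_def)
  have ns: "norm (s *\<^sub>R v) = min d r / 2" using \<open>v \<noteq> 0\<close> d(1) r(1) by (simp add: s_def)
  have lin: "f' (s *\<^sub>R v) = 0"
    using linear_cmul[OF has_derivative_linear[OF assms(1)], of s v] assms(6) by simp
  have "norm (f (x + s *\<^sub>R v) - f x) \<le> m / 2 * norm (s *\<^sub>R v)"
    using d(2)[of "x + s *\<^sub>R v"] lin ns d(1) r(1) by simp
  moreover have "x + s *\<^sub>R v \<in> U" using r ns d(1) by (intro subsetD[OF r(2)]) (simp add: dist_norm)
  then have "norm (f (x + s *\<^sub>R v) - f x) \<ge> m * norm (s *\<^sub>R v)" using assms(5) by force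
  moreover have "m * norm (s *\<^sub>R v) > m / 2 * norm (s *\<^sub>R v)" using ns d(1) r(1) assms(4) by simp
  ultimately show False by linarith
qed

section \<open>The inverse function theorem and linear forms of submersions\<close>

text \<open>
  The equation \<open>x + R x = w\<close> is the fixed point equation of the contraction \<open>x \<mapsto> w - R x\<close>. The ball is
  compact, hence complete.
\<close>

lemma half_lipschitz_perturbation_covers:
  fixes R :: "'a::real_normed_vector \<Rightarrow> 'a"
  assumes fd: "finite_dimensional TYPE('a)" and "\<delta> \<ge> 0"
    and lip: "\<And>x y. x \<in> cball x0 \<delta> \<Longrightarrow> y \<in> cball x0 \<delta> \<Longrightarrow> norm (R x - R y) \<le> 1/2 * norm (x - y)"
    and w: "norm (w - (x0 + R x0)) \<le> \<delta> / 2"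
  obtains x where "x \<in> cball x0 \<delta>" "x + R x = w"
proof -
  have "\<exists>!x\<in>cball x0 \<delta>. w - R x = x"
  proof (rule Banach_fix[where c = "1/2"])
    show "complete (cball x0 \<delta>)" using finite_dimensional_cball_compact[OF fd] by (rule compact_imp_complete)
    show "cball x0 \<delta> \<noteq> {}" using assms(2) by auto
    show "(\<lambda>x. w - R x) ` cball x0 \<delta> \<subseteq> cball x0 \<delta>"
    proof safe
      fix x assume x: "x \<in> cball x0 \<delta>"
      have "norm (w - R x - x0) \<le> norm (w - (x0 + R x0)) + norm (R x0 - R x)"
        using norm_triangle_ineq[of "w - (x0 + R x0)" "R x0 - R x"] by (simp add: algebra_simps)
      also have "norm (R x0 - R x) \<le> 1/2 * norm (x0 - x)" by (rule lip) (use assms(2) x in auto)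
      also have "norm (x0 - x) \<le> \<delta>" using x by (simp add: dist_norm)
      finally show "w - R x \<in> cball x0 \<delta>" using w by (simp add: dist_norm norm_minus_commute)
    qed
    show "dist (w - R x) (w - R y) \<le> 1 / 2 * dist x y" if "x \<in> cball x0 \<delta>" "y \<in> cball x0 \<delta>" for x y
      using lip[OF that] by (simp add: dist_norm norm_minus_commute)
  qed auto
  then obtain x where x: "x \<in> cball x0 \<delta>" "w - R x = x" by blast
  from x(2) have "x + R x = w" by (metis diff_add_cancel)
  then show ?thesis using that x(1) by blast
qed

lemma half_lipschitz_perturbation_expands:
  fixes R :: "'a::real_normed_vector \<Rightarrow> 'a"
  assumes "norm (R x - R y) \<le> 1/2 * norm (x - y)"
  shows "norm ((x + R x) - (y + R y)) \<ge> 1/2 * norm (x - y)"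
  using norm_triangle_ineq4[of "(x + R x) - (y + R y)" "R x - R y"] assms by (simp add: algebra_simps)

text \<open>
  After composing with the inverse \<open>J\<close> of the derivative at \<open>q\<close>, the map is the identity plus a map \<open>R\<close>
  with derivative zero at \<open>q\<close>, hence with Lipschitz constant one half near \<open>q\<close>.
\<close>

lemma smooth_local_inverse:
  fixes f :: "'a::real_normed_vector \<Rightarrow> 'a"
  assumes fd: "finite_dimensional TYPE('a)" and f: "smooth_on S f" "q \<in> S" "bij (D f q)"
  obtains U g where "open U" "q \<in> U" "U \<subseteq> S" "open (f ` U)" "\<And>x. x \<in> U \<Longrightarrow> g (f x) = x"
    "smooth_on (f ` U) g"
proof -
  let ?A = "D f q"
  define J where "J = inv_into UNIV ?A"
  have linA: "linear ?A" by (rule has_derivative_linear[OF smooth_on_has_derivative[OF f(1,2)]])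
  note invA = bij_linear_inv[OF fd linA f(3), folded J_def]
  have blA: "bounded_linear ?A" by (rule finite_dimensional_bounded_linear[OF fd linA])
  obtain K where K: "K > 0" "\<And>v. norm (J v) \<le> norm v * K" using bounded_linear.pos_bounded[OF invA(1)] by blast
  obtain r C where rC: "r > 0" "C > 0" "ball q r \<subseteq> S"
    "\<And>x y v. x \<in> ball q r \<Longrightarrow> y \<in> ball q r \<Longrightarrow> norm (D f x v - D f y v) \<le> C * norm (x - y) * norm v"
    using smooth_on_derivative_locally_lipschitz[OF fd f(1,2)] by metis
  \<comment> \<open>Chosen so that the derivative of R has norm at most one half on the ball.\<close>
  define \<rho> where "\<rho> = min r (1 / (2 * C * K))"
  have \<rho>: "\<rho> > 0" "\<rho> \<le> r" "C * \<rho> * K \<le> 1/2"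
    using rC K by (auto simp: \<rho>_def min_def field_simps)
  define U where "U = ball q \<rho>"
  have US: "U \<subseteq> S" using rC(3) \<rho>(2) subset_ball[of \<rho> r q] by (auto simp: U_def)
  define R where "R x = J (f x) - x" for x
  have Rlip: "norm (R x - R y) \<le> 1/2 * norm (x - y)" if "x \<in> U" "y \<in> U" for x y
  proof (rule differentiable_bound[of U R "\<lambda>x v. J (D f x v) - v"])
    show "(R has_derivative (\<lambda>v. J (D f x v) - v)) (at x within U)" if "x \<in> U" for x
    proof -
      have "(f has_derivative D f x) (at x)" by (rule smooth_on_has_derivative[OF f(1)]) (use that US in blast)
      from has_derivative_diff[OF bounded_linear.has_derivative[OF invA(1) this] has_derivative_ident]
      show ?thesis unfolding R_def by (rule has_derivative_at_withinI)
    qed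
    show "onorm (\<lambda>v. J (D f x v) - v) \<le> 1/2" if x: "x \<in> U" for x
    proof (rule onorm_bound)
      fix v
      have "J (D f x v) - v = J (D f x v - D f q v)"
        using invA(3)[of v] by (simp add: linear_diff[OF bounded_linear.linear[OF invA(1)]])
      also have "norm \<dots> \<le> norm (D f x v - D f q v) * K" by (rule K(2))
      also have "norm (D f x v - D f q v) \<le> C * norm (x - q) * norm v"
        by (rule rC(4)) (use x \<rho> rC(1) in \<open>auto simp: U_def\<close>)
      also have "C * norm (x - q) * norm v \<le> C * \<rho> * norm v"
        using x rC(2) by (intro mult_right_mono mult_left_mono) (auto simp: U_def dist_norm norm_minus_commute)
      finally have "norm (J (D f x v) - v) \<le> (C * \<rho> * K) * norm v" using K(1) by (simp add: mult_ac)
      also have "\<dots> \<le> 1/2 * norm v" using \<rho>(3) by (rule mult_right_mono) simp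
      finally show "norm (J (D f x v) - v) \<le> 1/2 * norm v" .
    qed simp
  qed (use that in \<open>auto simp: U_def\<close>)
  have Jf: "J (f x) = x + R x" for x by (simp add: R_def)
  have expand: "norm (f x - f y) \<ge> 1 / (2 * K) * norm (x - y)" if "x \<in> U" "y \<in> U" for x y
  proof -
    have "1/2 * norm (x - y) \<le> norm (J (f x) - J (f y))"
      unfolding Jf by (rule half_lipschitz_perturbation_expands[OF Rlip[OF that]])
    also have "J (f x) - J (f y) = J (f x - f y)" by (simp add: linear_diff[OF bounded_linear.linear[OF invA(1)]])
    also have "norm \<dots> \<le> norm (f x - f y) * K" by (rule K(2))
    finally show ?thesis using K(1) by (simp add: field_simps)
  qed
  have inj: "inj_on f U"
  proof (rule inj_onI)
    fix x y assume "x \<in> U" "y \<in> U" "f x = f y"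
    then show "x = y" using expand[of x y] K(1) by (simp add: field_simps)
  qed
  have "open ((\<lambda>x. x + R x) ` U)"
  proof (subst open_contains_ball, safe)
    fix x assume "x \<in> U"
    then obtain e where e: "e > 0" "cball x e \<subseteq> U" using open_contains_cball open_ball unfolding U_def by metis
    have "ball (x + R x) (e/2) \<subseteq> (\<lambda>x. x + R x) ` U"
    proof
      fix w assume "w \<in> ball (x + R x) (e/2)"
      then have w: "norm (w - (x + R x)) \<le> e/2" by (simp add: dist_norm norm_minus_commute)
      have "norm (R a - R b) \<le> 1/2 * norm (a - b)" if "a \<in> cball x e" "b \<in> cball x e" for a b
        using Rlip e(2) that by blast
      from half_lipschitz_perturbation_covers[where R = R, OF fd less_imp_le[OF e(1)] this w]
      obtain y where "y \<in> cball x e" "y + R y = w" by blast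
      then show "w \<in> (\<lambda>x. x + R x) ` U" using e(2) by (metis image_eqI subsetD)
    qed
    then show "\<exists>e>0. ball (x + R x) e \<subseteq> (\<lambda>x. x + R x) ` U" using e(1) by (intro exI[of _ "e/2"]) auto
  qed
  moreover have "f ` U = J -` ((\<lambda>x. x + R x) ` U)"
  proof -
    have "w \<in> f ` U" if "J w = x + R x" "x \<in> U" for w x
    proof -
      have "J w = J (f x)" using that Jf by simp
      then have "w = f x" using invA(2) by metis
      then show ?thesis using that(2) by simp
    qed
    then show ?thesis using Jf by (auto simp: image_iff)
  qed
  moreover have "open (J -` X)" if "open X" for X
    by (rule open_vimage[OF that linear_continuous_on[OF invA(1)]])
  ultimately have op: "open (f ` U)" by simp
  define g where "g = inv_into U f"
  have gf: "g (f x) = x" if "x \<in> U" for x using inj that by (simp add: g_def)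
  have "bij (D f x)" if x: "x \<in> U" for x
  proof (rule finite_dimensional_inj_imp_bij[OF fd])
    have d: "(f has_derivative D f x) (at x)" using smooth_on_has_derivative[OF f(1)] x US by blast
    then show "linear (D f x)" by (rule has_derivative_linear)
    show "v = 0" if "D f x v = 0" for v
      by (rule expanding_imp_derivative_inj[OF d _ x _ _ that, of "1 / (2 * K)"]) (use x expand K(1) in \<open>auto simp: U_def\<close>)
  qed
  moreover have "continuous_on (f ` U) g"
  proof (rule continuous_on_iff[THEN iffD2], intro ballI allI impI)
    fix y e assume y: "y \<in> f ` U" and e: "(e::real) > 0"
    show "\<exists>d>0. \<forall>x'\<in>f ` U. dist x' y < d \<longrightarrow> dist (g x') (g y) < e"
    proof (intro exI[of _ "e / (2 * K)"] conjI ballI impI)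
      fix z assume z: "z \<in> f ` U" "dist z y < e / (2 * K)"
      obtain a b where ab: "a \<in> U" "b \<in> U" "z = f a" "y = f b" using y z by blast
      then have "norm (a - b) < e" using expand[of a b] z(2) K(1) by (simp add: dist_norm field_simps)
      then show "dist (g z) (g y) < e" using ab gf by (simp add: dist_norm)
    qed (use e K in simp)
  qed
  moreover have "smooth_on U f" using smooth_on_subset[OF f(1) _ US] by (simp add: U_def)
  ultimately have "smooth_on (f ` U) g"
    by (intro smooth_on_inverse[OF fd _ _ op, of U f g]) (use gf in auto)
  then show ?thesis using that[of U g] op gf US \<rho>(1) by (auto simp: U_def)
qed

text \<open>
  Let \<open>L\<close> be the derivative of \<open>a\<close> at \<open>q\<close> and \<open>R\<close> a linear right inverse of \<open>L\<close>. The map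
  \<open>F x = R (a x) + (x - R (L x))\<close> of the space into itself has the identity as derivative at \<open>q\<close>, and
  \<open>L (F x) = a x\<close>. So \<open>F\<close> is a local change of coordinates that makes \<open>a\<close> equal to \<open>L\<close>, without splitting
  the space into a product.
\<close>

lemma submersion_straighten:
  fixes a :: "'h::real_normed_vector \<Rightarrow> 'k::real_normed_vector"
  assumes fd: "finite_dimensional TYPE('h)" "finite_dimensional TYPE('k)"
    and a: "smooth_on N a" "q \<in> N" "surj (D a q)"
  obtains U F G where "open U" "q \<in> U" "U \<subseteq> N" "smooth_on U F" "open (F ` U)" "\<And>x. x \<in> U \<Longrightarrow> G (F x) = x"
    "smooth_on (F ` U) G" "\<And>x. x \<in> U \<Longrightarrow> D a q (F x) = a x"
proof -
  let ?L = "D a q"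
  have der: "(a has_derivative ?L) (at q)" by (rule smooth_on_has_derivative[OF a(1,2)])
  have lin: "linear ?L" by (rule has_derivative_linear[OF der])
  have bl: "bounded_linear ?L" by (rule has_derivative_bounded_linear[OF der])
  obtain R where R: "linear R" "?L \<circ> R = id"
    using real_vector.linear_surjective_right_inverse[OF _ a(3)] lin unfolding linear_def by blast
  have LR: "?L (R x) = x" for x using R(2) by (metis comp_apply id_apply)
  have blR: "bounded_linear R" by (rule finite_dimensional_bounded_linear[OF fd(2) R(1)])
  define F where "F x = R (a x) + (x - R (?L x))" for x
  have smF: "smooth_on N F" unfolding F_def
    by (intro smooth_on_add smooth_on_diff smooth_on_id smooth_on_open[OF a(1)]
        smooth_on_bounded_linear_compose[OF blR] a(1) smooth_on_bounded_linear[OF _ bl])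
  have "(F has_derivative (\<lambda>v. R (?L v) + (v - R (?L v)))) (at q)" unfolding F_def
    by (intro has_derivative_add has_derivative_diff bounded_linear.has_derivative[OF blR] der has_derivative_ident
        bounded_linear.has_derivative[OF bl])
  then have "(F has_derivative (\<lambda>v. v)) (at q)" by simp
  then have "D F q = (\<lambda>v. v)" using frechet_derivative_at by metis
  then have bij: "bij (D F q)" by (simp add: bij_def)
  obtain U G where UG: "open U" "q \<in> U" "U \<subseteq> N" "open (F ` U)" "\<And>x. x \<in> U \<Longrightarrow> G (F x) = x"
    "smooth_on (F ` U) G"
    using smooth_local_inverse[OF fd(1) smF a(2) bij] by metis
  have "?L (F x) = a x" for x
    by (simp add: F_def linear_add[OF lin] linear_diff[OF lin] LR)
  then show ?thesis using that[of U F G] UG smooth_on_subset[OF smF UG(1,3)] by blast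
qed

section \<open>Bump functions\<close>

text \<open>
  The family is closed under differentiation up to linear combinations, and \<open>k = 0\<close> is the classical
  smooth function that is flat at the origin.
\<close>

definition flat_exp :: "nat \<Rightarrow> real \<Rightarrow> real" where
  "flat_exp k x = (if x > 0 then (1 / x) ^ k * exp (- (1 / x)) else 0)"

lemma flat_exp_tendsto: "(flat_exp k \<longlongrightarrow> 0) (at 0)"
proof -
  have "((\<lambda>y. y ^ k / exp y) \<longlongrightarrow> (0::real)) at_top" by (rule tendsto_power_div_exp_0)
  then have "((\<lambda>x. inverse x ^ k / exp (inverse x)) \<longlongrightarrow> (0::real)) (at_right 0)"
    by (rule filterlim_compose) (rule filterlim_inverse_at_top_right)
  then have "(flat_exp k \<longlongrightarrow> 0) (at_right 0)"
    by (rule tendsto_cong[THEN iffD1, rotated])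
      (auto simp: eventually_at_filter flat_exp_def exp_minus field_simps)
  moreover have "(flat_exp k \<longlongrightarrow> 0) (at_left 0)"
    by (rule tendsto_cong[THEN iffD2, OF _ tendsto_const]) (auto simp: eventually_at_filter flat_exp_def)
  ultimately show ?thesis by (simp add: filterlim_split_at)
qed

lemma flat_exp_has_derivative:
  "(flat_exp k has_real_derivative (flat_exp (k + 2) x - real k * flat_exp (k + 1) x)) (at x)"
proof -
  consider "x > 0" | "x < 0" | "x = 0" by linarith
  then show ?thesis
  proof cases
    case 1
    define y where "y = 1 / x"
    have d1: "((\<lambda>x. 1 / x) has_real_derivative - (y * y)) (at x)"
      using 1 by (auto intro!: derivative_eq_intros simp: y_def)
    have d2: "((\<lambda>y. y ^ k * exp (- y)) has_real_derivative (real k * y ^ (k - 1) * exp (- y) - y ^ k * exp (- y))) (at y)"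
      by (auto intro!: derivative_eq_intros)
    have "((\<lambda>x. (1 / x) ^ k * exp (- (1 / x))) has_real_derivative
        (real k * y ^ (k - 1) * exp (- y) - y ^ k * exp (- y)) * - (y * y)) (at x)"
      using DERIV_chain2[OF d2[unfolded y_def] d1] by (simp only: y_def)
    moreover have "(real k * y ^ (k - 1) * exp (- y) - y ^ k * exp (- y)) * - (y * y)
        = flat_exp (k + 2) x - real k * flat_exp (k + 1) x"
      using 1 unfolding flat_exp_def y_def[symmetric] by (cases k) (simp_all add: algebra_simps)
    ultimately have "((\<lambda>x. (1 / x) ^ k * exp (- (1 / x))) has_real_derivative
        (flat_exp (k + 2) x - real k * flat_exp (k + 1) x)) (at x)" by simp
    then show ?thesis
      by (rule has_field_derivative_transform_within_open[of _ _ _ "{0<..}"]) (use 1 in \<open>auto simp: flat_exp_def\<close>)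
  next
    case 2
    have "((\<lambda>x. 0) has_real_derivative (flat_exp (k + 2) x - real k * flat_exp (k + 1) x)) (at x)"
      using 2 by (auto simp: flat_exp_def)
    then show ?thesis
      by (rule has_field_derivative_transform_within_open[of _ _ _ "{..<0}"]) (use 2 in \<open>auto simp: flat_exp_def\<close>)
  next
    case 3
    have "((\<lambda>h. (flat_exp k (0 + h) - flat_exp k 0) / h) \<longlongrightarrow> 0) (at 0)"
      by (rule tendsto_cong[THEN iffD1, OF _ flat_exp_tendsto[of "Suc k"]])
        (auto simp: eventually_at_filter flat_exp_def)
    then show ?thesis using 3 by (simp add: DERIV_def flat_exp_def)
  qed
qed

lemma flat_exp_smooth: "smooth_on UNIV (flat_exp k)"
proof (rule smooth_onI)
  show "Ck_on n UNIV (flat_exp k)" for n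
  proof (induction n arbitrary: k)
    case 0
    then show ?case
      using DERIV_isCont[OF flat_exp_has_derivative] by (auto intro!: continuous_at_imp_continuous_on)
  next
    case (Suc n)
    show ?case
    proof (rule Ck_on_SucI)
      show "(flat_exp k has_derivative (\<lambda>v. (flat_exp (k + 2) x - real k * flat_exp (k + 1) x) * v)) (at x)" for x
        using flat_exp_has_derivative[of k x] by (simp add: has_field_derivative_def)
      show "Ck_on n UNIV (\<lambda>x. (flat_exp (k + 2) x - real k * flat_exp (k + 1) x) * v)" for v
      proof -
        have "Ck_on n UNIV (\<lambda>x. v *\<^sub>R flat_exp (k + 2) x + (- (v * real k)) *\<^sub>R flat_exp (k + 1) x)"
          by (rule Ck_on_add[OF open_UNIV]; rule Ck_on_scaleR[OF open_UNIV Ck_on_const[OF open_UNIV] Suc])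
        then show ?thesis by (simp add: algebra_simps)
      qed
    qed simp
  qed
qed simp

text \<open>
  The norm need not be smooth away from the origin, so the radial variable is the sum of the squares of
  the coordinates. The global Lipschitz constant exists because the derivative vanishes off a compact
  set.
\<close>

lemma smooth_bump:
  fixes x0 :: "'a::real_normed_vector"
  assumes fd: "finite_dimensional TYPE('a)" and "r > 0"
  obtains \<eta> :: "'a \<Rightarrow> real" and K where "smooth_on UNIV \<eta>" "\<eta> x0 = 1" "\<And>x. \<eta> x \<in> {0..1}"
    "\<And>x. x \<notin> cball x0 r \<Longrightarrow> \<eta> x = 0" "K > 0" "\<And>x y. \<bar>\<eta> x - \<eta> y\<bar> \<le> K * norm (x - y)"
proof -
  obtain B :: "'a set" and c where B: "finite B" "\<And>b. bounded_linear (c b)" "\<And>v. (\<Sum>b\<in>B. c b v *\<^sub>R b) = v"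
    using finite_dimensional_coordinates[OF fd] by metis
  \<comment> \<open>Coordinates bounded by s force the norm to be at most r.\<close>
  define s where "s = r / (1 + (\<Sum>b\<in>B. norm b))"
  have pos: "1 + (\<Sum>b\<in>B. norm b) > 0" by (simp add: add_pos_nonneg sum_nonneg)
  have s: "s > 0" using pos \<open>r > 0\<close> by (simp add: s_def)
  define Q where "Q x = (\<Sum>b\<in>B. c b (x - x0) *\<^sub>R c b (x - x0))" for x
  have Qpos: "Q x \<ge> 0" for x unfolding Q_def by (intro sum_nonneg) simp
  have Q0: "Q x0 = 0" by (simp add: Q_def linear_0[OF bounded_linear.linear[OF B(2)]])
  have smQ: "smooth_on UNIV Q" unfolding Q_def
    by (intro smooth_on_sum smooth_on_scaleR smooth_on_bounded_linear_compose[OF B(2)] smooth_on_diff smooth_on_id smooth_on_const) auto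
  define \<eta> where "\<eta> x = (1 / flat_exp 0 (s\<^sup>2)) *\<^sub>R flat_exp 0 (s\<^sup>2 - Q x)" for x
  have fs: "flat_exp 0 (s\<^sup>2) > 0" using s by (simp add: flat_exp_def)
  have sm: "smooth_on UNIV \<eta>" unfolding \<eta>_def
    by (intro smooth_on_scaleR smooth_on_const smooth_on_compose[OF finite_dimensional_euclidean flat_exp_smooth]
        smooth_on_diff smQ) auto
  have one: "\<eta> x0 = 1" using fs by (simp add: \<eta>_def Q0)
  have supp: "\<eta> x = 0" if "x \<notin> cball x0 r" for x
  proof (rule ccontr)
    assume "\<eta> x \<noteq> 0"
    then have "Q x < s\<^sup>2" by (auto simp: \<eta>_def flat_exp_def split: if_splits)
    have cb: "\<bar>c b (x - x0)\<bar> \<le> s" if "b \<in> B" for b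
    proof -
      have "(c b (x - x0))\<^sup>2 \<le> Q x" unfolding Q_def
        using member_le_sum[OF that, of "\<lambda>b. c b (x - x0) *\<^sub>R c b (x - x0)"] B(1) by (simp add: power2_eq_square)
      then have "(c b (x - x0))\<^sup>2 \<le> s\<^sup>2" using \<open>Q x < s\<^sup>2\<close> by linarith
      then show ?thesis using s abs_le_square_iff[of "c b (x - x0)" s] by simp
    qed
    have "norm (x - x0) = norm (\<Sum>b\<in>B. c b (x - x0) *\<^sub>R b)" by (simp add: B(3))
    also have "\<dots> \<le> (\<Sum>b\<in>B. norm (c b (x - x0) *\<^sub>R b))" by (rule norm_sum)
    also have "\<dots> \<le> (\<Sum>b\<in>B. s * norm b)" using cb by (intro sum_mono) (simp add: mult_right_mono)
    also have "\<dots> = s * (\<Sum>b\<in>B. norm b)" by (simp add: sum_distrib_left)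
    also have "\<dots> \<le> s * (1 + (\<Sum>b\<in>B. norm b))" using s by simp
    also have "\<dots> = r" using pos by (simp add: s_def)
    finally show False using that by (simp add: dist_norm norm_minus_commute)
  qed
  have range: "\<eta> x \<in> {0..1}" for x
  proof -
    have "flat_exp 0 (s\<^sup>2 - Q x) \<le> flat_exp 0 (s\<^sup>2)" using Qpos[of x] s
      by (auto simp: flat_exp_def intro!: divide_left_mono mult_pos_pos)
    moreover have "flat_exp 0 (s\<^sup>2 - Q x) \<ge> 0" by (simp add: flat_exp_def)
    ultimately show ?thesis using fs by (simp add: \<eta>_def)
  qed
  obtain Kc where Kc: "\<And>b. Kc b > 0"
    "\<And>(l::'a \<Rightarrow> real) v. linear l \<Longrightarrow> norm (l v) \<le> (\<Sum>b\<in>B. Kc b * norm (l b)) * norm v"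
    using linear_bound_by_coordinates[OF B] by metis
  have der: "(\<eta> has_derivative D \<eta> x) (at x)" for x using smooth_on_has_derivative[OF sm] by simp
  have "\<exists>M\<ge>0. \<forall>x. norm (D \<eta> x b) \<le> M" for b
  proof -
    have "continuous_on (cball x0 r) (\<lambda>x. D \<eta> x b)"
      using smooth_on_continuous_on[OF smooth_on_D[OF sm]] continuous_on_subset by blast
    then have "bounded ((\<lambda>x. D \<eta> x b) ` cball x0 r)"
      using finite_dimensional_cball_compact[OF fd] compact_continuous_image compact_imp_bounded by blast
    then obtain M where M: "M > 0" "\<And>x. x \<in> cball x0 r \<Longrightarrow> norm (D \<eta> x b) \<le> M"
      unfolding bounded_pos by blast
    have "norm (D \<eta> x b) \<le> M" for x
    proof (cases "x \<in> cball x0 r")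
      case False
      have "((\<lambda>_. 0) has_derivative D \<eta> x) (at x)"
        by (rule has_derivative_transform_within_open[OF der, of "- cball x0 r"]) (use False supp in auto)
      then have "D \<eta> x = (\<lambda>_. 0)" using has_derivative_unique has_derivative_const by blast
      then show ?thesis using M(1) by simp
    qed (rule M(2))
    then show ?thesis using M(1) by (intro exI[of _ M]) auto
  qed
  then obtain M where M: "\<And>b. M b \<ge> 0" "\<And>b x. norm (D \<eta> x b) \<le> M b" by metis
  define K where "K = 1 + (\<Sum>b\<in>B. Kc b * M b)"
  have "(\<Sum>b\<in>B. Kc b * M b) \<ge> 0" using Kc(1) M(1) by (intro sum_nonneg) (simp add: less_imp_le)
  then have K: "K > 0" unfolding K_def by linarith
  have "norm (\<eta> x - \<eta> y) \<le> K * norm (x - y)" for x y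
  proof (rule differentiable_bound[of UNIV \<eta> "D \<eta>"])
    show "onorm (D \<eta> x) \<le> K" for x
    proof (rule onorm_bound)
      fix v
      have "norm (D \<eta> x v) \<le> (\<Sum>b\<in>B. Kc b * norm (D \<eta> x b)) * norm v"
        by (rule Kc(2)[OF has_derivative_linear[OF der]])
      also have "\<dots> \<le> (\<Sum>b\<in>B. Kc b * M b) * norm v"
        using Kc(1) M(2) by (intro mult_right_mono sum_mono mult_left_mono) (auto simp: less_imp_le)
      also have "\<dots> \<le> K * norm v" by (simp add: K_def mult_right_mono)
      finally show "norm (D \<eta> x v) \<le> K * norm v" .
    qed (use K in simp)
  qed (use der in auto)
  then show ?thesis using that[of \<eta> K] sm one range supp K by simp
qed

section \<open>Small diffeomorphisms with compact support\<close>

text \<open>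
  The mean value inequality for \<open>z \<mapsto> b (z + u) - b z\<close>, whose derivative is of the order of \<open>u\<close>.
\<close>

lemma second_difference_bound:
  fixes b :: "'h::real_normed_vector \<Rightarrow> 'e::real_normed_vector"
  assumes b: "smooth_on Z b" "ball z0 r \<subseteq> Z"
    and lip: "\<And>x y v. x \<in> ball z0 r \<Longrightarrow> y \<in> ball z0 r \<Longrightarrow> norm (D b x v - D b y v) \<le> C * norm (x - y) * norm v"
    and C: "C \<ge> 0" and zw: "z \<in> ball z0 (r/2)" "w \<in> ball z0 (r/2)" "norm u < r/2"
  shows "norm ((b (z + u) - b z) - (b (w + u) - b w)) \<le> C * norm u * norm (z - w)"
proof (rule differentiable_bound[of "ball z0 (r/2)" "\<lambda>x. b (x + u) - b x" "\<lambda>x v. D b (x + u) v - D b x v"])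
  have in_ball: "x + u \<in> ball z0 r" "x \<in> ball z0 r" if "x \<in> ball z0 (r/2)" for x
    using that zw(3) norm_triangle_ineq4[of "z0 - x" u] norm_ge_zero[of u]
    by (auto simp: dist_norm algebra_simps simp del: norm_ge_zero)
  show "((\<lambda>x. b (x + u) - b x) has_derivative (\<lambda>v. D b (x + u) v - D b x v)) (at x within ball z0 (r/2))"
    if "x \<in> ball z0 (r/2)" for x
  proof -
    have "(b has_derivative D b (x + u)) (at (x + u))" "(b has_derivative D b x) (at x)"
      using smooth_on_has_derivative[OF b(1)] b(2) in_ball[OF that] by blast+
    moreover have "((\<lambda>x. x + u) has_derivative (\<lambda>v. v)) (at x)" by (auto intro!: derivative_eq_intros)
    ultimately have "((\<lambda>x. b (x + u) - b x) has_derivative (\<lambda>v. D b (x + u) v - D b x v)) (at x)"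
      using has_derivative_diff has_derivative_compose[of "\<lambda>x. x + u" "\<lambda>v. v" x UNIV b] by blast
    then show ?thesis by (rule has_derivative_at_withinI)
  qed
  show "onorm (\<lambda>v. D b (x + u) v - D b x v) \<le> C * norm u" if "x \<in> ball z0 (r/2)" for x
    by (rule onorm_bound) (use lip[OF in_ball[OF that]] C in auto)
qed (use zw in auto)

text \<open>
  If one point lies outside the ball, the segment to it leaves the support of \<open>R\<close> while still inside
  the ball; this intermediate point replaces the far one.
\<close>

lemma lipschitz_extend_by_zero:
  fixes R :: "'a::real_normed_vector \<Rightarrow> 'b::real_normed_vector"
  assumes "0 < s" "s < r" "c \<ge> 0"
    and lip: "\<And>x y. x \<in> ball x0 r \<Longrightarrow> y \<in> ball x0 r \<Longrightarrow> norm (R x - R y) \<le> c * norm (x - y)"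
    and zero: "\<And>x. x \<notin> cball x0 s \<Longrightarrow> R x = 0"
  shows "norm (R x - R y) \<le> c * norm (x - y)"
proof -
  have one: "norm (R x - R y) \<le> c * norm (x - y)" if xy: "x \<in> cball x0 s" "y \<notin> ball x0 r" for x y
  proof -
    let ?p = "\<lambda>t. norm (x0 - (x + t *\<^sub>R (y - x)))"
    obtain t where t: "0 \<le> t" "t \<le> 1" "?p t = (s + r) / 2"
      using IVT'[of ?p 0 "(s + r) / 2" 1] xy assms(2)
      by (auto simp: dist_norm continuous_intros)
    define z where "z = x + t *\<^sub>R (y - x)"
    have "z \<in> ball x0 r" "z \<notin> cball x0 s" using t(3) assms(2) by (auto simp: z_def dist_norm)
    then have "norm (R x - R z) \<le> c * norm (x - z)" "R z = 0" "R y = 0"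
      using lip[of x z] zero xy assms(2) by auto
    moreover have "norm (x - z) \<le> norm (x - y)"
      using t(1,2) mult_left_le_one_le[of "norm (y - x)" t] by (simp add: z_def norm_minus_commute)
    ultimately show ?thesis using mult_left_mono[of "norm (x - z)" "norm (x - y)" c] assms(3) by simp
  qed
  have sub: "cball x0 s \<subseteq> ball x0 r" using assms(2) by auto
  consider "x \<in> ball x0 r" "y \<in> ball x0 r" | "x \<in> cball x0 s" "y \<notin> ball x0 r" | "y \<in> cball x0 s" "x \<notin> ball x0 r"
    | "x \<notin> cball x0 s" "y \<notin> cball x0 s"
    using sub by blast
  then show ?thesis
  proof cases
    case 3 then show ?thesis using one[of y x] by (simp add: norm_minus_commute)
  next
    case 4 then show ?thesis using zero assms(3) by simp
  qed (use lip one in auto)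
qed

text \<open>
  The analytic core of the construction of bisections: \<open>\<zeta>\<close> is the section of units in a chart, \<open>b\<close> the
  target map. The map \<open>y \<mapsto> b (\<zeta> y + \<eta> y t)\<close> differs from the identity by a map vanishing off the support
  of the bump function \<open>\<eta>\<close>, whose Lipschitz constant is proportional to the norm of \<open>t\<close>: the second
  difference bound controls the variation of \<open>\<zeta>\<close>, the Lipschitz bound of \<open>b\<close> the variation of \<open>\<eta>\<close>. The
  parameter \<open>s\<close> in the conclusion describes the path from the section of units to the perturbed one.
\<close>

lemma small_diffeomorphisms:
  fixes \<zeta> :: "'e::real_normed_vector \<Rightarrow> 'h::real_normed_vector" and b :: "'h \<Rightarrow> 'e"
  assumes fd: "finite_dimensional TYPE('e)" "finite_dimensional TYPE('h)"
    and \<zeta>: "smooth_on Y0 \<zeta>" "y0 \<in> Y0" and b: "smooth_on Z b" "\<zeta> ` Y0 \<subseteq> Z"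
    and sec: "\<And>y. y \<in> Y0 \<Longrightarrow> b (\<zeta> y) = y"
  obtains \<eta> K \<epsilon> where "smooth_on UNIV \<eta>" "\<eta> y0 = (1::real)" "compact K" "K \<subseteq> Y0" "\<And>y. y \<notin> K \<Longrightarrow> \<eta> y = 0"
    "\<epsilon> > 0"
    "\<And>t y s. norm t < \<epsilon> \<Longrightarrow> y \<in> Y0 \<Longrightarrow> s \<in> {0..1} \<Longrightarrow> \<zeta> y + (s * \<eta> y) *\<^sub>R t \<in> Z"
    "\<And>t. norm t < \<epsilon> \<Longrightarrow> \<exists>T T'. smooth_on UNIV T \<and> smooth_on UNIV T' \<and> (\<forall>y. T' (T y) = y) \<and> (\<forall>y. T (T' y) = y) \<and>
        (\<forall>y\<in>Y0. T y = b (\<zeta> y + \<eta> y *\<^sub>R t)) \<and> (\<forall>y. y \<notin> K \<longrightarrow> T y = y)"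
proof -
  have z0: "\<zeta> y0 \<in> Z" using \<zeta>(2) b(2) by blast
  obtain r1 C1 where r1: "r1 > 0" "C1 > 0" "ball y0 r1 \<subseteq> Y0"
    "\<And>x y. x \<in> ball y0 r1 \<Longrightarrow> y \<in> ball y0 r1 \<Longrightarrow> norm (\<zeta> x - \<zeta> y) \<le> C1 * norm (x - y)"
    using C1_locally_lipschitz[OF fd(1) smooth_on_open[OF \<zeta>(1)] smooth_on_Ck[OF \<zeta>(1)] \<zeta>(2)] by metis
  obtain r2 C2 where r2: "r2 > 0" "C2 > 0" "ball (\<zeta> y0) r2 \<subseteq> Z"
    "\<And>x y. x \<in> ball (\<zeta> y0) r2 \<Longrightarrow> y \<in> ball (\<zeta> y0) r2 \<Longrightarrow> norm (b x - b y) \<le> C2 * norm (x - y)"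
    using C1_locally_lipschitz[OF fd(2) smooth_on_open[OF b(1)] smooth_on_Ck[OF b(1)] z0] by metis
  obtain r3 C3 where r3: "r3 > 0" "C3 > 0" "ball (\<zeta> y0) r3 \<subseteq> Z"
    "\<And>x y v. x \<in> ball (\<zeta> y0) r3 \<Longrightarrow> y \<in> ball (\<zeta> y0) r3 \<Longrightarrow> norm (D b x v - D b y v) \<le> C3 * norm (x - y) * norm v"
    using smooth_on_derivative_locally_lipschitz[OF fd(2) b(1) z0] by metis
  define \<rho> where "\<rho> = min r2 r3"
  have \<rho>: "\<rho> > 0" "ball (\<zeta> y0) \<rho> \<subseteq> ball (\<zeta> y0) r2" "ball (\<zeta> y0) \<rho> \<subseteq> ball (\<zeta> y0) r3"
    using r2(1) r3(1) by (auto simp: \<rho>_def)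
  define r where "r = min r1 (\<rho> / (2 * C1))"
  have r: "r > 0" "r \<le> r1" "C1 * r \<le> \<rho> / 2" using r1 \<rho>(1) by (auto simp: r_def min_def field_simps)
  have rY: "ball y0 r \<subseteq> Y0" using r1(3) r(2) subset_ball[of r r1 y0] by blast
  have \<zeta>ball: "\<zeta> y \<in> ball (\<zeta> y0) (\<rho>/2)" if "y \<in> ball y0 r" for y
  proof -
    have "norm (\<zeta> y0 - \<zeta> y) \<le> C1 * norm (y0 - y)" by (rule r1(4)) (use that r r1(1) in auto)
    also have "\<dots> < C1 * r" using that r1(2) by (simp add: dist_norm)
    finally show ?thesis using r(3) by (simp add: dist_norm)
  qed
  obtain \<eta> :: "'e \<Rightarrow> real" and Q where \<eta>: "smooth_on UNIV \<eta>" "\<eta> y0 = 1" "\<And>y. \<eta> y \<in> {0..1}"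
    "\<And>y. y \<notin> cball y0 (r/2) \<Longrightarrow> \<eta> y = 0" "Q > 0" "\<And>x y. \<bar>\<eta> x - \<eta> y\<bar> \<le> Q * norm (x - y)"
    using smooth_bump[OF fd(1), of "r/2" y0] r(1) by (metis half_gt_zero)
  define K where "K = cball y0 (r/2)"
  have K: "compact K" unfolding K_def by (rule finite_dimensional_cball_compact[OF fd(1)])
  have Kr: "K \<subseteq> ball y0 r" using r(1) by (auto simp: K_def)
  define M where "M = C3 * C1 + C2 * Q"
  have M: "M > 0" using r1 r2 r3 \<eta>(5) by (simp add: M_def add_pos_pos)
  \<comment> \<open>The first bound keeps the perturbed section in the ball, the second makes the perturbation a contraction.\<close>
  define \<epsilon> where "\<epsilon> = min (\<rho>/2) (1 / (2 * M))"
  have \<epsilon>: "\<epsilon> > 0" "\<epsilon> \<le> \<rho>/2" "M * \<epsilon> \<le> 1/2" using \<rho>(1) M by (auto simp: \<epsilon>_def min_def field_simps)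
  have inZ: "\<zeta> y + (s * \<eta> y) *\<^sub>R t \<in> ball (\<zeta> y0) \<rho>" if "norm t < \<epsilon>" "y \<in> ball y0 r" "s \<in> {0..1}" for t y s
  proof -
    have "\<bar>s * \<eta> y\<bar> \<le> 1" using \<eta>(3)[of y] that(3) by (auto simp: abs_mult intro: mult_le_one)
    then have "norm ((s * \<eta> y) *\<^sub>R t) \<le> norm t" using mult_right_mono[of "\<bar>s * \<eta> y\<bar>" 1 "norm t"] by simp
    then have "norm ((s * \<eta> y) *\<^sub>R t) < \<rho>/2" using that(1) \<epsilon>(2) by linarith
    moreover have "norm (\<zeta> y0 - \<zeta> y) < \<rho>/2" using \<zeta>ball[OF that(2)] by (simp add: dist_norm)
    ultimately show ?thesis
      using norm_triangle_ineq4[of "\<zeta> y0 - \<zeta> y" "(s * \<eta> y) *\<^sub>R t"] by (simp add: dist_norm algebra_simps)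
  qed
  have main: "\<exists>T T'. smooth_on UNIV T \<and> smooth_on UNIV T' \<and> (\<forall>y. T' (T y) = y) \<and> (\<forall>y. T (T' y) = y) \<and>
        (\<forall>y\<in>Y0. T y = b (\<zeta> y + \<eta> y *\<^sub>R t)) \<and> (\<forall>y. y \<notin> K \<longrightarrow> T y = y)" if t: "norm t < \<epsilon>" for t
  proof -
    have inZ1: "\<zeta> y + \<eta> y *\<^sub>R t \<in> ball (\<zeta> y0) \<rho>" if "y \<in> ball y0 r" for y
      using inZ[OF t that, of 1] by simp
    define R where "R y = (if y \<in> ball y0 r then b (\<zeta> y + \<eta> y *\<^sub>R t) - b (\<zeta> y) else 0)" for y
    have R0: "R y = 0" if "y \<notin> K" for y using \<eta>(4) that by (simp add: R_def K_def)
    have "norm (R x - R y) \<le> 1/2 * norm (x - y)" if xy: "x \<in> ball y0 r" "y \<in> ball y0 r" for x y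
    proof -
      let ?u = "\<eta> x *\<^sub>R t" and ?u' = "\<eta> y *\<^sub>R t"
      have nu: "norm ?u \<le> norm t" using \<eta>(3)[of x] mult_right_mono[of "\<bar>\<eta> x\<bar>" 1 "norm t"] by simp
      have sum_in: "\<zeta> y + ?u \<in> ball (\<zeta> y0) \<rho>"
      proof -
        have "norm (\<zeta> y0 - \<zeta> y) < \<rho>/2" using \<zeta>ball[OF xy(2)] by (simp add: dist_norm)
        moreover have "norm ?u < \<rho>/2" using nu t \<epsilon>(2) by linarith
        ultimately show ?thesis using norm_triangle_ineq4[of "\<zeta> y0 - \<zeta> y" ?u] by (simp add: dist_norm algebra_simps)
      qed
      have "norm ((b (\<zeta> x + ?u) - b (\<zeta> x)) - (b (\<zeta> y + ?u) - b (\<zeta> y))) \<le> C3 * norm ?u * norm (\<zeta> x - \<zeta> y)"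
      proof (rule second_difference_bound[OF b(1), of "\<zeta> y0" \<rho>])
        show "ball (\<zeta> y0) \<rho> \<subseteq> Z" using \<rho>(3) r3(3) by blast
        show "norm (D b x v - D b y v) \<le> C3 * norm (x - y) * norm v"
          if "x \<in> ball (\<zeta> y0) \<rho>" "y \<in> ball (\<zeta> y0) \<rho>" for x y v using r3(4) \<rho>(3) that by blast
        show "norm ?u < \<rho>/2" using nu t \<epsilon>(2) by linarith
      qed (use \<zeta>ball xy r3(2) in auto)
      also have "\<dots> \<le> C3 * norm t * (C1 * norm (x - y))"
        using nu r1(4)[of x y] xy r(2) r3(2) by (intro mult_mono) auto
      finally have 1: "norm ((b (\<zeta> x + ?u) - b (\<zeta> x)) - (b (\<zeta> y + ?u) - b (\<zeta> y))) \<le> C3 * C1 * norm t * norm (x - y)"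
        by (simp add: mult_ac)
      have "norm (b (\<zeta> y + ?u) - b (\<zeta> y + ?u')) \<le> C2 * norm ((\<zeta> y + ?u) - (\<zeta> y + ?u'))"
        by (rule r2(4)) (use sum_in inZ1[OF xy(2)] \<rho>(2) in auto)
      also have "(\<zeta> y + ?u) - (\<zeta> y + ?u') = (\<eta> x - \<eta> y) *\<^sub>R t" by (simp add: algebra_simps)
      also have "C2 * norm \<dots> \<le> C2 * (Q * norm (x - y) * norm t)"
        using r2(2) mult_right_mono[OF \<eta>(6)[of x y] norm_ge_zero[of t]] by simp
      finally have 2: "norm (b (\<zeta> y + ?u) - b (\<zeta> y + ?u')) \<le> C2 * Q * norm t * norm (x - y)" by (simp add: mult_ac)
      have "R x - R y = ((b (\<zeta> x + ?u) - b (\<zeta> x)) - (b (\<zeta> y + ?u) - b (\<zeta> y))) + (b (\<zeta> y + ?u) - b (\<zeta> y + ?u'))"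
        using xy by (simp add: R_def)
      also have "norm \<dots> \<le> C3 * C1 * norm t * norm (x - y) + C2 * Q * norm t * norm (x - y)"
        by (rule norm_triangle_mono[OF 1 2])
      also have "\<dots> = M * norm t * norm (x - y)" by (simp add: M_def algebra_simps)
      also have "\<dots> \<le> 1/2 * norm (x - y)"
      proof (rule mult_right_mono)
        have "M * norm t \<le> M * \<epsilon>" using t M by simp
        then show "M * norm t \<le> 1/2" using \<epsilon>(3) by linarith
      qed simp
      finally show ?thesis .
    qed
    then have Rlip: "norm (R x - R y) \<le> 1/2 * norm (x - y)" for x y
      by (rule lipschitz_extend_by_zero[of "r/2" r, where ?x0.0 = y0, rotated 3]) (use r(1) R0 in \<open>auto simp: K_def\<close>)
    define T where "T y = y + R y" for y
    have exp: "norm (T x - T y) \<ge> 1/2 * norm (x - y)" for x y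
      unfolding T_def by (rule half_lipschitz_perturbation_expands[OF Rlip])
    have "\<exists>y. T y = w" for w
    proof -
      have "norm (w - (0 + R 0)) \<le> 2 * norm (w - (0 + R 0)) / 2" by simp
      then obtain x where "x + R x = w"
        by (rule half_lipschitz_perturbation_covers[OF fd(1) _ Rlip, rotated]) auto
      then show ?thesis by (auto simp: T_def)
    qed
    then obtain T' where T': "\<And>w. T (T' w) = w" by metis
    have T'T: "T' (T y) = y" for y using exp[of "T' (T y)" y] T' by simp
    have Tin: "T y = b (\<zeta> y + \<eta> y *\<^sub>R t)" if "y \<in> Y0" for y
    proof (cases "y \<in> ball y0 r")
      case True then show ?thesis using sec[OF that] by (simp add: T_def R_def)
    next
      case False
      then have "y \<notin> K" using Kr by blast
      then show ?thesis using R0 \<eta>(4) sec[OF that] by (simp add: T_def K_def)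
    qed
    have Tout: "T y = y" if "y \<notin> K" for y using R0[OF that] by (simp add: T_def)
    have smT: "smooth_on UNIV T"
    proof (rule smooth_on_local)
      fix y
      show "\<exists>W. y \<in> W \<and> W \<subseteq> UNIV \<and> smooth_on W T"
      proof (cases "y \<in> ball y0 r")
        case True
        have "smooth_on (ball y0 r) (\<lambda>y. b (\<zeta> y + \<eta> y *\<^sub>R t))"
        proof (rule smooth_on_compose[OF fd(2) b(1)])
          show "smooth_on (ball y0 r) (\<lambda>y. \<zeta> y + \<eta> y *\<^sub>R t)"
            by (intro smooth_on_add smooth_on_scaleR smooth_on_const smooth_on_subset[OF \<zeta>(1) _ rY]
                smooth_on_subset[OF \<eta>(1)]) auto
          show "(\<lambda>y. \<zeta> y + \<eta> y *\<^sub>R t) ` ball y0 r \<subseteq> Z" using inZ1 \<rho>(3) r3(3) by blast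
        qed
        then have "smooth_on (ball y0 r) T" by (rule smooth_on_cong) (use Tin rY in auto)
        then show ?thesis using True by blast
      next
        case False
        have "smooth_on (- K) T"
          by (rule smooth_on_cong[OF smooth_on_id]) (use Tout K compact_imp_closed in auto)
        then show ?thesis using False Kr by blast
      qed
    qed
    have bijT: "bij (D T y)" for y
    proof (rule finite_dimensional_inj_imp_bij[OF fd(1)])
      have d: "(T has_derivative D T y) (at y)" using smooth_on_has_derivative[OF smT] by simp
      then show "linear (D T y)" by (rule has_derivative_linear)
      show "v = 0" if "D T y v = 0" for v
        by (rule expanding_imp_derivative_inj[OF d open_UNIV _ _ _ that, of "1/2"]) (use exp in auto)
    qed
    have "continuous_on UNIV T'"
    proof (rule continuous_on_iff[THEN iffD2], intro ballI allI impI)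
      fix y and e :: real assume e: "e > 0"
      have "dist (T' x) (T' y) < e" if "dist x y < e/2" for x
        using exp[of "T' x" "T' y"] T' that by (simp add: dist_norm)
      then show "\<exists>d>0. \<forall>x\<in>UNIV. dist x y < d \<longrightarrow> dist (T' x) (T' y) < e" using e by (intro exI[of _ "e/2"]) auto
    qed
    then have "smooth_on UNIV T'" by (intro smooth_on_inverse[OF fd(1) smT bijT open_UNIV]) (use T' in auto)
    then show ?thesis using smT T' T'T Tin Tout by blast
  qed
  show ?thesis
  proof (rule that[OF \<eta>(1,2) K _ _ \<epsilon>(1) _ main])
    show "K \<subseteq> Y0" using Kr rY by blast
    show "\<eta> y = 0" if "y \<notin> K" for y using \<eta>(4) that by (simp add: K_def)
    show "\<zeta> y + (s * \<eta> y) *\<^sub>R t \<in> Z" if "norm t < \<epsilon>" "y \<in> Y0" "s \<in> {0..1}" for t y s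
    proof (cases "y \<in> ball y0 r")
      case True then show ?thesis using inZ[OF that(1) True that(3)] \<rho>(3) r3(3) by blast
    next
      case False
      then have "\<eta> y = 0" using Kr unfolding K_def by (intro \<eta>(4)) blast
      then show ?thesis using b(2) that(2) by auto
    qed
  qed auto
qed

section \<open>Smooth maps between manifolds\<close>

lemma is_chartD:
  assumes "is_chart (U, \<phi>)"
  shows "open U" "open (\<phi> ` U)" "inj_on \<phi> U" "continuous_on U \<phi>" "continuous_on (\<phi> ` U) (inv_into U \<phi>)"
    "x \<in> U \<Longrightarrow> inv_into U \<phi> (\<phi> x) = x"
proof -
  show o: "open U" "open (\<phi> ` U)" using assms by (auto simp: is_chart_def)
  obtain \<psi> where h: "homeomorphism U (\<phi> ` U) \<phi> \<psi>" using assms by (auto simp: is_chart_def)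
  show inj: "inj_on \<phi> U" by (metis h homeomorphism_def inj_on_inverseI)
  show "continuous_on U \<phi>" using h by (simp add: homeomorphism_def)
  show inv: "inv_into U \<phi> (\<phi> x) = x" if "x \<in> U" for x using inj that by simp
  have "continuous_on (\<phi> ` U) \<psi>" using h by (simp add: homeomorphism_def)
  then show "continuous_on (\<phi> ` U) (inv_into U \<phi>)"
    by (rule continuous_on_eq) (use h inv in \<open>auto simp: homeomorphism_def\<close>)
qed

lemma is_chartI:
  assumes "open U" "open (\<phi> ` U)" "inj_on \<phi> U" "continuous_on U \<phi>" "continuous_on (\<phi> ` U) (inv_into U \<phi>)"
  shows "is_chart (U, \<phi>)"
  unfolding is_chart_def using assms
  by (auto intro!: exI[of _ "inv_into U \<phi>"] simp: homeomorphism_def image_image)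

lemma chart_open_image:
  assumes "is_chart (U, \<phi>)" "open W" "W \<subseteq> U"
  shows "open (\<phi> ` W)"
proof -
  have "\<phi> ` W = inv_into U \<phi> -` W \<inter> \<phi> ` U"
    using is_chartD(6)[OF assms(1)] assms(3) by (auto simp: image_iff subset_iff)
  then show ?thesis using continuous_on_open_vimage[OF is_chartD(2)[OF assms(1)]] is_chartD(5)[OF assms(1)] assms(2)
    by metis
qed

text \<open>
  The standard structure of a vector space. It turns coordinate expressions into compositions of smooth
  maps between manifolds.
\<close>

definition flat_atlas :: "('a, 'a) chart set" where
  "flat_atlas = {(UNIV, \<lambda>x. x)}"

lemma smooth_atlasD:
  assumes "smooth_atlas A"
  shows "(U, \<phi>) \<in> A \<Longrightarrow> is_chart (U, \<phi>)" "(U, \<phi>) \<in> A \<Longrightarrow> (V, \<psi>) \<in> A \<Longrightarrow> smooth_compatible (U, \<phi>) (V, \<psi>)"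
    "A \<subseteq> smooth_charts A"
  using assms unfolding smooth_atlas_def smooth_charts_def by blast+

lemma smooth_atlas_finite_dimensional:
  "smooth_atlas (A :: ('m::topological_space, 'e::real_normed_vector) chart set) \<Longrightarrow> finite_dimensional TYPE('e)"
  by (simp add: smooth_atlas_def)

lemma smooth_atlas_cover:
  assumes "smooth_atlas A"
  obtains U \<phi> where "(U, \<phi>) \<in> A" "p \<in> U"
proof -
  have "p \<in> (\<Union>c\<in>A. fst c)" using assms by (simp add: smooth_atlas_def)
  then show ?thesis using that by auto
qed

lemma smooth_chartsD:
  assumes "(U, \<phi>) \<in> smooth_charts A"
  shows "is_chart (U, \<phi>)"
    "(V, \<psi>) \<in> A \<Longrightarrow> smooth_on (\<phi> ` (U \<inter> V)) (\<psi> \<circ> inv_into U \<phi>)"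
    "(V, \<psi>) \<in> A \<Longrightarrow> smooth_on (\<psi> ` (U \<inter> V)) (\<phi> \<circ> inv_into V \<psi>)"
  using assms unfolding smooth_charts_def smooth_compatible_def by auto

lemma smooth_atlas_flat:
  "finite_dimensional TYPE('a::real_normed_vector) \<Longrightarrow> smooth_atlas (flat_atlas :: ('a, 'a) chart set)"
proof -
  have "inv_into UNIV (\<lambda>x::'a. x) = (\<lambda>x. x)" by (auto intro!: ext inv_into_f_eq)
  then show "finite_dimensional TYPE('a) \<Longrightarrow> ?thesis"
    using smooth_on_id[OF open_UNIV, where ?'a = 'a]
    unfolding smooth_atlas_def flat_atlas_def smooth_compatible_def
    by (auto intro!: is_chartI simp: o_def)
qed

lemma chart_preimage_open:
  assumes "open W" "continuous_on W f" "open X"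
  shows "open {q\<in>W. f q \<in> X}"
proof -
  have "{q\<in>W. f q \<in> X} = f -` X \<inter> W" by auto
  then show ?thesis using continuous_on_open_vimage[OF assms(1)] assms by metis
qed

lemma smooth_map_on_obtain_charts:
  assumes f: "smooth_map_on A B S f" and p: "p \<in> S"
  obtains U \<phi> V \<psi> W h where "(U, \<phi>) \<in> A" "(V, \<psi>) \<in> B" "open W" "p \<in> W" "W \<subseteq> U"
    "f ` (S \<inter> W) \<subseteq> V" "smooth_on (\<phi> ` W) h" "\<And>q. q \<in> S \<inter> W \<Longrightarrow> \<psi> (f q) = h (\<phi> q)"
  using bspec[OF f[unfolded smooth_map_on_def] p]
proof (elim bexE case_prodE exE conjE)
  fix c U \<phi> d V \<psi> W h
  assume "c \<in> A" "c = (U, \<phi>)" "d \<in> B" "d = (V, \<psi>)" "open W" "p \<in> W" "W \<subseteq> U"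
    "f ` (S \<inter> W) \<subseteq> V" "smooth_on (\<phi> ` W) h" "\<forall>q\<in>S \<inter> W. \<psi> (f q) = h (\<phi> q)"
  then show thesis by (intro that[of U \<phi> V \<psi> W h]) simp_all
qed

lemma smooth_map_onI:
  assumes "\<And>p. p \<in> S \<Longrightarrow> \<exists>U \<phi> V \<psi> W h. (U, \<phi>) \<in> A \<and> (V, \<psi>) \<in> B \<and> open W \<and> p \<in> W \<and> W \<subseteq> U \<and>
    f ` (S \<inter> W) \<subseteq> V \<and> smooth_on (\<phi> ` W) h \<and> (\<forall>q\<in>S \<inter> W. \<psi> (f q) = h (\<phi> q))"
  shows "smooth_map_on A B S f"
  unfolding smooth_map_on_def
proof
  fix p assume "p \<in> S"
  from assms[OF this] obtain U \<phi> V \<psi> W h where U: "(U, \<phi>) \<in> A" and V: "(V, \<psi>) \<in> B" and *: "open W \<and> p \<in> W \<and> W \<subseteq> U \<and>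
    f ` (S \<inter> W) \<subseteq> V \<and> smooth_on (\<phi> ` W) h \<and> (\<forall>q\<in>S \<inter> W. \<psi> (f q) = h (\<phi> q))"
    by (elim exE conjE) blast
  show "\<exists>(U, \<phi>)\<in>A. \<exists>(V, \<psi>)\<in>B. \<exists>W h. open W \<and> p \<in> W \<and> W \<subseteq> U \<and> f ` (S \<inter> W) \<subseteq> V \<and>
      smooth_on (\<phi> ` W) h \<and> (\<forall>q\<in>S \<inter> W. \<psi> (f q) = h (\<phi> q))"
    by (rule bexI[OF _ U], unfold prod.case, rule bexI[OF _ V], unfold prod.case, intro exI, rule *)
qed

text \<open>
  The definition of smoothness provides some pair of charts at each point; transition maps allow any
  other pair. That \<open>f\<close> stays in \<open>V\<close> near \<open>p\<close> is read off from its coordinate expression, which is continuous.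
\<close>

lemma smooth_map_onE:
  assumes A: "smooth_atlas A" and B: "smooth_atlas B" and f: "smooth_map_on A B S f"
    and p: "p \<in> S" "(U, \<phi>) \<in> smooth_charts A" "p \<in> U" "(V, \<psi>) \<in> smooth_charts B" "f p \<in> V"
  obtains W h where "open W" "p \<in> W" "W \<subseteq> U" "f ` (S \<inter> W) \<subseteq> V" "smooth_on (\<phi> ` W) h"
    "\<And>q. q \<in> S \<inter> W \<Longrightarrow> \<psi> (f q) = h (\<phi> q)"
proof -
  obtain U1 \<phi>1 V1 \<psi>1 W1 h1 where 1: "(U1, \<phi>1) \<in> A" "(V1, \<psi>1) \<in> B" "open W1" "p \<in> W1" "W1 \<subseteq> U1"
    "f ` (S \<inter> W1) \<subseteq> V1" "smooth_on (\<phi>1 ` W1) h1" "\<And>q. q \<in> S \<inter> W1 \<Longrightarrow> \<psi>1 (f q) = h1 (\<phi>1 q)"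
    using smooth_map_on_obtain_charts[OF f p(1)] by metis
  note U = is_chartD[OF smooth_chartsD(1)[OF p(2)]]
  note V = is_chartD[OF smooth_chartsD(1)[OF p(4)]]
  note U1 = is_chartD[OF smooth_atlasD(1)[OF A 1(1)]]
  note V1 = is_chartD[OF smooth_atlasD(1)[OF B 1(2)]]
  define N where "N = \<psi>1 ` (V \<inter> V1)"
  have N: "open N" unfolding N_def
    by (rule chart_open_image[OF smooth_atlasD(1)[OF B 1(2)]]) (use V V1 in auto)
  define W where "W = {q\<in>W1. h1 (\<phi>1 q) \<in> N} \<inter> U"
  have "continuous_on W1 (\<lambda>q. h1 (\<phi>1 q))"
    by (rule continuous_on_compose2[OF smooth_on_continuous_on[OF 1(7)] continuous_on_subset[OF U1(4) 1(5)]]) auto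
  then have oW: "open W" unfolding W_def by (intro open_Int chart_preimage_open 1(3) N U(1))
  have WU: "W \<subseteq> U" "W \<subseteq> U1" "W \<subseteq> W1" using 1(5) by (auto simp: W_def)
  have fV: "f q \<in> V" "f q \<in> V1" if "q \<in> S \<inter> W" for q
  proof -
    show q: "f q \<in> V1" using that 1(6) WU by blast
    have "\<psi>1 (f q) \<in> N" using 1(8)[of q] that by (auto simp: W_def)
    then show "f q \<in> V" using q V1(3) by (auto simp: N_def inj_on_def)
  qed
  have pN: "h1 (\<phi>1 p) \<in> N" using 1(8)[of p] 1(4,6) p unfolding N_def by (metis IntI image_eqI image_subset_iff)
  define h where "h z = (\<psi> \<circ> inv_into V1 \<psi>1) (h1 ((\<phi>1 \<circ> inv_into U \<phi>) z))" for z
  have op: "open (\<phi> ` W)" by (rule chart_open_image[OF smooth_chartsD(1)[OF p(2)] oW WU(1)])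
  have "smooth_on (\<phi> ` W) h" unfolding h_def
  proof (rule smooth_on_compose[OF smooth_atlas_finite_dimensional[OF B] smooth_chartsD(3)[OF p(4) 1(2), folded N_def]])
    show "smooth_on (\<phi> ` W) (\<lambda>z. h1 ((\<phi>1 \<circ> inv_into U \<phi>) z))"
    proof (rule smooth_on_compose[OF smooth_atlas_finite_dimensional[OF A] 1(7)])
      show "smooth_on (\<phi> ` W) (\<phi>1 \<circ> inv_into U \<phi>)"
        by (rule smooth_on_subset[OF smooth_chartsD(2)[OF p(2) 1(1)] op]) (use WU in auto)
      show "(\<phi>1 \<circ> inv_into U \<phi>) ` \<phi> ` W \<subseteq> \<phi>1 ` W1" using WU U(6) by (auto simp: subset_iff)
    qed
    show "(\<lambda>z. h1 ((\<phi>1 \<circ> inv_into U \<phi>) z)) ` \<phi> ` W \<subseteq> N" using WU U(6) by (auto simp: W_def)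
  qed
  moreover have "\<psi> (f q) = h (\<phi> q)" if "q \<in> S \<inter> W" for q
  proof -
    have "h (\<phi> q) = \<psi> (inv_into V1 \<psi>1 (h1 (\<phi>1 q)))" using that WU U(6) by (auto simp: h_def)
    also have "h1 (\<phi>1 q) = \<psi>1 (f q)" using that WU 1(8) by auto
    finally show ?thesis using V1(6)[OF fV(2)[OF that]] by simp
  qed
  ultimately show ?thesis using that[of W h] oW WU(1) fV(1) pN 1(4) p(3) by (auto simp: W_def)
qed

lemma smooth_map_on_continuous_on':
  assumes A: "\<And>U \<phi>. (U, \<phi>) \<in> A \<Longrightarrow> continuous_on U \<phi>" and B: "smooth_atlas B" and f: "smooth_map_on A B S f"
  shows "continuous_on S f"
  unfolding continuous_on_def
proof
  fix p assume p: "p \<in> S"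
  obtain U1 \<phi>1 V1 \<psi>1 W1 h1 where 1: "(U1, \<phi>1) \<in> A" "(V1, \<psi>1) \<in> B" "open W1" "p \<in> W1" "W1 \<subseteq> U1"
    "f ` (S \<inter> W1) \<subseteq> V1" "smooth_on (\<phi>1 ` W1) h1" "\<And>q. q \<in> S \<inter> W1 \<Longrightarrow> \<psi>1 (f q) = h1 (\<phi>1 q)"
    using smooth_map_on_obtain_charts[OF f p] by metis
  note V1 = is_chartD[OF smooth_atlasD(1)[OF B 1(2)]]
  have "continuous_on (S \<inter> W1) (\<lambda>q. h1 (\<phi>1 q))"
    by (rule continuous_on_compose2[OF smooth_on_continuous_on[OF 1(7)] continuous_on_subset[OF A[OF 1(1)]]]) (use 1(5) in auto)
  then have "continuous_on (S \<inter> W1) (\<lambda>q. inv_into V1 \<psi>1 (h1 (\<phi>1 q)))"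
    by (rule continuous_on_compose2[OF V1(5)]) (use 1(6) in \<open>auto simp flip: 1(8)\<close>)
  then have "continuous_on (S \<inter> W1) f"
  proof (rule continuous_on_eq)
    show "inv_into V1 \<psi>1 (h1 (\<phi>1 q)) = f q" if "q \<in> S \<inter> W1" for q
      using V1(6)[of "f q"] 1(6,8) that by (metis image_subset_iff)
  qed
  then have "(f \<longlongrightarrow> f p) (at p within S \<inter> W1)" using p 1(4) by (simp add: continuous_on_def)
  moreover have "at p within S \<inter> W1 = at p within S"
    by (rule at_within_nhd[of p W1]) (use 1 in auto)
  ultimately show "(f \<longlongrightarrow> f p) (at p within S)" by simp
qed

lemma smooth_map_on_continuous_on:
  assumes "smooth_atlas A" "smooth_atlas B" "smooth_map_on A B S f"
  shows "continuous_on S f"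
  by (rule smooth_map_on_continuous_on'[OF is_chartD(4)[OF smooth_atlasD(1)[OF assms(1)]] assms(2,3)])

lemma smooth_map_on_compose:
  assumes A: "smooth_atlas A" and B: "smooth_atlas B" and C: "smooth_atlas C"
    and g: "smooth_map_on A B S g" and f: "smooth_map_on B C T f" and gS: "g ` S \<subseteq> T"
  shows "smooth_map_on A C S (\<lambda>x. f (g x))"
proof (rule smooth_map_onI)
  fix p assume p: "p \<in> S"
  then have gp: "g p \<in> T" using gS by blast
  obtain V \<psi> X \<xi> W2 h2 where 2: "(V, \<psi>) \<in> B" "(X, \<xi>) \<in> C" "open W2" "g p \<in> W2" "W2 \<subseteq> V"
    "f ` (T \<inter> W2) \<subseteq> X" "smooth_on (\<psi> ` W2) h2" "\<And>q. q \<in> T \<inter> W2 \<Longrightarrow> \<xi> (f q) = h2 (\<psi> q)"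
    using smooth_map_on_obtain_charts[OF f gp] by metis
  obtain U \<phi> where U: "(U, \<phi>) \<in> A" "p \<in> U" using smooth_atlas_cover[OF A] by metis
  have U': "(U, \<phi>) \<in> smooth_charts A" and V': "(V, \<psi>) \<in> smooth_charts B"
    using U 2 smooth_atlasD(3) A B by blast+
  have gV: "g p \<in> V" using 2 by blast
  obtain W1 h1 where 1: "open W1" "p \<in> W1" "W1 \<subseteq> U" "g ` (S \<inter> W1) \<subseteq> V" "smooth_on (\<phi> ` W1) h1"
    "\<And>q. q \<in> S \<inter> W1 \<Longrightarrow> \<psi> (g q) = h1 (\<phi> q)"
    using smooth_map_onE[OF A B g p U' U(2) V' gV] by metis
  note Uc = is_chartD[OF smooth_chartsD(1)[OF U']]
  note Vc = is_chartD[OF smooth_chartsD(1)[OF V']]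
  define W where "W = {q\<in>W1. h1 (\<phi> q) \<in> \<psi> ` W2}"
  have "continuous_on W1 (\<lambda>q. h1 (\<phi> q))"
    by (rule continuous_on_compose2[OF smooth_on_continuous_on[OF 1(5)] continuous_on_subset[OF Uc(4) 1(3)]]) auto
  then have oW: "open W" unfolding W_def
    by (rule chart_preimage_open[OF 1(1) _ chart_open_image[OF smooth_chartsD(1)[OF V'] 2(3,5)]])
  have "h1 (\<phi> p) \<in> \<psi> ` W2" using 1(2) 1(6)[of p] p 2(4) by (metis IntI image_eqI)
  then have pW: "p \<in> W" using 1(2) by (simp add: W_def)
  have gW: "g q \<in> T \<inter> W2" if "q \<in> S \<inter> W" for q
  proof -
    have "\<psi> (g q) \<in> \<psi> ` W2" using 1(6)[of q] that by (auto simp: W_def)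
    moreover have "g q \<in> V" using 1(4) that by (auto simp: W_def)
    ultimately show ?thesis using Vc(3) 2(5) gS that by (auto simp: inj_on_def subset_iff)
  qed
  have "smooth_on (\<phi> ` W) (\<lambda>z. h2 (h1 z))"
    by (rule smooth_on_compose[OF smooth_atlas_finite_dimensional[OF B] 2(7) smooth_on_subset[OF 1(5)]])
      (use chart_open_image[OF smooth_chartsD(1)[OF U'] oW] 1(3) in \<open>auto simp: W_def\<close>)
  moreover have "(\<lambda>x. f (g x)) ` (S \<inter> W) \<subseteq> X" using gW 2(6) by blast
  moreover have "\<forall>q\<in>S \<inter> W. \<xi> (f (g q)) = h2 (h1 (\<phi> q))"
    using gW 2(8) 1(6) by (auto simp: W_def)
  moreover have "W \<subseteq> U" using 1(3) by (auto simp: W_def)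
  ultimately show "\<exists>U \<phi> V \<psi> W h. (U, \<phi>) \<in> A \<and> (V, \<psi>) \<in> C \<and> open W \<and> p \<in> W \<and> W \<subseteq> U \<and>
    (\<lambda>x. f (g x)) ` (S \<inter> W) \<subseteq> V \<and> smooth_on (\<phi> ` W) h \<and> (\<forall>q\<in>S \<inter> W. \<psi> (f (g q)) = h (\<phi> q))"
    using U(1) 2(2) oW pW by (intro exI[of _ U] exI[of _ \<phi>] exI[of _ X] exI[of _ \<xi>] exI[of _ W] exI[of _ "\<lambda>z. h2 (h1 z)"]) simp
qed

lemma smooth_map_on_subset:
  assumes "smooth_map_on A B S f" "T \<subseteq> S"
  shows "smooth_map_on A B T f"
proof (rule smooth_map_onI)
  fix p assume "p \<in> T"
  then have "p \<in> S" using assms(2) by blast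
  from smooth_map_on_obtain_charts[OF assms(1) this] obtain U \<phi> V \<psi> W h where
    1: "(U, \<phi>) \<in> A" "(V, \<psi>) \<in> B" "open W" "p \<in> W" "W \<subseteq> U" "f ` (S \<inter> W) \<subseteq> V" "smooth_on (\<phi> ` W) h"
      "\<And>q. q \<in> S \<inter> W \<Longrightarrow> \<psi> (f q) = h (\<phi> q)" by metis
  moreover have "f ` (T \<inter> W) \<subseteq> V" "\<forall>q\<in>T \<inter> W. \<psi> (f q) = h (\<phi> q)" using 1(6,8) assms(2) by blast+
  ultimately show "\<exists>U \<phi> V \<psi> W h. (U, \<phi>) \<in> A \<and> (V, \<psi>) \<in> B \<and> open W \<and> p \<in> W \<and> W \<subseteq> U \<and>
    f ` (T \<inter> W) \<subseteq> V \<and> smooth_on (\<phi> ` W) h \<and> (\<forall>q\<in>T \<inter> W. \<psi> (f q) = h (\<phi> q))"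
    by (intro exI[of _ U] exI[of _ \<phi>] exI[of _ V] exI[of _ \<psi>] exI[of _ W] exI[of _ h]) simp
qed

lemma smooth_map_on_cong:
  assumes "smooth_map_on A B S f" "\<And>x. x \<in> S \<Longrightarrow> f x = g x"
  shows "smooth_map_on A B S g"
proof -
  have "f ` (S \<inter> W) = g ` (S \<inter> W)" for W using assms(2) by (intro image_cong) auto
  then show ?thesis using assms unfolding smooth_map_on_def by simp
qed

lemma smooth_map_on_local:
  assumes A: "smooth_atlas A"
    and loc: "\<And>p. p \<in> S \<Longrightarrow> \<exists>X. open X \<and> p \<in> X \<and> smooth_map_on A B (S \<inter> X) f"
  shows "smooth_map_on A B S f"
proof (rule smooth_map_onI)
  fix p assume p: "p \<in> S"
  then obtain X where X: "open X" "p \<in> X" "smooth_map_on A B (S \<inter> X) f" using loc by blast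
  then have pX: "p \<in> S \<inter> X" using p by blast
  obtain U \<phi> V \<psi> W h where 1: "(U, \<phi>) \<in> A" "(V, \<psi>) \<in> B" "open W" "p \<in> W" "W \<subseteq> U"
    "f ` (S \<inter> X \<inter> W) \<subseteq> V" "smooth_on (\<phi> ` W) h" "\<And>q. q \<in> S \<inter> X \<inter> W \<Longrightarrow> \<psi> (f q) = h (\<phi> q)"
    using smooth_map_on_obtain_charts[OF X(3) pX] by metis
  have "smooth_on (\<phi> ` (X \<inter> W)) h"
    by (rule smooth_on_subset[OF 1(7) chart_open_image[OF smooth_atlasD(1)[OF A 1(1)]]]) (use 1 X in auto)
  then show "\<exists>U \<phi> V \<psi> W h. (U, \<phi>) \<in> A \<and> (V, \<psi>) \<in> B \<and> open W \<and> p \<in> W \<and> W \<subseteq> U \<and>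
    f ` (S \<inter> W) \<subseteq> V \<and> smooth_on (\<phi> ` W) h \<and> (\<forall>q\<in>S \<inter> W. \<psi> (f q) = h (\<phi> q))"
    using 1 X by (intro exI[of _ U] exI[of _ \<phi>] exI[of _ V] exI[of _ \<psi>] exI[of _ "X \<inter> W"] exI[of _ h])
      (auto simp: Int_assoc)
qed

lemma smooth_map_on_const:
  assumes A: "smooth_atlas A" and B: "smooth_atlas B"
  shows "smooth_map_on A B S (\<lambda>_. c)"
proof (rule smooth_map_onI)
  fix p
  obtain U \<phi> where U: "(U, \<phi>) \<in> A" "p \<in> U" using smooth_atlas_cover[OF A] by metis
  obtain V \<psi> where V: "(V, \<psi>) \<in> B" "c \<in> V" using smooth_atlas_cover[OF B] by metis
  show "\<exists>U \<phi> V \<psi> W h. (U, \<phi>) \<in> A \<and> (V, \<psi>) \<in> B \<and> open W \<and> p \<in> W \<and> W \<subseteq> U \<and>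
    (\<lambda>_. c) ` (S \<inter> W) \<subseteq> V \<and> smooth_on (\<phi> ` W) h \<and> (\<forall>q\<in>S \<inter> W. \<psi> c = h (\<phi> q))"
    using U V is_chartD(1,2)[OF smooth_atlasD(1)[OF A U(1)]]
    by (intro exI[of _ U] exI[of _ \<phi>] exI[of _ V] exI[of _ \<psi>] exI[of _ U] exI[of _ "\<lambda>_. \<psi> c"])
      (auto intro: smooth_on_const)
qed

lemma smooth_map_on_id:
  assumes A: "smooth_atlas A"
  shows "smooth_map_on A A S (\<lambda>x. x)"
proof (rule smooth_map_onI)
  fix p
  obtain U \<phi> where U: "(U, \<phi>) \<in> A" "p \<in> U" using smooth_atlas_cover[OF A] by metis
  show "\<exists>U \<phi> V \<psi> W h. (U, \<phi>) \<in> A \<and> (V, \<psi>) \<in> A \<and> open W \<and> p \<in> W \<and> W \<subseteq> U \<and>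
    (\<lambda>x. x) ` (S \<inter> W) \<subseteq> V \<and> smooth_on (\<phi> ` W) h \<and> (\<forall>q\<in>S \<inter> W. \<psi> q = h (\<phi> q))"
    using U is_chartD(1,2)[OF smooth_atlasD(1)[OF A U(1)]]
    by (intro exI[of _ U] exI[of _ \<phi>] exI[of _ U] exI[of _ \<phi>] exI[of _ U] exI[of _ "\<lambda>z. z"])
      (auto intro: smooth_on_id)
qed

lemma smooth_map_on_chart:
  assumes A: "smooth_atlas A" and U: "(U, \<phi>) \<in> smooth_charts A"
  shows "smooth_map_on A flat_atlas U \<phi>"
proof (rule smooth_map_onI)
  fix p assume p: "p \<in> U"
  obtain V \<psi> where V: "(V, \<psi>) \<in> A" "p \<in> V" using smooth_atlas_cover[OF A] by metis
  note Uc = is_chartD[OF smooth_chartsD(1)[OF U]] and Vc = is_chartD[OF smooth_atlasD(1)[OF A V(1)]]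
  show "\<exists>U' \<phi>' V \<psi> W h. (U', \<phi>') \<in> A \<and> (V, \<psi>) \<in> flat_atlas \<and> open W \<and> p \<in> W \<and> W \<subseteq> U' \<and>
    \<phi> ` (U \<inter> W) \<subseteq> V \<and> smooth_on (\<phi>' ` W) h \<and> (\<forall>q\<in>U \<inter> W. \<psi> (\<phi> q) = h (\<phi>' q))"
    using V p Uc(1) Vc(1,6) smooth_chartsD(3)[OF U V(1)]
    by (intro exI[of _ V] exI[of _ \<psi>] exI[of _ UNIV] exI[of _ "\<lambda>x. x"] exI[of _ "U \<inter> V"] exI[of _ "\<phi> \<circ> inv_into V \<psi>"])
      (auto simp: flat_atlas_def)
qed

lemma smooth_map_on_inv_chart:
  assumes A: "smooth_atlas A" and U: "(U, \<phi>) \<in> smooth_charts A"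
  shows "smooth_map_on flat_atlas A (\<phi> ` U) (inv_into U \<phi>)"
proof (rule smooth_map_onI)
  fix z assume z: "z \<in> \<phi> ` U"
  then obtain p where p: "p \<in> U" "z = \<phi> p" by blast
  obtain V \<psi> where V: "(V, \<psi>) \<in> A" "p \<in> V" using smooth_atlas_cover[OF A] by metis
  note Uc = is_chartD[OF smooth_chartsD(1)[OF U]] and Vc = is_chartD[OF smooth_atlasD(1)[OF A V(1)]]
  have o: "open (\<phi> ` (U \<inter> V))" by (rule chart_open_image[OF smooth_chartsD(1)[OF U]]) (use Uc Vc in auto)
  show "\<exists>U' \<phi>' V \<psi> W h. (U', \<phi>') \<in> flat_atlas \<and> (V, \<psi>) \<in> A \<and> open W \<and> z \<in> W \<and> W \<subseteq> U' \<and>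
    inv_into U \<phi> ` (\<phi> ` U \<inter> W) \<subseteq> V \<and> smooth_on (\<phi>' ` W) h \<and> (\<forall>q\<in>\<phi> ` U \<inter> W. \<psi> (inv_into U \<phi> q) = h (\<phi>' q))"
    using V p o Uc(6) smooth_chartsD(2)[OF U V(1)]
    by (intro exI[of _ UNIV] exI[of _ "\<lambda>x. x"] exI[of _ V] exI[of _ \<psi>] exI[of _ "\<phi> ` (U \<inter> V)"] exI[of _ "\<psi> \<circ> inv_into U \<phi>"])
      (auto simp: flat_atlas_def)
qed

lemma smooth_map_on_flat_iff:
  assumes "open S"
  shows "smooth_map_on flat_atlas flat_atlas S f \<longleftrightarrow> smooth_on S f"
proof
  assume f: "smooth_map_on flat_atlas flat_atlas S f"
  show "smooth_on S f"
  proof (rule smooth_on_local)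
    fix p assume "p \<in> S"
    then obtain W h where 1: "open W" "p \<in> W" "smooth_on W h" "\<And>q. q \<in> S \<inter> W \<Longrightarrow> f q = h q"
      using f unfolding smooth_map_on_def flat_atlas_def by auto
    have "smooth_on (S \<inter> W) f"
      by (rule smooth_on_cong[OF smooth_on_subset[OF 1(3)]]) (use 1 assms in auto)
    then show "\<exists>W. p \<in> W \<and> W \<subseteq> S \<and> smooth_on W f" using 1 \<open>p \<in> S\<close> by blast
  qed
next
  assume "smooth_on S f"
  then show "smooth_map_on flat_atlas flat_atlas S f"
    unfolding smooth_map_on_def flat_atlas_def using assms by (auto intro!: exI[of _ S] exI[of _ f])
qed

lemma smooth_chartsI:
  assumes A: "smooth_atlas (A :: ('m::topological_space, 'e::real_normed_vector) chart set)" and c: "is_chart (U, \<phi>)"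
    and sm: "smooth_map_on A flat_atlas U \<phi>" "smooth_map_on flat_atlas A (\<phi> ` U) (inv_into U \<phi>)"
  shows "(U, \<phi>) \<in> smooth_charts A"
proof -
  note F = smooth_atlas_flat[OF smooth_atlas_finite_dimensional[OF A]]
  note Uc = is_chartD[OF c]
  have "smooth_compatible (U, \<phi>) (V, \<psi>)" if V: "(V, \<psi>) \<in> A" for V \<psi>
  proof -
    have V': "(V, \<psi>) \<in> smooth_charts A" using V smooth_atlasD(3)[OF A] by blast
    note Vc = is_chartD[OF smooth_chartsD(1)[OF V']]
    have "smooth_map_on flat_atlas flat_atlas (\<phi> ` (U \<inter> V)) (\<lambda>z. \<psi> (inv_into U \<phi> z))"
      by (rule smooth_map_on_compose[OF F A F smooth_map_on_subset[OF sm(2)] smooth_map_on_chart[OF A V']])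
        (use Uc(6) in auto)
    moreover have "smooth_map_on flat_atlas flat_atlas (\<psi> ` (U \<inter> V)) (\<lambda>z. \<phi> (inv_into V \<psi> z))"
      by (rule smooth_map_on_compose[OF F A F smooth_map_on_subset[OF smooth_map_on_inv_chart[OF A V']] sm(1)])
        (use Vc(6) in auto)
    moreover have "open (\<phi> ` (U \<inter> V))" "open (\<psi> ` (U \<inter> V))"
      by (rule chart_open_image[OF c] chart_open_image[OF smooth_chartsD(1)[OF V']]; use Uc Vc in auto)+
    ultimately show ?thesis by (simp add: smooth_compatible_def smooth_map_on_flat_iff o_def)
  qed
  then show ?thesis unfolding smooth_charts_def using c by auto
qed

text \<open>
  Changing coordinates by a local diffeomorphism of the model space.
\<close>

lemma smooth_charts_compose:
  assumes A: "smooth_atlas (A :: ('m::topological_space, 'e::real_normed_vector) chart set)"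
    and U: "(U, \<phi>) \<in> smooth_charts A" and N: "N \<subseteq> \<phi> ` U"
    and F: "smooth_on N F" "open (F ` N)" and G: "smooth_on (F ` N) G" "\<And>z. z \<in> N \<Longrightarrow> G (F z) = z"
  shows "(U \<inter> \<phi> -` N, F \<circ> \<phi>) \<in> smooth_charts A" "(F \<circ> \<phi>) ` (U \<inter> \<phi> -` N) = F ` N"
proof -
  note FA = smooth_atlas_flat[OF smooth_atlas_finite_dimensional[OF A]]
  note Uc = is_chartD[OF smooth_chartsD(1)[OF U]]
  let ?U = "U \<inter> \<phi> -` N" and ?\<phi> = "F \<circ> \<phi>"
  have img: "\<phi> ` ?U = N" using N by auto
  then show img': "?\<phi> ` ?U = F ` N" by (metis image_comp)
  have oN: "open N" by (rule smooth_on_open[OF F(1)])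
  have oU: "open ?U" using continuous_on_open_vimage[OF Uc(1)] Uc(4) oN by (metis Int_commute)
  have inj: "inj_on ?\<phi> ?U"
    by (rule inj_onI) (metis (no_types, lifting) G(2) IntD1 IntD2 Uc(6) o_apply vimageE)
  have inv: "inv_into ?U ?\<phi> z = inv_into U \<phi> (G z)" if z: "z \<in> F ` N" for z
  proof -
    obtain p where p: "p \<in> ?U" "z = ?\<phi> p" using z img' by blast
    then have "inv_into ?U ?\<phi> z = p" using inv_into_f_f[OF inj] by metis
    moreover have "inv_into U \<phi> (G z) = p" using p G(2)[of "\<phi> p"] Uc(6)[of p] by simp
    ultimately show ?thesis by simp
  qed
  have GN: "G ` F ` N \<subseteq> N" using G(2) by auto
  have "smooth_map_on A flat_atlas ?U (\<lambda>x. F (\<phi> x))"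
    by (rule smooth_map_on_compose[OF A FA FA smooth_map_on_subset[OF smooth_map_on_chart[OF A U]]
          smooth_map_on_flat_iff[THEN iffD2, OF oN F(1)]]) auto
  then have s1: "smooth_map_on A flat_atlas ?U ?\<phi>" by (simp add: o_def)
  have "smooth_map_on flat_atlas A (F ` N) (\<lambda>z. inv_into U \<phi> (G z))"
    by (rule smooth_map_on_compose[OF FA FA A smooth_map_on_flat_iff[THEN iffD2, OF F(2) G(1)]
        smooth_map_on_inv_chart[OF A U]]) (use GN N in blast)
  then have s2: "smooth_map_on flat_atlas A (?\<phi> ` ?U) (inv_into ?U ?\<phi>)"
    unfolding img' by (rule smooth_map_on_cong) (simp add: inv)
  have "is_chart (?U, ?\<phi>)"
    using oU F(2) inj smooth_map_on_continuous_on[OF A FA s1] smooth_map_on_continuous_on[OF FA A s2] img'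
    by (intro is_chartI) simp_all
  then show "(?U, ?\<phi>) \<in> smooth_charts A" by (rule smooth_chartsI[OF A _ s1 s2])
qed

text \<open>
  The coordinate expression is straightened, and the new coordinates are restricted to the preimage of a
  ball, so that the level sets of \<open>f\<close> become convex.
\<close>

lemma submersion_chart:
  fixes A :: "('g::topological_space, 'h::real_normed_vector) chart set" and f :: "'g \<Rightarrow> 'k::real_normed_vector"
  assumes A: "smooth_atlas A" and fd: "finite_dimensional TYPE('k)"
    and f: "smooth_map_on A flat_atlas X f" "open X" "g \<in> X"
    and U: "(U, \<phi>) \<in> smooth_charts A" "g \<in> U" and surj: "surj (D (\<lambda>z. f (inv_into U \<phi> z)) (\<phi> g))"
  obtains U' \<phi>' \<rho> L where "(U', \<phi>') \<in> smooth_charts A" "g \<in> U'" "U' \<subseteq> X \<inter> U" "\<rho> > 0" "\<phi>' ` U' = ball (\<phi>' g) \<rho>"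
    "bounded_linear L" "surj L" "\<And>h. h \<in> U' \<Longrightarrow> f h = L (\<phi>' h)"
proof -
  note fdh = smooth_atlas_finite_dimensional[OF A]
  note FA = smooth_atlas_flat[OF fdh] and FK = smooth_atlas_flat[OF fd]
  note Uc = is_chartD[OF smooth_chartsD(1)[OF U(1)]]
  define a where "a z = f (inv_into U \<phi> z)" for z
  define N where "N = \<phi> ` (U \<inter> X)"
  have oN: "open N" unfolding N_def by (rule chart_open_image[OF smooth_chartsD(1)[OF U(1)]]) (use Uc f in auto)
  have "smooth_map_on flat_atlas flat_atlas N a" unfolding a_def
    by (rule smooth_map_on_compose[OF FA A FK smooth_map_on_subset[OF smooth_map_on_inv_chart[OF A U(1)]] f(1)])
      (use Uc(6) in \<open>auto simp: N_def\<close>)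
  then have sma: "smooth_on N a" using smooth_map_on_flat_iff[OF oN] by blast
  have gN: "\<phi> g \<in> N" using U(2) f(3) by (simp add: N_def)
  have sa: "surj (D a (\<phi> g))" using surj by (simp add: a_def[abs_def])
  obtain U1 F G where 1: "open U1" "\<phi> g \<in> U1" "U1 \<subseteq> N" "smooth_on U1 F" "open (F ` U1)" "\<And>x. x \<in> U1 \<Longrightarrow> G (F x) = x"
    "smooth_on (F ` U1) G" "\<And>x. x \<in> U1 \<Longrightarrow> D a (\<phi> g) (F x) = a x"
    using submersion_straighten[OF fdh fd sma gN sa] by metis
  obtain \<rho> where \<rho>: "\<rho> > 0" "ball (F (\<phi> g)) \<rho> \<subseteq> F ` U1" using 1(2,5) open_contains_ball by blast
  define N1 where "N1 = {z\<in>U1. F z \<in> ball (F (\<phi> g)) \<rho>}"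
  have oN1: "open N1" unfolding N1_def by (rule chart_preimage_open[OF 1(1) smooth_on_continuous_on[OF 1(4)]]) simp
  have FN1: "F ` N1 = ball (F (\<phi> g)) \<rho>" using \<rho>(2) by (fastforce simp: N1_def)
  have N1: "N1 \<subseteq> U1" by (auto simp: N1_def)
  have N1U: "N1 \<subseteq> \<phi> ` U" using N1 1(3) by (auto simp: N_def)
  have oF: "open (F ` N1)" by (simp add: FN1)
  have G2: "G (F z) = z" if "z \<in> N1" for z using 1(6) N1 that by blast
  note ch = smooth_charts_compose[OF A U(1) N1U smooth_on_subset[OF 1(4) oN1 N1] oF
      smooth_on_subset[OF 1(7) oF image_mono[OF N1]] G2]
  have der: "(a has_derivative D a (\<phi> g)) (at (\<phi> g))" by (rule smooth_on_has_derivative[OF sma gN])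
  show ?thesis
  proof (rule that[OF ch(1) _ _ \<rho>(1) _ has_derivative_bounded_linear[OF der] sa])
    show "g \<in> U \<inter> \<phi> -` N1" using U(2) 1(2) \<rho>(1) by (simp add: N1_def)
    show "U \<inter> \<phi> -` N1 \<subseteq> X \<inter> U"
      using N1 1(3) Uc(3) by (auto simp: N_def inj_on_def subset_iff)
    show "(F \<circ> \<phi>) ` (U \<inter> \<phi> -` N1) = ball ((F \<circ> \<phi>) g) \<rho>" using ch(2) FN1 by simp
    show "f h = D a (\<phi> g) ((F \<circ> \<phi>) h)" if "h \<in> U \<inter> \<phi> -` N1" for h
      using that N1 1(8)[of "\<phi> h"] Uc(6)[of h] by (auto simp: a_def)
  qed
qed

section \<open>Lie groupoids and identity components of source fibres\<close>

locale lie_gpd =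
  fixes \<Gamma> :: "('g::topological_space, 'm::{t2_space, second_countable_topology},
               'h::real_normed_vector, 'e::real_normed_vector) groupoid_data"
  assumes lie: "lie_groupoid \<Gamma>"
begin

abbreviation \<alpha> where "\<alpha> \<equiv> src \<Gamma>"
abbreviation \<beta> where "\<beta> \<equiv> tgt \<Gamma>"
abbreviation \<iota> where "\<iota> \<equiv> unit_arrow \<Gamma>"
abbreviation iv where "iv \<equiv> inv_arrow \<Gamma>"
abbreviation mul (infixl \<open>\<cdot>\<close> 70) where "g \<cdot> h \<equiv> comp \<Gamma> g h"
abbreviation A where "A \<equiv> arrow_atlas \<Gamma>"
abbreviation M where "M \<equiv> unit_atlas \<Gamma>"
abbreviation fibre_o where "fibre_o \<equiv> src_fibre_o \<Gamma>"

lemma groupoid: "is_groupoid \<Gamma>" using lie by (simp add: lie_groupoid_def)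

lemma unit_simps [simp]: "\<alpha> (\<iota> x) = x" "\<beta> (\<iota> x) = x"
  using groupoid by (auto simp: is_groupoid_def)

lemma mul_simps [simp]: "\<alpha> g = \<beta> h \<Longrightarrow> \<alpha> (g \<cdot> h) = \<alpha> h" "\<alpha> g = \<beta> h \<Longrightarrow> \<beta> (g \<cdot> h) = \<beta> g"
  using groupoid by (auto simp: is_groupoid_def composable_def)

lemma mul_assoc: "\<alpha> g = \<beta> h \<Longrightarrow> \<alpha> h = \<beta> k \<Longrightarrow> (g \<cdot> h) \<cdot> k = g \<cdot> (h \<cdot> k)"
  using groupoid by (auto simp: is_groupoid_def composable_def)

lemma mul_unit [simp]: "g \<cdot> \<iota> (\<alpha> g) = g" "\<iota> (\<beta> g) \<cdot> g = g"
  using groupoid by (auto simp: is_groupoid_def)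

lemma mul_unit' [simp]: "\<alpha> g = x \<Longrightarrow> g \<cdot> \<iota> x = g" "\<beta> g = x \<Longrightarrow> \<iota> x \<cdot> g = g"
  by auto

lemma iv_simps [simp]: "\<alpha> (iv g) = \<beta> g" "\<beta> (iv g) = \<alpha> g" "iv g \<cdot> g = \<iota> (\<alpha> g)" "g \<cdot> iv g = \<iota> (\<beta> g)"
  using groupoid by (auto simp: is_groupoid_def)

lemma iv_unit [simp]: "iv (\<iota> x) = \<iota> x"
  using mul_unit(1)[of "iv (\<iota> x)"] iv_simps(3)[of "\<iota> x"] by simp

lemma iv_mul_cancel [simp]: "\<alpha> g = \<beta> h \<Longrightarrow> iv g \<cdot> (g \<cdot> h) = h"
  using mul_assoc[of "iv g" g h] by simp

lemma mul_iv_cancel [simp]: "\<alpha> g = \<alpha> h \<Longrightarrow> (g \<cdot> iv h) \<cdot> h = g"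
  using mul_assoc[of g "iv h" h] by simp

lemma mul_iv_cancel' [simp]: "\<alpha> g = \<beta> h \<Longrightarrow> (g \<cdot> h) \<cdot> iv h = g"
  using mul_assoc[of g h "iv h"] by simp

lemma atlas_A: "smooth_atlas A" and atlas_M: "smooth_atlas M"
  using lie by (auto simp: lie_groupoid_def)

lemmas fd_h = smooth_atlas_finite_dimensional[OF atlas_A]
lemmas fd_e = smooth_atlas_finite_dimensional[OF atlas_M]
lemmas flat_h = smooth_atlas_flat[OF fd_h]
lemmas flat_e = smooth_atlas_flat[OF fd_e]

lemma smooth_src: "smooth_map A M \<alpha>" and smooth_tgt: "smooth_map A M \<beta>"
  and smooth_unit: "smooth_map M A \<iota>" and smooth_iv: "smooth_map A A iv"
  using lie by (auto simp: lie_groupoid_def submersion_def)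

lemma continuous_src: "continuous_on UNIV \<alpha>" and continuous_tgt: "continuous_on UNIV \<beta>"
  and continuous_unit: "continuous_on UNIV \<iota>" and continuous_iv: "continuous_on UNIV iv"
  using smooth_map_on_continuous_on smooth_src smooth_tgt smooth_unit smooth_iv atlas_A atlas_M by blast+

lemma open_src_vimage: "open X \<Longrightarrow> open {g. \<alpha> g \<in> X}"
  using chart_preimage_open[OF open_UNIV continuous_src] by simp

lemma open_tgt_vimage: "open X \<Longrightarrow> open {g. \<beta> g \<in> X}"
  using chart_preimage_open[OF open_UNIV continuous_tgt] by simp

lemma smooth_mul: "smooth_map_on (prod_atlas A A) A (composable \<Gamma>) (\<lambda>(g, h). g \<cdot> h)"
  using lie by (simp add: lie_groupoid_def)

lemma continuous_mul: "continuous_on {(g, h). \<alpha> g = \<beta> h} (\<lambda>(g, h). g \<cdot> h)"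
proof -
  have "continuous_on U \<phi>" if "(U, \<phi>) \<in> prod_atlas A A" for U \<phi>
  proof -
    obtain U1 \<phi>1 U2 \<phi>2 where 1: "U = U1 \<times> U2" "\<phi> = map_prod \<phi>1 \<phi>2" "(U1, \<phi>1) \<in> A" "(U2, \<phi>2) \<in> A"
      using \<open>(U, \<phi>) \<in> prod_atlas A A\<close> by (auto simp: prod_atlas_def)
    have c: "continuous_on U1 \<phi>1" "continuous_on U2 \<phi>2"
      using is_chartD(4)[OF smooth_atlasD(1)[OF atlas_A 1(3)]] is_chartD(4)[OF smooth_atlasD(1)[OF atlas_A 1(4)]] by auto
    have "continuous_on (U1 \<times> U2) (\<lambda>x. (\<phi>1 (fst x), \<phi>2 (snd x)))"
      by (intro continuous_on_Pair continuous_on_compose2[OF c(1)] continuous_on_compose2[OF c(2)]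
          continuous_on_fst continuous_on_snd continuous_on_id) auto
    then show ?thesis by (simp add: 1 map_prod_def case_prod_beta')
  qed
  from smooth_map_on_continuous_on'[OF this atlas_A smooth_mul] show ?thesis
    by (simp add: composable_def)
qed

text \<open>
  Multiplication is smooth only along the submanifold of composable pairs, and its charts are products of
  charts; the coordinate expression of the pair is obtained from those of its two components.
\<close>

lemma smooth_mul_compose:
  fixes B :: "('n::topological_space, 'k::real_normed_vector) chart set"
  assumes B: "smooth_atlas B" and g: "smooth_map_on B A S g" and h: "smooth_map_on B A S h"
    and c: "\<And>x. x \<in> S \<Longrightarrow> \<alpha> (g x) = \<beta> (h x)"
  shows "smooth_map_on B A S (\<lambda>x. g x \<cdot> h x)"
proof (rule smooth_map_onI)
  fix p assume p: "p \<in> S"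
  have "(g p, h p) \<in> composable \<Gamma>" using c[OF p] by (simp add: composable_def)
  from smooth_map_on_obtain_charts[OF smooth_mul this] obtain U \<phi> V \<psi> W k where
    1: "(U, \<phi>) \<in> prod_atlas A A" "(V, \<psi>) \<in> A" "open W" "(g p, h p) \<in> W" "W \<subseteq> U"
      "(\<lambda>(g, h). g \<cdot> h) ` (composable \<Gamma> \<inter> W) \<subseteq> V" "smooth_on (\<phi> ` W) k"
      "\<And>q. q \<in> composable \<Gamma> \<inter> W \<Longrightarrow> \<psi> ((\<lambda>(g, h). g \<cdot> h) q) = k (\<phi> q)" by metis
  obtain U1 \<phi>1 U2 \<phi>2 where U: "U = U1 \<times> U2" "\<phi> = map_prod \<phi>1 \<phi>2" "(U1, \<phi>1) \<in> A" "(U2, \<phi>2) \<in> A"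
    using 1(1) by (auto simp: prod_atlas_def)
  have U1: "(U1, \<phi>1) \<in> smooth_charts A" and U2: "(U2, \<phi>2) \<in> smooth_charts A"
    using U smooth_atlasD(3)[OF atlas_A] by auto
  have gU: "g p \<in> U1" "h p \<in> U2" using 1(4,5) U(1) by auto
  obtain X \<xi> where X: "(X, \<xi>) \<in> B" "p \<in> X" using smooth_atlas_cover[OF B] by metis
  have X': "(X, \<xi>) \<in> smooth_charts B" using X smooth_atlasD(3)[OF B] by auto
  obtain W1 k1 where W1: "open W1" "p \<in> W1" "W1 \<subseteq> X" "g ` (S \<inter> W1) \<subseteq> U1" "smooth_on (\<xi> ` W1) k1"
    "\<And>q. q \<in> S \<inter> W1 \<Longrightarrow> \<phi>1 (g q) = k1 (\<xi> q)"
    using smooth_map_onE[OF B atlas_A g p X' X(2) U1 gU(1)] by metis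
  obtain W2 k2 where W2: "open W2" "p \<in> W2" "W2 \<subseteq> X" "h ` (S \<inter> W2) \<subseteq> U2" "smooth_on (\<xi> ` W2) k2"
    "\<And>q. q \<in> S \<inter> W2 \<Longrightarrow> \<phi>2 (h q) = k2 (\<xi> q)"
    using smooth_map_onE[OF B atlas_A h p X' X(2) U2 gU(2)] by metis
  note Xc = is_chartD[OF smooth_chartsD(1)[OF X']]
  have oW: "open (\<xi> ` (W1 \<inter> W2))" by (rule chart_open_image[OF smooth_chartsD(1)[OF X']]) (use W1 W2 in auto)
  have sm12: "smooth_on (\<xi> ` (W1 \<inter> W2)) (\<lambda>z. (k1 z, k2 z))"
    by (rule smooth_on_Pair; rule smooth_on_subset[OF _ oW]) (use W1(5) W2(5) in auto)
  define W3 where "W3 = {q \<in> W1 \<inter> W2. (k1 (\<xi> q), k2 (\<xi> q)) \<in> \<phi> ` W}"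
  have "continuous_on (W1 \<inter> W2) (\<lambda>q. (k1 (\<xi> q), k2 (\<xi> q)))"
    by (rule continuous_on_compose2[OF smooth_on_continuous_on[OF sm12] continuous_on_subset[OF Xc(4)]]) (use W1(3) in auto)
  then have o3: "open W3" unfolding W3_def
    by (rule chart_preimage_open[rotated]) (use W1(1) W2(1) smooth_on_open[OF 1(7)] in auto)
  have k: "(k1 (\<xi> q), k2 (\<xi> q)) = \<phi> (g q, h q)" if "q \<in> S \<inter> (W1 \<inter> W2)" for q
    using W1(6)[of q] W2(6)[of q] that by (simp add: U(2))
  have "(g p, h p) \<in> W" by (rule 1(4))
  then have p3: "p \<in> W3" unfolding W3_def using k[of p] p W1(2) W2(2) by simp
  have inW: "(g q, h q) \<in> composable \<Gamma> \<inter> W" if q: "q \<in> S \<inter> W3" for q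
  proof -
    have "\<phi> (g q, h q) \<in> \<phi> ` W" using q k[of q] by (auto simp: W3_def)
    then obtain a b where ab: "(a, b) \<in> W" "\<phi>1 (g q) = \<phi>1 a" "\<phi>2 (h q) = \<phi>2 b" by (auto simp: U(2))
    have "a \<in> U1" "b \<in> U2" using ab(1) 1(5) U(1) by auto
    moreover have "g q \<in> U1" "h q \<in> U2" using q W1(4) W2(4) by (auto simp: W3_def)
    ultimately have "g q = a" "h q = b"
      using ab is_chartD(3)[OF smooth_chartsD(1)[OF U1]] is_chartD(3)[OF smooth_chartsD(1)[OF U2]]
      by (auto simp: inj_on_def)
    moreover have "\<alpha> (g q) = \<beta> (h q)" using c q by blast
    ultimately show ?thesis using ab(1) by (simp add: composable_def)
  qed
  have o3': "open (\<xi> ` W3)" by (rule chart_open_image[OF smooth_chartsD(1)[OF X'] o3]) (use W1(3) in \<open>auto simp: W3_def\<close>)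
  have "smooth_on (\<xi> ` W3) (\<lambda>z. k (k1 z, k2 z))"
    by (rule smooth_on_compose[OF finite_dimensional_prod[OF fd_h fd_h] 1(7) smooth_on_subset[OF sm12 o3']])
      (auto simp: W3_def)
  moreover have "(\<lambda>x. g x \<cdot> h x) ` (S \<inter> W3) \<subseteq> V" using inW 1(6) by fastforce
  moreover have "\<forall>q\<in>S \<inter> W3. \<psi> (g q \<cdot> h q) = k (k1 (\<xi> q), k2 (\<xi> q))"
    using 1(8)[OF inW] k by (auto simp: W3_def)
  moreover have "W3 \<subseteq> X" using W1(3) by (auto simp: W3_def)
  ultimately show "\<exists>U \<phi> V \<psi> W k. (U, \<phi>) \<in> B \<and> (V, \<psi>) \<in> A \<and> open W \<and> p \<in> W \<and> W \<subseteq> U \<and>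
    (\<lambda>x. g x \<cdot> h x) ` (S \<inter> W) \<subseteq> V \<and> smooth_on (\<phi> ` W) k \<and> (\<forall>q\<in>S \<inter> W. \<psi> (g q \<cdot> h q) = k (\<phi> q))"
    using X(1) 1(2) o3 p3 by (intro exI[of _ X] exI[of _ \<xi>] exI[of _ V] exI[of _ \<psi>] exI[of _ W3]
        exI[of _ "\<lambda>z. k (k1 z, k2 z)"]) simp
qed

lemma continuous_right_mul: "continuous_on {h. \<alpha> h = \<beta> k} (\<lambda>h. h \<cdot> k)"
  by (rule smooth_map_on_continuous_on[OF atlas_A atlas_A
        smooth_mul_compose[OF atlas_A smooth_map_on_id[OF atlas_A] smooth_map_on_const[OF atlas_A atlas_A]]]) simp

lemma fibre_oD: "g \<in> fibre_o x \<Longrightarrow> \<alpha> g = x"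
  unfolding src_fibre_o_def src_fibre_def using connected_component_subset by fastforce

lemma unit_in_fibre_o [simp]: "\<iota> x \<in> fibre_o x"
  by (simp add: src_fibre_o_def src_fibre_def)

lemma connected_fibre_o: "connected (fibre_o x)"
  by (simp add: src_fibre_o_def)

lemma fibre_o_maximal:
  assumes "connected T" "\<And>h. h \<in> T \<Longrightarrow> \<alpha> h = x" "g \<in> T" "g \<in> fibre_o x"
  shows "T \<subseteq> fibre_o x"
proof -
  have "T \<subseteq> connected_component_set {g. \<alpha> g = x} g"
    by (rule connected_component_maximal[OF assms(3,1)]) (use assms(2) in auto)
  then show ?thesis using assms(4) connected_component_eq unfolding src_fibre_o_def src_fibre_def by metis
qed

lemma right_mul_connected:
  assumes "connected T" "\<And>h. h \<in> T \<Longrightarrow> \<alpha> h = \<beta> k"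
  shows "connected ((\<lambda>h. h \<cdot> k) ` T)"
  by (rule connected_continuous_image[OF continuous_on_subset[OF continuous_right_mul] assms(1)]) (use assms(2) in auto)

text \<open>
  Right translation by \<open>g\<close> maps the connected set \<open>\<Gamma>\<^sup>o\<close> over \<open>\<beta> g\<close> into the fibre over \<open>x\<close>, and the unit to
  \<open>g\<close>.
\<close>

lemma fibre_o_mul:
  assumes "g \<in> fibre_o x" "h \<in> fibre_o (\<beta> g)"
  shows "h \<cdot> g \<in> fibre_o x"
proof -
  have "(\<lambda>h. h \<cdot> g) ` fibre_o (\<beta> g) \<subseteq> fibre_o x"
  proof (rule fibre_o_maximal[OF right_mul_connected[OF connected_fibre_o]])
    show "\<alpha> h = \<beta> g" if "h \<in> fibre_o (\<beta> g)" for h using fibre_oD[OF that] .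
    show "\<alpha> h = x" if "h \<in> (\<lambda>h. h \<cdot> g) ` fibre_o (\<beta> g)" for h
      using that fibre_oD assms(1) by fastforce
    show "g \<in> (\<lambda>h. h \<cdot> g) ` fibre_o (\<beta> g)" by (rule image_eqI[of _ _ "\<iota> (\<beta> g)"]) auto
  qed (rule assms(1))
  then show ?thesis using assms(2) by blast
qed

lemma fibre_o_iv:
  assumes "g \<in> fibre_o x"
  shows "iv g \<in> fibre_o (\<beta> g)"
proof -
  have x: "\<alpha> g = x" using fibre_oD[OF assms] .
  have "(\<lambda>h. h \<cdot> iv g) ` fibre_o x \<subseteq> fibre_o (\<beta> g)"
  proof (rule fibre_o_maximal[OF right_mul_connected[OF connected_fibre_o]])
    show "\<alpha> h = \<beta> (iv g)" if "h \<in> fibre_o x" for h using fibre_oD[OF that] x by simp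
    show "\<alpha> h = \<beta> g" if "h \<in> (\<lambda>h. h \<cdot> iv g) ` fibre_o x" for h
      using that fibre_oD x by fastforce
    show "\<iota> (\<beta> g) \<in> (\<lambda>h. h \<cdot> iv g) ` fibre_o x" using assms by (intro image_eqI[of _ _ g]) auto
  qed simp
  moreover have "iv g \<in> (\<lambda>h. h \<cdot> iv g) ` fibre_o x" using x by (intro image_eqI[of _ _ "\<iota> x"]) auto
  ultimately show ?thesis by blast
qed

section \<open>Bisections and reachability\<close>

definition bis_mul where "bis_mul \<sigma> \<tau> = (\<lambda>x. \<sigma> (\<beta> (\<tau> x)) \<cdot> \<tau> x)"

definition bis_inv where "bis_inv \<sigma> = (\<lambda>y. iv (\<sigma> (inv_into UNIV (\<beta> \<circ> \<sigma>) y)))"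

lemma bisectionsD:
  assumes "\<sigma> \<in> bisections \<Gamma>"
  shows "smooth_map M A \<sigma>" "\<alpha> (\<sigma> x) = x" "bij (\<beta> \<circ> \<sigma>)" "smooth_map M M (\<beta> \<circ> \<sigma>)"
    "smooth_map M M (inv_into UNIV (\<beta> \<circ> \<sigma>))"
    "inv_into UNIV (\<beta> \<circ> \<sigma>) (\<beta> (\<sigma> x)) = x" "\<beta> (\<sigma> (inv_into UNIV (\<beta> \<circ> \<sigma>) x)) = x"
proof -
  show "smooth_map M A \<sigma>" and b: "bij (\<beta> \<circ> \<sigma>)" and "smooth_map M M (\<beta> \<circ> \<sigma>)"
    "smooth_map M M (inv_into UNIV (\<beta> \<circ> \<sigma>))" using assms by (auto simp: bisections_def diffeomorphism_def)
  show "\<alpha> (\<sigma> x) = x" using assms by (auto simp: bisections_def fun_eq_iff)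
  show "inv_into UNIV (\<beta> \<circ> \<sigma>) (\<beta> (\<sigma> x)) = x" using inv_f_f[OF bij_is_inj[OF b], of x] by simp
  show "\<beta> (\<sigma> (inv_into UNIV (\<beta> \<circ> \<sigma>) x)) = x" using surj_f_inv_f[OF bij_is_surj[OF b], of x] by simp
qed

lemma bisectionsI:
  assumes "smooth_map M A \<sigma>" "\<And>x. \<alpha> (\<sigma> x) = x" "smooth_map M M f'"
    "\<And>x. f' (\<beta> (\<sigma> x)) = x" "\<And>x. \<beta> (\<sigma> (f' x)) = x"
  shows "\<sigma> \<in> bisections \<Gamma>"
proof -
  have b: "bij (\<beta> \<circ> \<sigma>)" by (rule o_bij[of f']) (use assms in auto)
  have "inv_into UNIV (\<beta> \<circ> \<sigma>) = f'" by (rule inv_unique_comp) (use assms in auto)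
  moreover have "smooth_map M M (\<lambda>x. \<beta> (\<sigma> x))"
    by (rule smooth_map_on_compose[OF atlas_M atlas_A atlas_M assms(1) smooth_tgt]) simp
  ultimately show ?thesis using assms b by (auto simp: bisections_def diffeomorphism_def o_def)
qed

lemma bis_mul_bisection:
  assumes \<sigma>: "\<sigma> \<in> bisections \<Gamma>" and \<tau>: "\<tau> \<in> bisections \<Gamma>"
  shows "bis_mul \<sigma> \<tau> \<in> bisections \<Gamma>"
proof -
  note s = bisectionsD[OF \<sigma>] and t = bisectionsD[OF \<tau>]
  have "smooth_map M A (\<lambda>x. \<sigma> ((\<beta> \<circ> \<tau>) x))"
    by (rule smooth_map_on_compose[OF atlas_M atlas_M atlas_A t(4) s(1)]) simp
  then have 1: "smooth_map M A (bis_mul \<sigma> \<tau>)" unfolding bis_mul_def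
    by (intro smooth_mul_compose[OF atlas_M]) (use s t in auto)
  have 2: "smooth_map M M (\<lambda>x. inv_into UNIV (\<beta> \<circ> \<tau>) (inv_into UNIV (\<beta> \<circ> \<sigma>) x))"
    by (rule smooth_map_on_compose[OF atlas_M atlas_M atlas_M s(5) t(5)]) simp
  show ?thesis by (rule bisectionsI[OF 1 _ 2]) (simp_all add: bis_mul_def s t)
qed

lemma bis_inv_bisection:
  assumes \<sigma>: "\<sigma> \<in> bisections \<Gamma>"
  shows "bis_inv \<sigma> \<in> bisections \<Gamma>"
proof (rule bisectionsI)
  note s = bisectionsD[OF \<sigma>]
  have "smooth_map M A (\<lambda>x. \<sigma> (inv_into UNIV (\<beta> \<circ> \<sigma>) x))"
    by (rule smooth_map_on_compose[OF atlas_M atlas_M atlas_A s(5) s(1)]) simp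
  then show "smooth_map M A (bis_inv \<sigma>)" unfolding bis_inv_def
    by (rule smooth_map_on_compose[OF atlas_M atlas_A atlas_A _ smooth_iv]) simp
  show "\<alpha> (bis_inv \<sigma> x) = x" for x by (simp add: bis_inv_def s)
  show "smooth_map M M (\<beta> \<circ> \<sigma>)" by (rule s(4))
  show "(\<beta> \<circ> \<sigma>) (\<beta> (bis_inv \<sigma> x)) = x" for x by (simp add: bis_inv_def s)
  show "\<beta> (bis_inv \<sigma> ((\<beta> \<circ> \<sigma>) x)) = x" for x by (simp add: bis_inv_def s)
qed

text \<open>
  Values in the identity components are part of the definition so that the arrows produced in an
  inductive construction stay in the components on which it operates. With any
  compact set \<open>K\<close> in place of the support, closure under products and inverses is immediate.
\<close>

definition supported_bis :: "'m set \<Rightarrow> ('m \<Rightarrow> 'g) set" where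
  "supported_bis X = {\<sigma> \<in> bisections \<Gamma>. (\<forall>y. \<sigma> y \<in> fibre_o y) \<and> (\<exists>K. compact K \<and> K \<subseteq> X \<and> (\<forall>y. y \<notin> K \<longrightarrow> \<sigma> y = \<iota> y))}"

lemma supported_bis_supp:
  assumes "\<sigma> \<in> supported_bis X"
  shows "compact (bisection_supp \<Gamma> \<sigma>)" "bisection_supp \<Gamma> \<sigma> \<subseteq> X"
proof -
  obtain K where K: "compact K" "K \<subseteq> X" "\<And>y. y \<notin> K \<Longrightarrow> \<sigma> y = \<iota> y" using assms by (auto simp: supported_bis_def)
  then have "{y. \<sigma> y \<noteq> \<iota> y} \<subseteq> K" by blast
  then have s: "bisection_supp \<Gamma> \<sigma> \<subseteq> K" unfolding bisection_supp_def
    using K(1) by (simp add: closure_minimal compact_imp_closed)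
  then show "bisection_supp \<Gamma> \<sigma> \<subseteq> X" using K by blast
  have "closed (bisection_supp \<Gamma> \<sigma>)" by (simp add: bisection_supp_def)
  then show "compact (bisection_supp \<Gamma> \<sigma>)" using s K(1) compact_Int_closed[of K] by (metis inf.absorb2)
qed

lemma supported_bis_mono: "X \<subseteq> Y \<Longrightarrow> supported_bis X \<subseteq> supported_bis Y"
  unfolding supported_bis_def by blast

lemma supported_bis_outside: "\<sigma> \<in> supported_bis X \<Longrightarrow> y \<notin> X \<Longrightarrow> \<sigma> y = \<iota> y"
  unfolding supported_bis_def by blast

lemma supported_bis_mul:
  assumes "\<sigma> \<in> supported_bis X" "\<tau> \<in> supported_bis X"
  shows "bis_mul \<sigma> \<tau> \<in> supported_bis X"
proof -
  obtain K where K: "compact K" "K \<subseteq> X" "\<And>y. y \<notin> K \<Longrightarrow> \<sigma> y = \<iota> y" using assms by (auto simp: supported_bis_def)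
  obtain K' where K': "compact K'" "K' \<subseteq> X" "\<And>y. y \<notin> K' \<Longrightarrow> \<tau> y = \<iota> y" using assms by (auto simp: supported_bis_def)
  have b: "\<sigma> \<in> bisections \<Gamma>" "\<tau> \<in> bisections \<Gamma>" and f: "\<And>y. \<sigma> y \<in> fibre_o y" "\<And>y. \<tau> y \<in> fibre_o y"
    using assms by (auto simp: supported_bis_def)
  have "bis_mul \<sigma> \<tau> y \<in> fibre_o y" for y unfolding bis_mul_def by (rule fibre_o_mul[OF f(2) f(1)])
  moreover have "\<forall>y. y \<notin> K \<union> K' \<longrightarrow> bis_mul \<sigma> \<tau> y = \<iota> y" using K(3) K'(3) by (simp add: bis_mul_def)
  moreover have "compact (K \<union> K')" "K \<union> K' \<subseteq> X" using K K' by auto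
  ultimately show ?thesis unfolding supported_bis_def using bis_mul_bisection[OF b] by blast
qed

text \<open>
  Outside \<open>K\<close> the diffeomorphism \<open>\<beta> \<circ> \<sigma>\<close> is the identity, so the inverse bisection is a unit there.
\<close>

lemma supported_bis_inv:
  assumes "\<sigma> \<in> supported_bis X"
  shows "bis_inv \<sigma> \<in> supported_bis X"
proof -
  obtain K where K: "compact K" "K \<subseteq> X" "\<And>y. y \<notin> K \<Longrightarrow> \<sigma> y = \<iota> y" using assms by (auto simp: supported_bis_def)
  have b: "\<sigma> \<in> bisections \<Gamma>" and f: "\<And>y. \<sigma> y \<in> fibre_o y" using assms by (auto simp: supported_bis_def)
  have "bis_inv \<sigma> y \<in> fibre_o y" for y
    using fibre_o_iv[OF f[of "inv_into UNIV (\<beta> \<circ> \<sigma>) y"]] bisectionsD(7)[OF b] by (simp add: bis_inv_def)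
  moreover have "\<forall>y. y \<notin> K \<longrightarrow> bis_inv \<sigma> y = \<iota> y"
    using K(3) bisectionsD(6)[OF b] by (metis bis_inv_def iv_unit unit_simps(2))
  ultimately show ?thesis unfolding supported_bis_def using K bis_inv_bisection[OF b] by blast
qed

definition reach :: "'m set \<Rightarrow> 'g \<Rightarrow> 'g \<Rightarrow> bool" where
  "reach X g g' \<longleftrightarrow> (\<exists>\<sigma>\<in>supported_bis X. \<sigma> (\<beta> g) \<cdot> g = g')"

lemma reach_trans:
  assumes "reach X g g'" "reach X g' g''"
  shows "reach X g g''"
proof -
  obtain \<sigma> \<tau> where \<sigma>: "\<sigma> \<in> supported_bis X" "\<sigma> (\<beta> g) \<cdot> g = g'" and \<tau>: "\<tau> \<in> supported_bis X" "\<tau> (\<beta> g') \<cdot> g' = g''"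
    using assms by (auto simp: reach_def)
  have b: "\<sigma> \<in> bisections \<Gamma>" "\<tau> \<in> bisections \<Gamma>" using \<sigma> \<tau> by (auto simp: supported_bis_def)
  have "\<beta> g' = \<beta> (\<sigma> (\<beta> g))" using \<sigma>(2) bisectionsD(2)[OF b(1)] by auto
  then have "bis_mul \<tau> \<sigma> (\<beta> g) \<cdot> g = g''"
    using \<sigma>(2) \<tau>(2) bisectionsD(2)[OF b(1)] bisectionsD(2)[OF b(2)] by (simp add: bis_mul_def mul_assoc)
  then show ?thesis using supported_bis_mul[OF \<tau>(1) \<sigma>(1)] by (auto simp: reach_def)
qed

lemma reach_sym:
  assumes "reach X g g'"
  shows "reach X g' g"
proof -
  obtain \<sigma> where \<sigma>: "\<sigma> \<in> supported_bis X" "\<sigma> (\<beta> g) \<cdot> g = g'" using assms by (auto simp: reach_def)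
  have b: "\<sigma> \<in> bisections \<Gamma>" using \<sigma> by (auto simp: supported_bis_def)
  have "\<beta> g' = \<beta> (\<sigma> (\<beta> g))" using \<sigma>(2) bisectionsD(2)[OF b(1)] by auto
  then have "bis_inv \<sigma> (\<beta> g') = iv (\<sigma> (\<beta> g))" using bisectionsD(6)[OF b] by (simp add: bis_inv_def)
  then have "bis_inv \<sigma> (\<beta> g') \<cdot> g' = g" using \<sigma>(2) bisectionsD(2)[OF b] by auto
  then show ?thesis using supported_bis_inv[OF \<sigma>(1)] by (auto simp: reach_def)
qed

lemma smooth_charts_A: "(U, \<phi>) \<in> A \<Longrightarrow> (U, \<phi>) \<in> smooth_charts A"
  using smooth_atlasD(3)[OF atlas_A] by blast

lemma smooth_charts_M: "(U, \<phi>) \<in> M \<Longrightarrow> (U, \<phi>) \<in> smooth_charts M"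
  using smooth_atlasD(3)[OF atlas_M] by blast

section \<open>Bisections through arrows close to a unit\<close>

lemma smooth_src_coordinate:
  assumes "(V, \<psi>) \<in> smooth_charts M"
  shows "smooth_map_on A flat_atlas {h. \<alpha> h \<in> V} (\<lambda>h. \<psi> (\<alpha> h))"
  by (rule smooth_map_on_compose[OF atlas_A atlas_M flat_e smooth_map_on_subset[OF smooth_src]
        smooth_map_on_chart[OF atlas_M assms]]) auto

lemma smooth_tgt_coordinate:
  assumes "(V, \<psi>) \<in> smooth_charts M"
  shows "smooth_map_on A flat_atlas {h. \<beta> h \<in> V} (\<lambda>h. \<psi> (\<beta> h))"
  by (rule smooth_map_on_compose[OF atlas_A atlas_M flat_e smooth_map_on_subset[OF smooth_tgt]
        smooth_map_on_chart[OF atlas_M assms]]) auto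

text \<open>
  One chart of the base serves both for the source and for the target, since both maps send the unit at
  \<open>p\<close> to \<open>p\<close>.
\<close>

lemma unit_chart:
  obtains V \<psi> U \<phi> \<rho> L where "(V, \<psi>) \<in> smooth_charts M" "p \<in> V" "(U, \<phi>) \<in> smooth_charts A" "\<iota> p \<in> U"
    "\<beta> ` U \<subseteq> V" "\<rho> > 0" "\<phi> ` U = ball (\<phi> (\<iota> p)) \<rho>" "bounded_linear L" "surj L" "\<alpha> ` U \<subseteq> V"
    "\<And>h. h \<in> U \<Longrightarrow> \<psi> (\<alpha> h) = L (\<phi> h)"
proof -
  have "\<exists>(U, \<phi>)\<in>A. \<exists>(V, \<psi>)\<in>M. \<iota> p \<in> U \<and> \<alpha> (\<iota> p) \<in> V \<and> surj (D (\<psi> \<circ> \<alpha> \<circ> inv_into U \<phi>) (\<phi> (\<iota> p)))"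
    using lie unfolding lie_groupoid_def submersion_def by blast
  then obtain U0 \<phi>0 V \<psi> where 0: "(U0, \<phi>0) \<in> A" "(V, \<psi>) \<in> M" "\<iota> p \<in> U0" "p \<in> V"
    "surj (D (\<psi> \<circ> \<alpha> \<circ> inv_into U0 \<phi>0) (\<phi>0 (\<iota> p)))" by (elim bexE case_prodE) auto
  note V = smooth_charts_M[OF 0(2)] and U0 = smooth_charts_A[OF 0(1)]
  have oV: "open V" by (rule is_chartD(1)[OF smooth_chartsD(1)[OF V]])
  let ?X = "{h. \<beta> h \<in> V} \<inter> {h. \<alpha> h \<in> V}"
  have gX: "\<iota> p \<in> ?X" using 0(4) by simp
  have sj: "surj (D (\<lambda>z. \<psi> (\<alpha> (inv_into U0 \<phi>0 z))) (\<phi>0 (\<iota> p)))" using 0(5) by (simp add: o_def)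
  obtain U \<phi> \<rho> L where "(U, \<phi>) \<in> smooth_charts A" "\<iota> p \<in> U" "U \<subseteq> ?X \<inter> U0" "\<rho> > 0"
    "\<phi> ` U = ball (\<phi> (\<iota> p)) \<rho>" "bounded_linear L" "surj L" "\<And>h. h \<in> U \<Longrightarrow> \<psi> (\<alpha> h) = L (\<phi> h)"
    by (rule submersion_chart[OF atlas_A fd_e smooth_map_on_subset[OF smooth_src_coordinate[OF V] Int_lower2]
          open_Int[OF open_tgt_vimage[OF oV] open_src_vimage[OF oV]] gX U0 0(3) sj]) metis
  then show ?thesis by (intro that[OF V 0(4)]) auto
qed

text \<open>
  When the source map is \<open>l\<close> in coordinates, source fibres are level sets of \<open>l\<close>. The predicate \<open>P\<close>
  allows for further conditions such as omitted targets.
\<close>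

lemma fibre_in_chart:
  assumes U: "(U, \<phi>) \<in> smooth_charts A" and V: "(V, \<psi>) \<in> smooth_charts M" "\<alpha> ` U \<subseteq> V" "x \<in> V"
    and s: "\<And>h. h \<in> U \<Longrightarrow> \<psi> (\<alpha> h) = l (\<phi> h)"
  shows "{h\<in>U. \<alpha> h = x \<and> P h} = inv_into U \<phi> ` {z \<in> \<phi> ` U. l z = \<psi> x \<and> P (inv_into U \<phi> z)}" (is "?lhs = ?rhs")
proof -
  note Uc = is_chartD[OF smooth_chartsD(1)[OF U]] and Vc = is_chartD[OF smooth_chartsD(1)[OF V(1)]]
  have *: "\<alpha> h = x \<longleftrightarrow> l (\<phi> h) = \<psi> x" if "h \<in> U" for h
    using s[OF that] Vc(3) V(2,3) that by (metis image_subset_iff inj_on_def)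
  show ?thesis
  proof (intro equalityI subsetI)
    fix h assume h: "h \<in> ?lhs"
    then have "\<phi> h \<in> {z \<in> \<phi> ` U. l z = \<psi> x \<and> P (inv_into U \<phi> z)}" using *[of h] Uc(6)[of h] by simp
    then show "h \<in> ?rhs" using Uc(6)[of h] h by (metis (no_types, lifting) CollectD image_eqI)
  next
    fix h assume "h \<in> ?rhs"
    then obtain h' where "h' \<in> U" "h = inv_into U \<phi> (\<phi> h')" "l (\<phi> h') = \<psi> x" "P (inv_into U \<phi> (\<phi> h'))" by auto
    then show "h \<in> ?lhs" using *[of h'] Uc(6)[of h'] by simp
  qed
qed

lemma connected_in_chart:
  assumes U: "(U, \<phi>) \<in> smooth_charts A" and T: "connected T" "T \<subseteq> \<phi> ` U"
  shows "connected (inv_into U \<phi> ` T)"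
  by (rule connected_continuous_image[OF continuous_on_subset[OF is_chartD(5)[OF smooth_chartsD(1)[OF U]] T(2)] T(1)])

lemma connected_fibre_in_chart:
  assumes U: "(U, \<phi>) \<in> smooth_charts A" and V: "(V, \<psi>) \<in> smooth_charts M" "\<alpha> ` U \<subseteq> V" "x \<in> V"
    and s: "\<And>h. h \<in> U \<Longrightarrow> \<psi> (\<alpha> h) = l (\<phi> h)" and l: "linear l" and ball: "\<phi> ` U = ball z \<rho>"
  shows "connected {h\<in>U. \<alpha> h = x}"
proof -
  have "{z \<in> \<phi> ` U. l z = \<psi> x} = \<phi> ` U \<inter> l -` {\<psi> x}" by auto
  then have "convex {z \<in> \<phi> ` U. l z = \<psi> x}" unfolding ball using l
    by (metis convex_Int convex_ball convex_linear_vimage convex_singleton)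
  then have "connected (inv_into U \<phi> ` {z \<in> \<phi> ` U. l z = \<psi> x})"
    by (intro connected_in_chart[OF U convex_connected]) auto
  then show ?thesis using fibre_in_chart[OF U V s, of "\<lambda>_. True"] by simp
qed

text \<open>
  Smoothness across the boundary of the chart domain: the two formulas agree off \<open>K\<close>, whose preimage is
  closed in the Hausdorff manifold.
\<close>

lemma smooth_extend_by_identity:
  assumes V: "(V, \<psi>) \<in> smooth_charts M" and V0: "open V0" "V0 \<subseteq> V" and K: "compact K" "K \<subseteq> \<psi> ` V0"
    and P: "smooth_on UNIV P" "\<And>y. y \<notin> K \<Longrightarrow> P y = y" "P ` \<psi> ` V0 \<subseteq> \<psi> ` V0"
  shows "smooth_map M M (\<lambda>m. if m \<in> V0 then inv_into V \<psi> (P (\<psi> m)) else m)" (is "smooth_map M M ?f")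
proof (rule smooth_map_on_local[OF atlas_M])
  fix p
  note Vc = is_chartD[OF smooth_chartsD(1)[OF V]]
  define Km where "Km = inv_into V \<psi> ` K"
  have KV: "K \<subseteq> \<psi> ` V" using K(2) V0(2) by blast
  have cK: "closed Km" unfolding Km_def
    by (rule compact_imp_closed[OF compact_continuous_image[OF continuous_on_subset[OF Vc(5) KV] K(1)]])
  have out: "?f m = m" if "m \<notin> Km" for m
  proof (cases "m \<in> V0")
    case True
    then have "m = inv_into V \<psi> (\<psi> m)" using Vc(6)[of m] V0(2) by auto
    then have "\<psi> m \<notin> K" using that unfolding Km_def by blast
    then show ?thesis using P(2) True Vc(6)[of m] V0(2) by auto
  qed simp
  show "\<exists>X. open X \<and> p \<in> X \<and> smooth_map_on M M (UNIV \<inter> X) ?f"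
  proof (cases "p \<in> V0")
    case True
    have PV: "smooth_map_on flat_atlas flat_atlas (\<psi> ` V) P"
      using smooth_map_on_flat_iff[OF Vc(2)] smooth_on_subset[OF P(1) Vc(2)] by blast
    have "smooth_map_on M flat_atlas V0 (\<lambda>m. P (\<psi> m))"
      by (rule smooth_map_on_compose[OF atlas_M flat_e flat_e smooth_map_on_subset[OF smooth_map_on_chart[OF atlas_M V] V0(2)] PV])
        (use V0(2) in auto)
    then have "smooth_map_on M M V0 (\<lambda>m. inv_into V \<psi> (P (\<psi> m)))"
      by (rule smooth_map_on_compose[OF atlas_M flat_e atlas_M _ smooth_map_on_inv_chart[OF atlas_M V]])
        (use P(3) V0(2) in blast)
    then have "smooth_map_on M M V0 ?f" by (rule smooth_map_on_cong) simp
    then show ?thesis using True V0(1) by auto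
  next
    case False
    have "p \<notin> Km"
    proof
      assume "p \<in> Km"
      then obtain m where "m \<in> V0" "p = inv_into V \<psi> (\<psi> m)" using K(2) by (auto simp: Km_def)
      then show False using False Vc(6)[of m] V0(2) by auto
    qed
    moreover have "smooth_map_on M M (- Km) ?f"
      by (rule smooth_map_on_cong[OF smooth_map_on_id[OF atlas_M]]) (use out in auto)
    ultimately show ?thesis using cK by (intro exI[of _ "- Km"]) auto
  qed
qed

text \<open>
  In a chart of the arrows in which the source is linear, given by \<open>L\<close>, arrows over \<open>p\<close> close to \<open>\<iota> p\<close> are
  \<open>z\<^sub>0 + t\<close> with \<open>L t = 0\<close>. The bisection is \<open>\<zeta> + \<eta> t\<close>, where \<open>\<zeta>\<close> represents the units; it is a section
  because \<open>L\<close> does not see \<open>t\<close>. The segment from \<open>\<zeta>\<close> to \<open>\<zeta> + \<eta> t\<close> joins its values to units within the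
  source fibres.
\<close>

lemma local_bisections:
  assumes "open X" "p \<in> X"
  obtains N where "open N" "\<iota> p \<in> N" "\<And>g. g \<in> N \<Longrightarrow> \<alpha> g = p \<Longrightarrow> \<exists>\<sigma>\<in>supported_bis X. \<sigma> p = g"
proof -
  obtain V \<psi> U \<phi> \<rho> L where V: "(V, \<psi>) \<in> smooth_charts M" "p \<in> V" and
    U: "(U, \<phi>) \<in> smooth_charts A" "\<iota> p \<in> U" "\<beta> ` U \<subseteq> V" "\<rho> > 0" "\<phi> ` U = ball (\<phi> (\<iota> p)) \<rho>"
      "bounded_linear L" "surj L" "\<alpha> ` U \<subseteq> V" "\<And>h. h \<in> U \<Longrightarrow> \<psi> (\<alpha> h) = L (\<phi> h)"
    by (rule unit_chart[of p]) (rule that)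
  note Vc = is_chartD[OF smooth_chartsD(1)[OF V(1)]]
  note Uc = is_chartD[OF smooth_chartsD(1)[OF U(1)]]
  define z0 where "z0 = \<phi> (\<iota> p)"
  define Z where "Z = ball z0 \<rho>"
  have ZU: "\<phi> ` U = Z" using U(5) by (simp add: Z_def z0_def)
  have invU: "inv_into U \<phi> z \<in> U" "\<phi> (inv_into U \<phi> z) = z" if "z \<in> Z" for z
    using that by (auto simp flip: ZU simp: Uc(6))
  have lin: "linear L" using U(6) by (rule bounded_linear.linear)
  define V0 where "V0 = V \<inter> X \<inter> {m. \<iota> m \<in> U}"
  have "open {m. \<iota> m \<in> U}" using chart_preimage_open[OF open_UNIV continuous_unit Uc(1)] by simp
  then have oV0: "open V0" unfolding V0_def using Vc(1) assms(1) by blast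
  have V0V: "V0 \<subseteq> V" by (auto simp: V0_def)
  define Y0 where "Y0 = \<psi> ` V0"
  have oY0: "open Y0" unfolding Y0_def by (rule chart_open_image[OF smooth_chartsD(1)[OF V(1)] oV0 V0V])
  have pV0: "p \<in> V0" using V(2) U(2) assms(2) by (simp add: V0_def)
  have invV: "inv_into V \<psi> y \<in> V0" "\<psi> (inv_into V \<psi> y) = y" if "y \<in> Y0" for y
    using that V0V by (auto simp: Y0_def Vc(6) subset_iff)
  define \<zeta> where "\<zeta> y = \<phi> (\<iota> (inv_into V \<psi> y))" for y
  define b where "b z = \<psi> (\<beta> (inv_into U \<phi> z))" for z
  have sm\<zeta>: "smooth_on Y0 \<zeta>"
  proof -
    have "smooth_map_on flat_atlas A Y0 (\<lambda>y. \<iota> (inv_into V \<psi> y))"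
      by (rule smooth_map_on_compose[OF flat_e atlas_M atlas_A smooth_map_on_subset[OF smooth_map_on_inv_chart[OF atlas_M V(1)]] smooth_unit])
        (use V0V in \<open>auto simp: Y0_def\<close>)
    then have "smooth_map_on flat_atlas flat_atlas Y0 \<zeta>" unfolding \<zeta>_def
      by (rule smooth_map_on_compose[OF flat_e atlas_A flat_h _ smooth_map_on_chart[OF atlas_A U(1)]])
        (use invV in \<open>auto simp: V0_def\<close>)
    then show ?thesis using smooth_map_on_flat_iff[OF oY0] by blast
  qed
  have smb: "smooth_on Z b"
  proof -
    have "smooth_map_on flat_atlas flat_atlas (\<phi> ` U) b" unfolding b_def
      by (rule smooth_map_on_compose[OF flat_h atlas_A flat_e smooth_map_on_inv_chart[OF atlas_A U(1)] smooth_tgt_coordinate[OF V(1)]])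
        (use U(3) Uc(6) in auto)
    then show ?thesis using smooth_map_on_flat_iff[OF Uc(2), of b] ZU by simp
  qed
  have \<zeta>Z: "\<zeta> ` Y0 \<subseteq> Z" using invV(1) by (auto simp: \<zeta>_def V0_def simp flip: ZU)
  have sec: "b (\<zeta> y) = y" if "y \<in> Y0" for y
    using invV[OF that] Uc(6) by (simp add: b_def \<zeta>_def V0_def)
  have L\<zeta>: "L (\<zeta> y) = y" if "y \<in> Y0" for y
    using invV[OF that] U(9)[of "\<iota> (inv_into V \<psi> y)"] by (simp add: \<zeta>_def V0_def)
  have y0: "\<psi> p \<in> Y0" using pV0 by (simp add: Y0_def)
  have \<zeta>p: "\<zeta> (\<psi> p) = z0" using Vc(6)[OF V(2)] by (simp add: \<zeta>_def z0_def)
  obtain \<eta> K \<epsilon> where \<eta>: "smooth_on UNIV \<eta>" "\<eta> (\<psi> p) = (1::real)" "compact K" "K \<subseteq> Y0" "\<And>y. y \<notin> K \<Longrightarrow> \<eta> y = 0"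
    "\<epsilon> > 0"
    "\<And>t y s. norm t < \<epsilon> \<Longrightarrow> y \<in> Y0 \<Longrightarrow> s \<in> {0..1} \<Longrightarrow> \<zeta> y + (s * \<eta> y) *\<^sub>R t \<in> Z"
    "\<And>t. norm t < \<epsilon> \<Longrightarrow> \<exists>T T'. smooth_on UNIV T \<and> smooth_on UNIV T' \<and> (\<forall>y. T' (T y) = y) \<and> (\<forall>y. T (T' y) = y) \<and>
        (\<forall>y\<in>Y0. T y = b (\<zeta> y + \<eta> y *\<^sub>R t)) \<and> (\<forall>y. y \<notin> K \<longrightarrow> T y = y)"
    by (rule small_diffeomorphisms[OF fd_e fd_h sm\<zeta> y0 smb \<zeta>Z sec]) blast+
  define Km where "Km = inv_into V \<psi> ` K"
  have "compact Km" unfolding Km_def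
    by (rule compact_continuous_image[OF continuous_on_subset[OF Vc(5)] \<eta>(3)]) (use \<eta>(4) V0V in \<open>auto simp: Y0_def\<close>)
  have KmV: "Km \<subseteq> V0" using \<eta>(4) invV(1) by (auto simp: Km_def)
  have notK: "\<psi> m \<notin> K" if "m \<in> V0" "m \<notin> Km" for m
    using that Vc(6)[of m] V0V unfolding Km_def by (metis image_eqI subsetD)
  define N where "N = {h\<in>U. \<phi> h \<in> ball z0 \<epsilon>}"
  have oN: "open N" unfolding N_def by (rule chart_preimage_open[OF Uc(1,4)]) simp
  have "\<exists>\<sigma>\<in>supported_bis X. \<sigma> p = g" if g: "g \<in> N" "\<alpha> g = p" for g
  proof -
    define t where "t = \<phi> g - z0"
    have t: "norm t < \<epsilon>" using g(1) by (simp add: N_def t_def dist_norm norm_minus_commute)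
    have gU: "g \<in> U" using g(1) by (simp add: N_def)
    have "L (\<phi> g) = L z0" using U(9)[OF gU] U(9)[OF U(2)] g(2) by (simp add: z0_def)
    then have Lt: "L t = 0" by (simp add: t_def linear_diff[OF lin])
    obtain T T' where T: "smooth_on UNIV T" "smooth_on UNIV T'" "\<And>y. T' (T y) = y" "\<And>y. T (T' y) = y"
      "\<And>y. y \<in> Y0 \<Longrightarrow> T y = b (\<zeta> y + \<eta> y *\<^sub>R t)" "\<And>y. y \<notin> K \<Longrightarrow> T y = y"
      using \<eta>(8)[OF t] by metis
    have T'out: "T' y = y" if "y \<notin> K" for y using T(3)[of y] T(6)[OF that] by simp
    have TY: "T y \<in> Y0" "T' y \<in> Y0" if "y \<in> Y0" for y
    proof -
      show "T y \<in> Y0"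
        using T(3) T(6)[of "T y"] \<eta>(4) that by (metis subsetD)
      show "T' y \<in> Y0"
        using T(4) T'out[of "T' y"] \<eta>(4) that by (metis subsetD)
    qed
    define c where "c m s = inv_into U \<phi> (\<zeta> (\<psi> m) + (s * \<eta> (\<psi> m)) *\<^sub>R t)" for m s
    define \<sigma> where "\<sigma> m = (if m \<in> V0 then c m 1 else \<iota> m)" for m
    have cZ: "\<zeta> (\<psi> m) + (s * \<eta> (\<psi> m)) *\<^sub>R t \<in> Z" if "m \<in> V0" "s \<in> {0..1}" for m s
      by (rule \<eta>(7)[OF t _ that(2)]) (use that in \<open>simp add: Y0_def\<close>)
    have cs: "c m s \<in> U" "\<alpha> (c m s) = m" if m: "m \<in> V0" and s: "s \<in> {0..1}" for m s
    proof -
      note z = cZ[OF m s]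
      show cU: "c m s \<in> U" unfolding c_def by (rule invU(1)[OF z])
      have "\<psi> (\<alpha> (c m s)) = L (\<zeta> (\<psi> m) + (s * \<eta> (\<psi> m)) *\<^sub>R t)"
        using U(9)[OF cU] invU(2)[OF z] by (simp add: c_def)
      also have "\<dots> = \<psi> m" using L\<zeta>[of "\<psi> m"] m by (simp add: linear_add[OF lin] linear_cmul[OF lin] Lt Y0_def)
      finally show "\<alpha> (c m s) = m" using U(8) cU m V0V Vc(3) by (auto simp: inj_on_def)
    qed
    have \<zeta>\<psi>: "\<zeta> (\<psi> m) = \<phi> (\<iota> m)" "\<iota> m \<in> U" if "m \<in> V0" for m
      using that V0V Vc(6)[of m] by (auto simp: \<zeta>_def V0_def)
    have c0: "c m 0 = \<iota> m" if "m \<in> V0" for m using \<zeta>\<psi>[OF that] Uc(6) by (simp add: c_def)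
    have out: "\<sigma> m = \<iota> m" if "m \<notin> Km" for m
      using notK[of m] that \<eta>(5)[of "\<psi> m"] \<zeta>\<psi>[of m] Uc(6) by (simp add: \<sigma>_def c_def)
    have \<alpha>\<sigma>: "\<alpha> (\<sigma> m) = m" for m using cs(2)[of m 1] by (simp add: \<sigma>_def)
    have sm\<sigma>: "smooth_map M A \<sigma>"
    proof (rule smooth_map_on_local[OF atlas_M])
      fix m
      show "\<exists>X. open X \<and> m \<in> X \<and> smooth_map_on M A (UNIV \<inter> X) \<sigma>"
      proof (cases "m \<in> V0")
        case True
        have "smooth_on Y0 (\<lambda>y. \<zeta> y + (1 * \<eta> y) *\<^sub>R t)" unfolding mult_1
          by (rule smooth_on_add[OF sm\<zeta> smooth_on_scaleR[OF smooth_on_subset[OF \<eta>(1) oY0] smooth_on_const[OF oY0]]]) simp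
        then have 1: "smooth_map_on flat_atlas flat_atlas Y0 (\<lambda>y. \<zeta> y + (1 * \<eta> y) *\<^sub>R t)"
          using smooth_map_on_flat_iff[OF oY0] by blast
        have "smooth_map_on M flat_atlas V0 (\<lambda>m. \<zeta> (\<psi> m) + (1 * \<eta> (\<psi> m)) *\<^sub>R t)"
          by (rule smooth_map_on_compose[OF atlas_M flat_e flat_h smooth_map_on_subset[OF smooth_map_on_chart[OF atlas_M V(1)] V0V] 1])
            (simp add: Y0_def)
        then have "smooth_map_on M A V0 (\<lambda>m. c m 1)" unfolding c_def
          by (rule smooth_map_on_compose[OF atlas_M flat_h atlas_A _ smooth_map_on_inv_chart[OF atlas_A U(1)]])
            (use cZ[of _ 1] ZU in auto)
        then have "smooth_map_on M A V0 \<sigma>" by (rule smooth_map_on_cong) (simp add: \<sigma>_def)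
        then show ?thesis using True oV0 by auto
      next
        case False
        have "smooth_map_on M A (- Km) \<sigma>"
          by (rule smooth_map_on_cong[OF smooth_map_on_subset[OF smooth_unit]]) (use out in auto)
        then show ?thesis using False KmV compact_imp_closed[OF \<open>compact Km\<close>] by (intro exI[of _ "- Km"]) auto
      qed
    qed
    define f' where "f' m = (if m \<in> V0 then inv_into V \<psi> (T' (\<psi> m)) else m)" for m
    have smf': "smooth_map M M f'" unfolding f'_def
      by (rule smooth_extend_by_identity[OF V(1) oV0 V0V \<eta>(3) \<eta>(4)[unfolded Y0_def] T(2) T'out])
        (use TY(2) in \<open>auto simp: Y0_def\<close>)
    have \<beta>\<sigma>: "\<beta> (\<sigma> m) = (if m \<in> V0 then inv_into V \<psi> (T (\<psi> m)) else m)" for m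
    proof (cases "m \<in> V0")
      case True
      then have y: "\<psi> m \<in> Y0" by (simp add: Y0_def)
      have "T (\<psi> m) = \<psi> (\<beta> (c m 1))" using T(5)[OF y] by (simp add: b_def c_def)
      moreover have "\<beta> (c m 1) \<in> V" using cs(1)[OF True, of 1] U(3) by auto
      ultimately show ?thesis using True Vc(6) by (simp add: \<sigma>_def)
    qed (simp add: \<sigma>_def)
    have f1: "f' (\<beta> (\<sigma> m)) = m" for m
    proof (cases "m \<in> V0")
      case True
      then have y: "\<psi> m \<in> Y0" by (simp add: Y0_def)
      show ?thesis using True invV[OF TY(1)[OF y]] T(3) Vc(6)[of m] V0V by (auto simp: \<beta>\<sigma> f'_def)
    qed (simp add: \<beta>\<sigma> f'_def)
    have f2: "\<beta> (\<sigma> (f' m)) = m" for m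
    proof (cases "m \<in> V0")
      case True
      then have y: "\<psi> m \<in> Y0" by (simp add: Y0_def)
      show ?thesis using True invV[OF TY(2)[OF y]] T(4) Vc(6)[of m] V0V by (auto simp: \<beta>\<sigma> f'_def)
    qed (simp add: \<beta>\<sigma> f'_def)
    have "\<sigma> \<in> bisections \<Gamma>" by (rule bisectionsI[OF sm\<sigma> \<alpha>\<sigma> smf' f1 f2])
    moreover have "\<sigma> m \<in> fibre_o m" for m
    proof (cases "m \<in> V0")
      case True
      have "continuous_on {0..1} (c m)" unfolding c_def
        by (rule continuous_on_compose2[OF Uc(5)[unfolded ZU]]) (use cZ[OF True] in \<open>auto intro!: continuous_intros\<close>)
      then have "connected (c m ` {0..1})" using connected_continuous_image connected_Icc by blast
      then have "c m ` {0..1} \<subseteq> fibre_o m"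
        by (rule fibre_o_maximal[of _ _ "\<iota> m"]) (use cs(2)[OF True] c0[OF True] in \<open>auto intro: image_eqI[of _ _ 0]\<close>)
      then show ?thesis using True by (auto simp: \<sigma>_def)
    qed (simp add: \<sigma>_def)
    moreover have "\<exists>K. compact K \<and> K \<subseteq> X \<and> (\<forall>y. y \<notin> K \<longrightarrow> \<sigma> y = \<iota> y)"
      using \<open>compact Km\<close> KmV out by (intro exI[of _ Km]) (auto simp: V0_def)
    ultimately have "\<sigma> \<in> supported_bis X" by (simp add: supported_bis_def)
    moreover have "\<sigma> p = g" using pV0 \<zeta>p \<eta>(2) Uc(6)[OF gU] by (simp add: \<sigma>_def c_def t_def)
    ultimately show ?thesis by blast
  qed
  then show ?thesis using that[OF oN] U(2) \<eta>(6) by (simp add: N_def z0_def)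
qed

text \<open>
  Right translation by the inverse of \<open>g\<close> reduces the claim to arrows close to a unit.
\<close>

lemma reach_local:
  assumes "open X" "\<beta> g \<in> X"
  obtains N where "open N" "g \<in> N" "\<And>g'. g' \<in> N \<Longrightarrow> \<alpha> g' = \<alpha> g \<Longrightarrow> reach X g g'"
proof -
  obtain N0 where N0: "open N0" "\<iota> (\<beta> g) \<in> N0" "\<And>h. h \<in> N0 \<Longrightarrow> \<alpha> h = \<beta> g \<Longrightarrow> \<exists>\<sigma>\<in>supported_bis X. \<sigma> (\<beta> g) = h"
    using local_bisections[OF assms] by metis
  have c: "continuous_on {h. \<alpha> h = \<beta> (iv g)} (\<lambda>h. h \<cdot> iv g)" by (rule continuous_right_mul)
  obtain N where N: "open N" "N \<inter> {h. \<alpha> h = \<beta> (iv g)} = (\<lambda>h. h \<cdot> iv g) -` N0 \<inter> {h. \<alpha> h = \<beta> (iv g)}"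
    using c N0(1) unfolding continuous_on_open_invariant by metis
  show ?thesis
  proof (rule that[OF N(1)])
    have "g \<in> (\<lambda>h. h \<cdot> iv g) -` N0 \<inter> {h. \<alpha> h = \<beta> (iv g)}" using N0(2) by simp
    then show "g \<in> N" unfolding N(2)[symmetric] by blast
    fix g' assume g': "g' \<in> N" "\<alpha> g' = \<alpha> g"
    then have "g' \<in> N \<inter> {h. \<alpha> h = \<beta> (iv g)}" by simp
    then have "g' \<cdot> iv g \<in> N0" unfolding N(2) by simp
    then obtain \<sigma> where "\<sigma> \<in> supported_bis X" "\<sigma> (\<beta> g) = g' \<cdot> iv g" using N0(3)[of "g' \<cdot> iv g"] g'(2) by auto
    then show "reach X g g'" unfolding reach_def using g'(2) by (intro bexI[of _ \<sigma>]) simp_all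
  qed
qed

lemma reach_connected:
  assumes "open X" "connected Y" "\<And>h. h \<in> Y \<Longrightarrow> \<alpha> h = x" "\<And>h. h \<in> Y \<Longrightarrow> \<beta> h \<in> X" "g \<in> Y" "g' \<in> Y"
  shows "reach X g g'"
proof (rule connected_equivalence_relation[OF assms(2,5,6)])
  show "reach X b a" if "reach X a b" for a b using that by (rule reach_sym)
  show "reach X a c" if "reach X a b" "reach X b c" for a b c using that by (rule reach_trans)
  fix a assume a: "a \<in> Y"
  obtain N where N: "open N" "a \<in> N" "\<And>g'. g' \<in> N \<Longrightarrow> \<alpha> g' = \<alpha> a \<Longrightarrow> reach X a g'"
    using reach_local[OF assms(1) assms(4)[OF a]] by metis
  show "\<exists>T. openin (top_of_set Y) T \<and> a \<in> T \<and> (\<forall>b\<in>T. reach X a b)"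
    by (rule exI[of _ "Y \<inter> N"]) (use N a assms(3) in \<open>auto simp: openin_open\<close>)
qed

end

section \<open>Fibres of rank at least two\<close>

text \<open>
  A straight segment between two points may meet the omitted codimension two subspace. It is then
  replaced by two segments through a point close to the first end, displaced in the direction \<open>i p\<close>
  orthogonal to the value \<open>p\<close> at that end; at most one size of the displacement is bad, so one of \<open>s\<^sub>1\<close> and
  half of it will do.
\<close>

lemma connected_avoid_codim2:
  fixes L :: "'h::real_normed_vector \<Rightarrow> 'e::real_normed_vector \<times> complex"
  assumes L: "bounded_linear L" "surj L"
  shows "connected {z \<in> ball z0 \<rho>. fst (L z) = e \<and> snd (L z) \<noteq> c}" (is "connected ?C")
  unfolding connected_iff_connected_component
proof (intro ballI)
  have lin: "linear L" using L(1) by (rule bounded_linear.linear)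
  have seg: "connected_component ?C a b"
    if ab: "a \<in> ?C" "b \<in> ?C"
      and ne: "\<And>t. 0 \<le> t \<Longrightarrow> t \<le> 1 \<Longrightarrow> (1 - t) *\<^sub>R (snd (L a) - c) + t *\<^sub>R (snd (L b) - c) \<noteq> 0" for a b
  proof (rule connected_componentI)
    show "connected (closed_segment a b)" by simp
    show "closed_segment a b \<subseteq> ?C"
    proof
      fix z assume "z \<in> closed_segment a b"
      then obtain t where t: "0 \<le> t" "t \<le> 1" "z = (1 - t) *\<^sub>R a + t *\<^sub>R b" by (auto simp: closed_segment_def)
      have "z \<in> ball z0 \<rho>"
        using closed_segment_subset[OF _ _ convex_ball, of a z0 \<rho> b] ab \<open>z \<in> closed_segment a b\<close> by blast
      moreover have Lz: "L z = (1 - t) *\<^sub>R L a + t *\<^sub>R L b"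
        by (simp add: t(3) linear_add[OF lin] linear_cmul[OF lin])
      have "fst (L z) = e" using ab by (simp add: Lz algebra_simps)
      moreover have "snd (L z) - c = (1 - t) *\<^sub>R (snd (L a) - c) + t *\<^sub>R (snd (L b) - c)"
        by (simp add: Lz algebra_simps)
      then have "snd (L z) \<noteq> c" using ne[OF t(1,2)] by auto
      ultimately show "z \<in> ?C" by simp
    qed
  qed auto
  fix a b assume ab: "a \<in> ?C" "b \<in> ?C"
  define p where "p = snd (L a) - c"
  define q where "q = snd (L b) - c"
  have pq: "p \<noteq> 0" "q \<noteq> 0" using ab by (auto simp: p_def q_def)
  obtain w where w: "L w = (0, \<i> * p)" using L(2) by (metis surjD)
  obtain d where d: "d > 0" "ball a d \<subseteq> ball z0 \<rho>"
    using ab open_contains_ball_eq[OF open_ball, of a z0 \<rho>] by blast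
  define n where "n = norm w + 1"
  have n: "n > 0" "norm w \<le> n" by (simp_all add: n_def add_nonneg_pos)
  define s1 where "s1 = d / 2 / n"
  have s1: "s1 > 0" using d n by (simp add: s1_def)
  have small: "a + s *\<^sub>R w \<in> ball z0 \<rho>" if "0 < s" "s \<le> s1" for s
  proof -
    have "s * norm w \<le> s1 * n" using that n by (intro mult_mono) auto
    also have "\<dots> = d / 2" using n by (simp add: s1_def)
    finally have "s * norm w < d" using d(1) by simp
    then show ?thesis using that by (intro subsetD[OF d(2)]) (simp add: dist_norm)
  qed
  obtain s where s: "0 < s" "s \<le> s1" "Im (q / p) \<noteq> s * Re (q / p) \<or> Re (q / p) \<ge> 0"
  proof (cases "Im (q / p) = s1 * Re (q / p)")
    case True
    then show ?thesis using that[of s1] that[of "s1/2"] s1 by auto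
  qed (use that[of s1] s1 in auto)
  define a' where "a' = a + s *\<^sub>R w"
  have La': "L a' = L a + s *\<^sub>R (0, \<i> * p)" by (simp add: a'_def linear_add[OF lin] linear_cmul[OF lin] w)
  have pa': "snd (L a') - c = p * (1 + \<i> * s)" by (simp add: La' p_def algebra_simps scaleR_conv_of_real)
  have ns: "1 + \<i> * of_real r \<noteq> 0" for r :: real by (simp add: complex_eq_iff)
  have a'C: "a' \<in> ?C"
  proof -
    have "snd (L a') - c \<noteq> 0" unfolding pa' using pq(1) ns by simp
    then show ?thesis using small[OF s(1,2)] ab by (auto simp: a'_def[symmetric] La')
  qed
  have "connected_component ?C a a'"
  proof (rule seg[OF ab(1) a'C])
    fix t :: real
    have "(1 - t) *\<^sub>R (snd (L a) - c) + t *\<^sub>R (snd (L a') - c) = p * (1 + \<i> * of_real (t * s))"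
      unfolding pa' p_def[symmetric] by (simp add: scaleR_conv_of_real algebra_simps)
    then show "(1 - t) *\<^sub>R (snd (L a) - c) + t *\<^sub>R (snd (L a') - c) \<noteq> 0"
      using pq(1) ns[of "t * s"] by (metis mult_eq_0_iff)
  qed
  moreover have "connected_component ?C a' b"
  proof (rule seg[OF a'C ab(2)], rule notI)
    fix t :: real assume t: "0 \<le> t" "t \<le> 1" "(1 - t) *\<^sub>R (snd (L a') - c) + t *\<^sub>R (snd (L b) - c) = 0"
    have "p * ((1 - t) *\<^sub>R (1 + \<i> * s) + t *\<^sub>R (q / p)) = (1 - t) *\<^sub>R (p * (1 + \<i> * s)) + t *\<^sub>R q"
      using pq(1) by (simp add: algebra_simps)
    also have "\<dots> = 0" using t(3) unfolding pa' q_def[symmetric] by simp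
    finally have z: "(1 - t) *\<^sub>R (1 + \<i> * s) + t *\<^sub>R (q / p) = 0" using pq(1) by simp
    have re: "(1 - t) + t * Re (q / p) = 0" and im: "(1 - t) * s + t * Im (q / p) = 0"
      using arg_cong[OF z, of Re] arg_cong[OF z, of Im] by simp_all
    show False
    proof (cases "t = 0")
      case False
      have "t * Im (q / p) = t * (s * Re (q / p))" using re im by algebra
      then have "Im (q / p) = s * Re (q / p)" using False by simp
      then have "Re (q / p) \<ge> 0" using s(3) by blast
      then have "1 - t = 0" "t * Re (q / p) = 0" using re t(1,2) mult_nonneg_nonneg[of t "Re (q / p)"] by linarith+
      then have "Re (q / p) = 0" "Im (q / p) = 0" using im by auto
      then have "q / p = 0" by (simp add: complex_eq_iff)
      then show False using pq by simp
    qed (use re in simp)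
  qed
  ultimately show "connected_component ?C a b" by (rule connected_component_trans)
qed

lemma exists_complex_coordinate:
  fixes w1 w2 :: "'e::real_normed_vector"
  assumes fd: "finite_dimensional TYPE('e)" and ind: "\<And>c d::real. c *\<^sub>R w1 + d *\<^sub>R w2 = 0 \<Longrightarrow> c = 0 \<and> d = 0"
  obtains \<pi> :: "'e \<Rightarrow> complex" where "bounded_linear \<pi>" "\<pi> w1 = 1" "\<pi> w2 = \<i>"
proof -
  have ne: "w1 \<noteq> w2" using ind[of 1 "-1"] by auto
  have "w2 \<noteq> 0" using ind[of 0 1] by auto
  moreover have "w1 \<notin> span {w2}"
  proof
    assume "w1 \<in> span {w2}"
    then obtain k where "w1 = k *\<^sub>R w2" by (auto simp: span_singleton)
    then show False using ind[of 1 "-k"] by simp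
  qed
  ultimately have "independent {w1, w2}" using ne by (simp add: independent_insert)
  then obtain \<pi> :: "'e \<Rightarrow> complex" where \<pi>: "linear \<pi>" "\<forall>w\<in>{w1, w2}. \<pi> w = (if w = w1 then 1 else \<i>)"
    using linear_independent_extend[of "{w1, w2}" "\<lambda>w. if w = w1 then 1 else \<i>"] by blast
  then show ?thesis using that[of \<pi>] finite_dimensional_bounded_linear[OF fd] ne by auto
qed

context lie_gpd begin

text \<open>
  A topological form of the condition that the target map has rank at least two along the fibre: the arrows
  with the same target as \<open>g\<close> do not separate the fibre near \<open>g\<close>. In this form its invariance under
  left multiplication by bisections is evident.
\<close>

definition punctured :: "'m \<Rightarrow> 'g \<Rightarrow> bool" where
  "punctured x g \<longleftrightarrow> (\<forall>X. open X \<and> g \<in> X \<longrightarrow> (\<exists>Y. open Y \<and> g \<in> Y \<and> Y \<subseteq> X \<and> connected {h\<in>Y. \<alpha> h = x} \<and>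
     connected {h\<in>Y. \<alpha> h = x \<and> \<beta> h \<noteq> \<beta> g} \<and> {h\<in>Y. \<alpha> h = x \<and> \<beta> h \<noteq> \<beta> g} \<noteq> {}))"

lemma puncturedE:
  assumes "punctured x g" "open X" "g \<in> X"
  obtains Y where "open Y" "g \<in> Y" "Y \<subseteq> X" "connected {h\<in>Y. \<alpha> h = x}"
     "connected {h\<in>Y. \<alpha> h = x \<and> \<beta> h \<noteq> \<beta> g}" "{h\<in>Y. \<alpha> h = x \<and> \<beta> h \<noteq> \<beta> g} \<noteq> {}"
  using mp[OF spec[OF assms(1)[unfolded punctured_def], of X] conjI[OF assms(2,3)]] that
  by (elim exE conjE)

definition left_mul :: "('m \<Rightarrow> 'g) \<Rightarrow> 'g \<Rightarrow> 'g" where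
  "left_mul \<sigma> h = \<sigma> (\<beta> h) \<cdot> h"

lemma left_mul:
  assumes \<sigma>: "\<sigma> \<in> bisections \<Gamma>"
  shows "continuous_on UNIV (left_mul \<sigma>)" "\<alpha> (left_mul \<sigma> h) = \<alpha> h" "\<beta> (left_mul \<sigma> h) = \<beta> (\<sigma> (\<beta> h))"
    "left_mul (bis_inv \<sigma>) (left_mul \<sigma> h) = h" "left_mul \<sigma> (left_mul (bis_inv \<sigma>) h) = h"
proof -
  note s = bisectionsD[OF \<sigma>]
  have "smooth_map A A (\<lambda>h. \<sigma> (\<beta> h))"
    by (rule smooth_map_on_compose[OF atlas_A atlas_M atlas_A smooth_tgt s(1)]) simp
  then have "smooth_map A A (\<lambda>h. \<sigma> (\<beta> h) \<cdot> h)"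
    by (rule smooth_mul_compose[OF atlas_A _ smooth_map_on_id[OF atlas_A]]) (simp add: s)
  then show "continuous_on UNIV (left_mul \<sigma>)"
    using smooth_map_on_continuous_on[OF atlas_A atlas_A] unfolding left_mul_def[abs_def] by blast
  show 1: "\<alpha> (left_mul \<sigma> h) = \<alpha> h" "\<beta> (left_mul \<sigma> h) = \<beta> (\<sigma> (\<beta> h))" for h by (simp_all add: left_mul_def s)
  have bi: "bis_inv \<sigma> (\<beta> (\<sigma> y)) = iv (\<sigma> y)" for y by (simp add: bis_inv_def s)
  show "left_mul (bis_inv \<sigma>) (left_mul \<sigma> h) = h"
    unfolding left_mul_def[of "bis_inv \<sigma>"] 1 bi by (simp add: left_mul_def s)
  define y where "y = inv_into UNIV (\<beta> \<circ> \<sigma>) (\<beta> h)"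
  have y: "\<beta> (\<sigma> y) = \<beta> h" unfolding y_def by (rule s(7))
  have "bis_inv \<sigma> (\<beta> h) = iv (\<sigma> y)" using bi[of y] y by simp
  then show "left_mul \<sigma> (left_mul (bis_inv \<sigma>) h) = h"
    using y mul_assoc[of "\<sigma> y" "iv (\<sigma> y)" h] by (simp add: left_mul_def s)
qed

text \<open>
  Left multiplication by a bisection is a homeomorphism that preserves sources and acts on targets by a
  bijection.
\<close>

lemma punctured_left_mul:
  assumes \<sigma>: "\<sigma> \<in> bisections \<Gamma>" and g: "punctured x g"
  shows "punctured x (left_mul \<sigma> g)"
  unfolding punctured_def
proof (intro allI impI, elim conjE)
  let ?l = "left_mul \<sigma>" and ?l' = "left_mul (bis_inv \<sigma>)"
  note l = left_mul[OF \<sigma>] and c' = left_mul(1)[OF bis_inv_bisection[OF \<sigma>]]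
  fix X assume X: "open X" "?l g \<in> X"
  have "open {h\<in>UNIV. ?l h \<in> X}" by (rule chart_preimage_open[OF open_UNIV l(1) X(1)])
  moreover have "g \<in> {h\<in>UNIV. ?l h \<in> X}" using X(2) by simp
  ultimately obtain Y where Y: "open Y" "g \<in> Y" "Y \<subseteq> {h\<in>UNIV. ?l h \<in> X}" "connected {h\<in>Y. \<alpha> h = x}"
     "connected {h\<in>Y. \<alpha> h = x \<and> \<beta> h \<noteq> \<beta> g}" "{h\<in>Y. \<alpha> h = x \<and> \<beta> h \<noteq> \<beta> g} \<noteq> {}"
    by (rule puncturedE[OF g])
  have img: "?l ` {h\<in>Y. P h} = {h \<in> {h\<in>UNIV. ?l' h \<in> Y}. P (?l' h)}" for P
    using l(4,5) by (auto simp: image_iff) metis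
  have \<alpha>': "\<alpha> (?l' h) = \<alpha> h" for h using l(2)[of "?l' h"] l(5) by simp
  have \<beta>': "\<beta> (?l' h) = \<beta> g \<longleftrightarrow> \<beta> h = \<beta> (?l g)" for h
    using l(3)[of "?l' h"] l(3)[of g] l(5)[of h] bisectionsD(6)[OF \<sigma>] by metis
  have con: "connected (?l ` T)" if "connected T" for T
    by (rule connected_continuous_image[OF continuous_on_subset[OF l(1)] that]) simp
  show "\<exists>Y. open Y \<and> ?l g \<in> Y \<and> Y \<subseteq> X \<and> connected {h\<in>Y. \<alpha> h = x} \<and>
     connected {h\<in>Y. \<alpha> h = x \<and> \<beta> h \<noteq> \<beta> (?l g)} \<and> {h\<in>Y. \<alpha> h = x \<and> \<beta> h \<noteq> \<beta> (?l g)} \<noteq> {}"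
  proof (intro exI[of _ "{h\<in>UNIV. ?l' h \<in> Y}"] conjI)
    show "open {h\<in>UNIV. ?l' h \<in> Y}" by (rule chart_preimage_open[OF open_UNIV c' Y(1)])
    show "?l g \<in> {h\<in>UNIV. ?l' h \<in> Y}" using Y(2) l(4) by simp
    show "{h\<in>UNIV. ?l' h \<in> Y} \<subseteq> X"
    proof clarify
      fix h assume "?l' h \<in> Y"
      then have "?l (?l' h) \<in> X" using Y(3) by blast
      then show "h \<in> X" by (simp only: l(5))
    qed
    show "connected {h \<in> {h\<in>UNIV. ?l' h \<in> Y}. \<alpha> h = x}"
      using con[OF Y(4)] unfolding img \<alpha>' .
    show "connected {h \<in> {h\<in>UNIV. ?l' h \<in> Y}. \<alpha> h = x \<and> \<beta> h \<noteq> \<beta> (?l g)}"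
      using con[OF Y(5)] unfolding img \<alpha>' \<beta>' .
    show "{h \<in> {h\<in>UNIV. ?l' h \<in> Y}. \<alpha> h = x \<and> \<beta> h \<noteq> \<beta> (?l g)} \<noteq> {}"
    proof -
      have "?l ` {h\<in>Y. \<alpha> h = x \<and> \<beta> h \<noteq> \<beta> g} \<noteq> {}" using Y(6) by simp
      then show ?thesis unfolding img \<alpha>' \<beta>' .
    qed
  qed
qed

lemma fibre_o_transitive:
  assumes "g \<in> fibre_o x" "g' \<in> fibre_o x"
  obtains \<sigma> where "\<sigma> \<in> bisections \<Gamma>" "left_mul \<sigma> g = g'"
  using reach_connected[OF open_UNIV connected_fibre_o fibre_oD UNIV_I assms]
  by (auto simp: reach_def supported_bis_def left_mul_def)

text \<open>
  If all arrows are punctured, those with targets outside \<open>F\<close> are dense in the connected set \<open>\<Gamma>\<^sup>o\<^sub>x\<close>. Close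
  to any given arrow they are all equivalent under reachability over \<open>X - F\<close>: close to an arrow with target
  in \<open>F\<close> because they form a connected set there. A relation of this kind is total.
\<close>

lemma reach_avoiding:
  assumes X: "open X" "\<beta> ` fibre_o x \<subseteq> X" and F: "finite F" and g: "g \<in> fibre_o x" "\<beta> g \<notin> F"
    and g': "g' \<in> fibre_o x" "\<beta> g' \<notin> F"
    and dich: "(\<forall>h\<in>fibre_o x. punctured x h) \<or> F \<inter> \<beta> ` fibre_o x = {}"
  shows "reach (X - F) g g'"
proof -
  have oXF: "open (X - F)" using X(1) F by (simp add: finite_imp_closed open_Diff)
  show ?thesis
  proof (cases "F \<inter> \<beta> ` fibre_o x = {}")
    case True
    show ?thesis
      by (rule reach_connected[OF oXF connected_fibre_o fibre_oD _ g(1) g'(1)]) (use True X(2) in auto)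
  next
    case False
    then have P: "\<And>h. h \<in> fibre_o x \<Longrightarrow> punctured x h" using dich by blast
    have nbhd: "\<exists>Y. open Y \<and> a \<in> Y \<and> Y \<subseteq> W \<and> {h\<in>Y. \<alpha> h = x} \<subseteq> fibre_o x \<and> connected {h\<in>Y. \<alpha> h = x \<and> \<beta> h \<noteq> \<beta> a} \<and>
        {h\<in>Y. \<alpha> h = x \<and> \<beta> h \<noteq> \<beta> a} \<noteq> {} \<and> (\<forall>h\<in>Y. \<beta> h \<in> F \<longrightarrow> \<beta> h = \<beta> a)"
      if a: "a \<in> fibre_o x" and W: "open W" "a \<in> W" for a W
    proof -
      have "open (- (F - {\<beta> a}))" by (rule open_Compl[OF finite_imp_closed[OF finite_Diff[OF F]]])
      from open_tgt_vimage[OF this] have "open (W \<inter> {h. \<beta> h \<in> - (F - {\<beta> a})})" using W by blast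
      moreover have "a \<in> W \<inter> {h. \<beta> h \<in> - (F - {\<beta> a})}" using W by simp
      ultimately obtain Y where Y: "open Y" "a \<in> Y" "Y \<subseteq> W \<inter> {h. \<beta> h \<in> - (F - {\<beta> a})}" "connected {h\<in>Y. \<alpha> h = x}"
         "connected {h\<in>Y. \<alpha> h = x \<and> \<beta> h \<noteq> \<beta> a}" "{h\<in>Y. \<alpha> h = x \<and> \<beta> h \<noteq> \<beta> a} \<noteq> {}"
        by (rule puncturedE[OF P[OF a]])
      have "{h\<in>Y. \<alpha> h = x} \<subseteq> fibre_o x"
        by (rule fibre_o_maximal[OF Y(4) _ _ a]) (use Y(2) fibre_oD[OF a] in auto)
      then show ?thesis using Y by (intro exI[of _ Y]) auto
    qed
    show ?thesis
    proof (rule connected_equivalence_relation_gen[OF connected_fibre_o g(1) g'(1),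
          of "\<lambda>h. \<beta> h \<notin> F" "reach (X - F)", OF g(2) g'(2)])
      show "reach (X - F) a c" if "reach (X - F) a b" "reach (X - F) b c" for a b c
        using that by (rule reach_trans)
      show "\<exists>z. z \<in> T \<and> \<beta> z \<notin> F" if T: "openin (top_of_set (fibre_o x)) T" and a: "a \<in> T" for T a
      proof -
        obtain W where W: "open W" "T = fibre_o x \<inter> W" using T by (auto simp: openin_open)
        have "a \<in> fibre_o x" "a \<in> W" using a W by auto
        from nbhd[OF this(1) W(1) this(2)] obtain Y h where Y: "Y \<subseteq> W" "{h\<in>Y. \<alpha> h = x} \<subseteq> fibre_o x"
          "\<forall>h\<in>Y. \<beta> h \<in> F \<longrightarrow> \<beta> h = \<beta> a" and h: "h \<in> Y" "\<alpha> h = x" "\<beta> h \<noteq> \<beta> a" by blast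
        then show ?thesis using W(2) by blast
      qed
      fix a assume a: "a \<in> fibre_o x"
      show "\<exists>T. openin (top_of_set (fibre_o x)) T \<and> a \<in> T \<and>
          (\<forall>y\<in>T. \<forall>z\<in>T. \<beta> y \<notin> F \<and> \<beta> z \<notin> F \<longrightarrow> reach (X - F) y z)"
      proof (cases "\<beta> a \<in> F")
        case True
        from nbhd[OF a open_UNIV UNIV_I] obtain Y where Y: "open Y" "a \<in> Y" "{h\<in>Y. \<alpha> h = x} \<subseteq> fibre_o x"
          "connected {h\<in>Y. \<alpha> h = x \<and> \<beta> h \<noteq> \<beta> a}" "\<forall>h\<in>Y. \<beta> h \<in> F \<longrightarrow> \<beta> h = \<beta> a" by blast
        have "reach (X - F) y z" if "y \<in> fibre_o x \<inter> Y" "z \<in> fibre_o x \<inter> Y" "\<beta> y \<notin> F" "\<beta> z \<notin> F" for y z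
        proof (rule reach_connected[OF oXF Y(4)])
          show "\<beta> h \<in> X - F" if "h \<in> {h\<in>Y. \<alpha> h = x \<and> \<beta> h \<noteq> \<beta> a}" for h
            using that Y(3,5) X(2) by blast
        qed (use that True fibre_oD in auto)
        then show ?thesis using Y(1,2) a by (intro exI[of _ "fibre_o x \<inter> Y"]) (auto simp: openin_open)
      next
        case False
        then have "\<beta> a \<in> X - F" using X(2) a by blast
        then obtain N where N: "open N" "a \<in> N" "\<And>g'. g' \<in> N \<Longrightarrow> \<alpha> g' = \<alpha> a \<Longrightarrow> reach (X - F) a g'"
          using reach_local[OF oXF] by metis
        have "reach (X - F) y z" if "y \<in> fibre_o x \<inter> N" "z \<in> fibre_o x \<inter> N" for y z
          using reach_trans[OF reach_sym] N(3) that fibre_oD a by (metis IntE)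
        then show ?thesis using N(1,2) a by (intro exI[of _ "fibre_o x \<inter> N"]) (auto simp: openin_open)
      qed
    qed
  qed
qed

lemma smooth_map_on_flatI:
  fixes f :: "'g \<Rightarrow> 'k::real_normed_vector"
  assumes "finite_dimensional TYPE('k)" "(U, \<phi>) \<in> smooth_charts A" "smooth_on (\<phi> ` U) (\<lambda>z. f (inv_into U \<phi> z))"
  shows "smooth_map_on A flat_atlas U f"
proof -
  note Uc = is_chartD[OF smooth_chartsD(1)[OF assms(2)]]
  have "smooth_map_on A flat_atlas U (\<lambda>h. f (inv_into U \<phi> (\<phi> h)))"
    by (rule smooth_map_on_compose[OF atlas_A flat_h smooth_atlas_flat[OF assms(1)] smooth_map_on_chart[OF atlas_A assms(2)]
        smooth_map_on_flat_iff[THEN iffD2, OF Uc(2) assms(3)]]) simp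
  then show ?thesis by (rule smooth_map_on_cong) (simp add: Uc(6))
qed

lemma smooth_tgt_in_chart:
  assumes U: "(U, \<phi>) \<in> smooth_charts A" and V: "(V, \<psi>) \<in> smooth_charts M" "\<beta> ` U \<subseteq> V"
  shows "smooth_on (\<phi> ` U) (\<lambda>z. \<psi> (\<beta> (inv_into U \<phi> z)))"
proof -
  note Uc = is_chartD[OF smooth_chartsD(1)[OF U]]
  have "smooth_map_on flat_atlas flat_atlas (\<phi> ` U) (\<lambda>z. \<psi> (\<beta> (inv_into U \<phi> z)))"
    by (rule smooth_map_on_compose[OF flat_h atlas_A flat_e smooth_map_on_inv_chart[OF atlas_A U] smooth_tgt_coordinate[OF V(1)]])
      (use V(2) Uc(6) in auto)
  then show ?thesis using smooth_map_on_flat_iff[OF Uc(2)] by blast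
qed

text \<open>
  The source map paired with the coordinates \<open>\<pi>\<close> of the target map is a submersion at \<open>g\<close>, so it can be
  straightened.
\<close>

lemma tangential_chart:
  fixes \<psi>1 :: "'m \<Rightarrow> 'e" and \<pi> :: "'e \<Rightarrow> 'k::real_normed_vector"
  assumes fd: "finite_dimensional TYPE('k)"
    and U: "(U, \<phi>) \<in> smooth_charts A" "g \<in> U" and V2: "(V2, \<psi>2) \<in> smooth_charts M" "\<beta> ` U \<subseteq> V2"
    and L: "bounded_linear L" "\<And>h. h \<in> U \<Longrightarrow> \<psi>1 (\<alpha> h) = L (\<phi> h)"
    and \<pi>: "bounded_linear \<pi>" and X: "open X" "g \<in> X"
    and sj: "\<And>y. \<exists>w. (L w, \<pi> (D (\<lambda>z. \<psi>2 (\<beta> (inv_into U \<phi> z))) (\<phi> g) w)) = y"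
  obtains U' \<phi>' \<rho> L' where "(U', \<phi>') \<in> smooth_charts A" "g \<in> U'" "U' \<subseteq> X \<inter> U" "\<rho> > 0"
    "\<phi>' ` U' = ball (\<phi>' g) \<rho>" "bounded_linear L'" "surj L'"
    "\<And>h. h \<in> U' \<Longrightarrow> (\<psi>1 (\<alpha> h), \<pi> (\<psi>2 (\<beta> h))) = L' (\<phi>' h)"
proof -
  note Uc = is_chartD[OF smooth_chartsD(1)[OF U(1)]]
  define b where "b = (\<lambda>z. \<psi>2 (\<beta> (inv_into U \<phi> z)))"
  define f where "f h = (\<psi>1 (\<alpha> h), \<pi> (\<psi>2 (\<beta> h)))" for h
  have smb: "smooth_on (\<phi> ` U) b" unfolding b_def by (rule smooth_tgt_in_chart[OF U(1) V2])
  have fdp: "finite_dimensional TYPE('e \<times> 'k)" by (rule finite_dimensional_prod[OF fd_e fd])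
  have a: "f (inv_into U \<phi> z) = (L z, \<pi> (b z))" if "z \<in> \<phi> ` U" for z
    using that Uc(6) L(2) by (auto simp: f_def b_def)
  have sma: "smooth_on (\<phi> ` U) (\<lambda>z. (L z, \<pi> (b z)))"
    by (intro smooth_on_Pair smooth_on_bounded_linear_compose[OF \<pi>] smb smooth_on_bounded_linear[OF Uc(2) L(1)])
  have "smooth_on (\<phi> ` U) (\<lambda>z. f (inv_into U \<phi> z))" by (rule smooth_on_cong[OF sma]) (simp add: a)
  then have smf: "smooth_map_on A flat_atlas U f" by (rule smooth_map_on_flatI[OF fdp U(1)])
  have gU: "\<phi> g \<in> \<phi> ` U" using U(2) by simp
  have "((\<lambda>z. (L z, \<pi> (b z))) has_derivative (\<lambda>w. (L w, \<pi> (D b (\<phi> g) w)))) (at (\<phi> g))"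
    by (intro has_derivative_Pair bounded_linear_imp_has_derivative L(1)
        bounded_linear.has_derivative[OF \<pi>] smooth_on_has_derivative[OF smb gU])
  then have "((\<lambda>z. f (inv_into U \<phi> z)) has_derivative (\<lambda>w. (L w, \<pi> (D b (\<phi> g) w)))) (at (\<phi> g))"
    by (rule has_derivative_transform_within_open[OF _ Uc(2) gU]) (simp add: a)
  then have der: "D (\<lambda>z. f (inv_into U \<phi> z)) (\<phi> g) = (\<lambda>w. (L w, \<pi> (D b (\<phi> g) w)))"
    using frechet_derivative_at by metis
  have sj': "surj (D (\<lambda>z. f (inv_into U \<phi> z)) (\<phi> g))" unfolding der surj_def b_def by (metis sj)
  have gX: "g \<in> X \<inter> U" using X U by simp
  obtain U' \<phi>' \<rho> L' where "(U', \<phi>') \<in> smooth_charts A" "g \<in> U'" "U' \<subseteq> (X \<inter> U) \<inter> U" "\<rho> > 0"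
    "\<phi>' ` U' = ball (\<phi>' g) \<rho>" "bounded_linear L'" "surj L'" "\<And>h. h \<in> U' \<Longrightarrow> f h = L' (\<phi>' h)"
    by (rule submersion_chart[OF atlas_A fdp smooth_map_on_subset[OF smf Int_lower2] open_Int[OF X(1) Uc(1)] gX U sj']) metis
  then show ?thesis by (intro that) (auto simp: f_def)
qed

text \<open>
  In a chart making the source and two independent real coordinates of the target linear, the fibre is
  convex, and removing a level of the two coordinates from it leaves a connected set \<open>C\<^sub>0\<close>. The set \<open>C\<close>
  obtained by removing only the arrows with target \<open>\<beta> g\<close> lies between \<open>C\<^sub>0\<close> and its closure, so it is
  connected as well.
\<close>

lemma rank_two_imp_punctured:
  assumes U: "(U, \<phi>) \<in> smooth_charts A" "g \<in> U" and V1: "(V1, \<psi>1) \<in> smooth_charts M" "\<alpha> ` U \<subseteq> V1"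
    and V2: "(V2, \<psi>2) \<in> smooth_charts M" "\<beta> ` U \<subseteq> V2"
    and L: "bounded_linear L" "surj L" "\<And>h. h \<in> U \<Longrightarrow> \<psi>1 (\<alpha> h) = L (\<phi> h)"
    and uv: "L u = 0" "L v = 0"
    and ind: "\<And>c d::real. c *\<^sub>R D (\<lambda>z. \<psi>2 (\<beta> (inv_into U \<phi> z))) (\<phi> g) u + d *\<^sub>R D (\<lambda>z. \<psi>2 (\<beta> (inv_into U \<phi> z))) (\<phi> g) v = 0
        \<Longrightarrow> c = 0 \<and> d = 0"
  shows "punctured (\<alpha> g) g"
  unfolding punctured_def
proof (intro allI impI, elim conjE)
  fix X assume X: "open X" "g \<in> X"
  let ?x = "\<alpha> g"
  note Uc = is_chartD[OF smooth_chartsD(1)[OF U(1)]]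
  define b where "b = (\<lambda>z. \<psi>2 (\<beta> (inv_into U \<phi> z)))"
  define B where "B = D b (\<phi> g)"
  have smb: "smooth_on (\<phi> ` U) b" unfolding b_def by (rule smooth_tgt_in_chart[OF U(1) V2])
  have gU: "\<phi> g \<in> \<phi> ` U" using U(2) by simp
  have "\<And>c d::real. c *\<^sub>R B u + d *\<^sub>R B v = 0 \<Longrightarrow> c = 0 \<and> d = 0" using ind by (simp add: B_def b_def)
  then obtain \<pi> :: "'e \<Rightarrow> complex" where \<pi>: "bounded_linear \<pi>" "\<pi> (B u) = 1" "\<pi> (B v) = \<i>"
    using exists_complex_coordinate[OF fd_e] by metis
  have linL: "linear L" using L(1) by (rule bounded_linear.linear)
  have lin2: "linear (\<lambda>w. \<pi> (B w))"
    using linear_compose[OF has_derivative_linear[OF smooth_on_has_derivative[OF smb gU]] bounded_linear.linear[OF \<pi>(1)]]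
    by (simp add: B_def o_def)
  have sj: "\<exists>w. (L w, \<pi> (B w)) = y" for y
  proof -
    obtain r where r: "L r = fst y" using L(2) by (metis surjD)
    define k where "k = snd y - \<pi> (B r)"
    have "L (r + (Re k *\<^sub>R u + Im k *\<^sub>R v)) = fst y"
      using r uv by (simp add: linear_add[OF linL] linear_cmul[OF linL])
    moreover have "\<pi> (B (r + (Re k *\<^sub>R u + Im k *\<^sub>R v))) = \<pi> (B r) + (Re k *\<^sub>R 1 + Im k *\<^sub>R \<i>)"
      using linear_add[OF lin2] linear_cmul[OF lin2] \<pi>(2,3) by simp
    moreover have "Re k *\<^sub>R 1 + Im k *\<^sub>R \<i> = k" by (simp add: complex_eq_iff)
    ultimately show ?thesis by (intro exI[of _ "r + (Re k *\<^sub>R u + Im k *\<^sub>R v)"]) (simp add: k_def prod_eq_iff)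
  qed
  obtain U' \<phi>' \<rho> L' where U': "(U', \<phi>') \<in> smooth_charts A" "g \<in> U'" "U' \<subseteq> X \<inter> U" "\<rho> > 0"
    "\<phi>' ` U' = ball (\<phi>' g) \<rho>" "bounded_linear L'" "surj L'"
    "\<And>h. h \<in> U' \<Longrightarrow> (\<psi>1 (\<alpha> h), \<pi> (\<psi>2 (\<beta> h))) = L' (\<phi>' h)"
    by (rule tangential_chart[OF finite_dimensional_euclidean U V2 L(1,3) \<pi>(1) X sj[unfolded B_def b_def]]) (assumption | rule that)+
  note Uc' = is_chartD[OF smooth_chartsD(1)[OF U'(1)]]
  have linL': "linear L'" using U'(6) by (rule bounded_linear.linear)
  let ?e = "\<psi>1 ?x" and ?c = "snd (L' (\<phi>' g))"
  have xV: "?x \<in> V1" using V1(2) U(2) by auto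
  have aV: "\<alpha> ` U' \<subseteq> V1" using V1(2) U'(3) by auto
  have s: "\<psi>1 (\<alpha> h) = fst (L' (\<phi>' h))" if "h \<in> U'" for h using arg_cong[OF U'(8)[OF that], of fst] by simp
  note fib = fibre_in_chart[OF U'(1) V1(1) aV xV s]
  define C where "C = {z \<in> ball (\<phi>' g) \<rho>. fst (L' z) = ?e \<and> \<beta> (inv_into U' \<phi>' z) \<noteq> \<beta> g}"
  define C0 where "C0 = {z \<in> ball (\<phi>' g) \<rho>. fst (L' z) = ?e \<and> snd (L' z) \<noteq> ?c}"
  have sndL: "snd (L' z) = \<pi> (\<psi>2 (\<beta> (inv_into U' \<phi>' z)))" if "z \<in> ball (\<phi>' g) \<rho>" for z
  proof -
    have "z \<in> \<phi>' ` U'" using that U'(5) by simp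
    then obtain h where h: "h \<in> U'" "z = \<phi>' h" by blast
    then show ?thesis using arg_cong[OF U'(8)[OF h(1)], of snd] Uc'(6)[OF h(1)] by simp
  qed
  have g_in: "\<phi>' g \<in> ball (\<phi>' g) \<rho>" using U'(4) by simp
  have "C0 \<subseteq> C" using sndL sndL[OF g_in] Uc'(6)[OF U'(2)] by (auto simp: C_def C0_def)
  obtain w where w: "L' w = (0, 1)" using U'(7) by (metis surjD)
  have approx: "\<exists>y\<in>C0. dist y z < e" if z: "z \<in> ball (\<phi>' g) \<rho>" "fst (L' z) = ?e" and e: "e > 0" for z e
  proof (cases "snd (L' z) = ?c")
    case False
    then show ?thesis using z e by (intro bexI[of _ z]) (auto simp: C0_def)
  next
    case True
    obtain d where d: "d > 0" "ball z d \<subseteq> ball (\<phi>' g) \<rho>"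
      using z(1) open_contains_ball_eq[OF open_ball, of z "\<phi>' g" \<rho>] by blast
    define n where "n = norm w + 1"
    have n: "n > 0" "norm w \<le> n" by (simp_all add: n_def add_nonneg_pos)
    define r where "r = min d e / 2 / n"
    have r: "r > 0" using d(1) e n by (simp add: r_def)
    have "r * norm w \<le> r * n" using r n by simp
    also have "\<dots> = min d e / 2" using n by (simp add: r_def)
    finally have nr: "norm (r *\<^sub>R w) < min d e" using d(1) e r by simp
    have "z + r *\<^sub>R w \<in> ball (\<phi>' g) \<rho>" using nr by (intro subsetD[OF d(2)]) (simp add: dist_norm)
    moreover have "L' (z + r *\<^sub>R w) = L' z + (0, of_real r)"
      by (simp add: linear_add[OF linL'] linear_cmul[OF linL'] w scaleR_conv_of_real)
    ultimately have "z + r *\<^sub>R w \<in> C0" using z True r by (simp add: C0_def)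
    then show ?thesis using nr by (intro bexI[of _ "z + r *\<^sub>R w"]) (simp_all add: dist_norm)
  qed
  have "C \<subseteq> closure C0" using approx by (auto simp: C_def closure_approachable)
  moreover have "connected C0" unfolding C0_def by (rule connected_avoid_codim2[OF U'(6,7)])
  ultimately have conC: "connected C" using \<open>C0 \<subseteq> C\<close> connected_intermediate_closure by blast
  have "C0 \<noteq> {}" using approx[OF g_in _ zero_less_one] s[OF U'(2)] by auto
  then have neC: "C \<noteq> {}" using \<open>C0 \<subseteq> C\<close> by blast
  have lin1: "linear (\<lambda>z. fst (L' z))" using linear_compose[OF linL' linear_fst] by (simp add: o_def)
  show "\<exists>Y. open Y \<and> g \<in> Y \<and> Y \<subseteq> X \<and> connected {h\<in>Y. \<alpha> h = ?x} \<and>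
     connected {h\<in>Y. \<alpha> h = ?x \<and> \<beta> h \<noteq> \<beta> g} \<and> {h\<in>Y. \<alpha> h = ?x \<and> \<beta> h \<noteq> \<beta> g} \<noteq> {}"
  proof (intro exI[of _ U'] conjI)
    show "connected {h\<in>U'. \<alpha> h = ?x}" by (rule connected_fibre_in_chart[OF U'(1) V1(1) aV xV s lin1 U'(5)])
    have eq: "{h\<in>U'. \<alpha> h = ?x \<and> \<beta> h \<noteq> \<beta> g} = inv_into U' \<phi>' ` C"
      using fib[of "\<lambda>h. \<beta> h \<noteq> \<beta> g"] by (simp add: U'(5) C_def)
    show "connected {h\<in>U'. \<alpha> h = ?x \<and> \<beta> h \<noteq> \<beta> g}"
      unfolding eq by (rule connected_in_chart[OF U'(1) conC]) (auto simp: U'(5) C_def)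
    show "{h\<in>U'. \<alpha> h = ?x \<and> \<beta> h \<noteq> \<beta> g} \<noteq> {}" unfolding eq using neC by simp
  qed (use U' Uc'(1) in auto)
qed

end

section \<open>Sigma-compactness of identity components\<close>

definition sigma_compact :: "'a::topological_space set \<Rightarrow> bool" where
  "sigma_compact S \<longleftrightarrow> (\<exists>\<K>. countable \<K> \<and> (\<forall>K\<in>\<K>. compact K) \<and> S = \<Union>\<K>)"

lemma sigma_compact_compact: "compact S \<Longrightarrow> sigma_compact S"
  unfolding sigma_compact_def by (rule exI[of _ "{S}"]) simp

lemma sigma_compact_UN:
  assumes "countable I" "\<And>i. i \<in> I \<Longrightarrow> sigma_compact (S i)"
  shows "sigma_compact (\<Union>i\<in>I. S i)"
proof -
  have "\<forall>i\<in>I. \<exists>\<K>. countable \<K> \<and> (\<forall>K\<in>\<K>. compact K) \<and> S i = \<Union>\<K>"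
    using assms(2) by (simp add: sigma_compact_def)
  from bchoice[OF this] obtain \<K> where \<K>: "\<forall>i\<in>I. countable (\<K> i) \<and> (\<forall>K\<in>\<K> i. compact K) \<and> S i = \<Union>(\<K> i)" ..
  show ?thesis unfolding sigma_compact_def
  proof (intro exI conjI)
    show "countable (\<Union>i\<in>I. \<K> i)" using \<K> assms(1) by blast
    show "\<forall>K\<in>(\<Union>i\<in>I. \<K> i). compact K" using \<K> by blast
    show "(\<Union>i\<in>I. S i) = \<Union>(\<Union>i\<in>I. \<K> i)" using \<K> by (simp add: Union_eq) blast
  qed
qed

lemma sigma_compact_countable_subcover:
  assumes "sigma_compact S" "\<And>s. s \<in> S \<Longrightarrow> open (W s) \<and> s \<in> W s"
  obtains C where "countable C" "C \<subseteq> S" "S \<subseteq> (\<Union>s\<in>C. W s)"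
proof -
  obtain \<K> where \<K>: "countable \<K>" "\<And>K. K \<in> \<K> \<Longrightarrow> compact K" "S = \<Union>\<K>"
    using assms(1) by (auto simp: sigma_compact_def)
  have "\<exists>F. finite F \<and> F \<subseteq> S \<and> K \<subseteq> (\<Union>s\<in>F. W s)" if K: "K \<in> \<K>" for K
  proof -
    have KS: "K \<subseteq> S" using K \<K>(3) by blast
    obtain F where "F \<subseteq> K" "finite F" "K \<subseteq> (\<Union>s\<in>F. W s)"
    proof (rule compactE_image[OF \<K>(2)[OF K], of K W])
      show "open (W s)" if "s \<in> K" for s using assms(2) KS that by blast
      show "K \<subseteq> (\<Union>s\<in>K. W s)" using assms(2) KS by blast
    qed
    then show ?thesis using KS by blast
  qed
  then obtain F where F: "\<And>K. K \<in> \<K> \<Longrightarrow> finite (F K) \<and> F K \<subseteq> S \<and> K \<subseteq> (\<Union>s\<in>F K. W s)" by metis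
  show ?thesis
  proof (rule that[of "\<Union>K\<in>\<K>. F K"])
    show "countable (\<Union>K\<in>\<K>. F K)" using \<K>(1) F countable_finite by blast
    show "(\<Union>K\<in>\<K>. F K) \<subseteq> S" using F by blast
    show "S \<subseteq> (\<Union>s\<in>(\<Union>K\<in>\<K>. F K). W s)" using F \<K>(3) by blast
  qed
qed

text \<open>
  Level sets of a linear map in a ball are convex, and the derivative of \<open>b\<close> vanishes along them.
\<close>

lemma constant_along_kernel:
  fixes b :: "'h::real_normed_vector \<Rightarrow> 'e::real_normed_vector" and L :: "'h \<Rightarrow> 'k::real_normed_vector"
  assumes b: "smooth_on (ball z0 \<rho>) b" and L: "linear L"
    and d: "\<And>z w. z \<in> ball z0 \<rho> \<Longrightarrow> L z = e \<Longrightarrow> L w = 0 \<Longrightarrow> D b z w = 0"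
    and y: "y \<in> ball z0 \<rho>" "L y = e" and y': "y' \<in> ball z0 \<rho>" "L y' = e"
  shows "b y = b y'"
proof -
  define c where "c s = y + s *\<^sub>R (y' - y)" for s :: real
  have c: "c s \<in> ball z0 \<rho>" "L (c s) = e" if "s \<in> {0..1}" for s
  proof -
    have cs: "c s = (1 - s) *\<^sub>R y + s *\<^sub>R y'" by (simp add: c_def algebra_simps)
    show "c s \<in> ball z0 \<rho>" unfolding cs using convexD_alt[OF convex_ball y(1) y'(1)] that by simp
    show "L (c s) = e" using y(2) y'(2) by (simp add: c_def linear_add[OF L] linear_diff[OF L] linear_cmul[OF L])
  qed
  have "((\<lambda>s. b (c s)) has_derivative (\<lambda>_. 0)) (at s within {0..1})" if s: "s \<in> {0..1}" for s
  proof -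
    have "(c has_derivative (\<lambda>r. r *\<^sub>R (y' - y))) (at s)" unfolding c_def by (auto intro!: derivative_eq_intros)
    from has_derivative_compose[OF this smooth_on_has_derivative[OF b c(1)[OF s]]]
    have "((\<lambda>s. b (c s)) has_derivative (\<lambda>r. D b (c s) (r *\<^sub>R (y' - y)))) (at s)" .
    moreover have "D b (c s) (r *\<^sub>R (y' - y)) = 0" for r
      by (rule d[OF c[OF s]]) (simp add: linear_cmul[OF L] linear_diff[OF L] y(2) y'(2))
    ultimately show ?thesis by (simp add: has_derivative_at_withinI)
  qed
  then obtain k where "\<And>s. s \<in> {0..1} \<Longrightarrow> b (c s) = k"
    using has_derivative_zero_constant[of "{0..1::real}" "\<lambda>s. b (c s)"] by auto
  from this[of 0] this[of 1] show ?thesis by (simp add: c_def)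
qed

context lie_gpd begin

text \<open>
  The neighbourhood is so small that each of its arrows lies in one chart together with the unit at its source;
  the part of the chart domain in a source fibre is connected.
\<close>

lemma compact_unit_neighbourhood:
  obtains \<kappa> N where "compact \<kappa>" "open N" "\<iota> p \<in> N" "N \<subseteq> \<kappa>" "\<And>h. h \<in> \<kappa> \<Longrightarrow> h \<in> fibre_o (\<alpha> h)"
proof -
  obtain V \<psi> U \<phi> \<rho> L where V: "(V, \<psi>) \<in> smooth_charts M" "p \<in> V" and
    U: "(U, \<phi>) \<in> smooth_charts A" "\<iota> p \<in> U" "\<beta> ` U \<subseteq> V" "\<rho> > 0" "\<phi> ` U = ball (\<phi> (\<iota> p)) \<rho>"
      "bounded_linear L" "surj L" "\<alpha> ` U \<subseteq> V" "\<And>h. h \<in> U \<Longrightarrow> \<psi> (\<alpha> h) = L (\<phi> h)"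
    by (rule unit_chart[of p]) (rule that)
  note Uc = is_chartD[OF smooth_chartsD(1)[OF U(1)]]
  have c: "continuous_on UNIV (\<lambda>h. \<iota> (\<alpha> h))"
    by (rule continuous_on_compose2[OF continuous_unit continuous_src]) simp
  define U1 where "U1 = U \<inter> {h\<in>UNIV. \<iota> (\<alpha> h) \<in> U}"
  have oU1: "open U1" unfolding U1_def by (intro open_Int Uc(1) chart_preimage_open[OF open_UNIV c])
  have "open (\<phi> ` U1)" by (rule chart_open_image[OF smooth_chartsD(1)[OF U(1)] oU1]) (simp add: U1_def)
  moreover have "\<phi> (\<iota> p) \<in> \<phi> ` U1" using U(2) by (simp add: U1_def)
  ultimately obtain r where r: "r > 0" "cball (\<phi> (\<iota> p)) r \<subseteq> \<phi> ` U1" using open_contains_cball by blast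
  have sub: "\<phi> ` U1 \<subseteq> \<phi> ` U" by (auto simp: U1_def)
  define \<kappa> where "\<kappa> = inv_into U \<phi> ` cball (\<phi> (\<iota> p)) r"
  define N where "N = {h\<in>U. \<phi> h \<in> ball (\<phi> (\<iota> p)) r}"
  show ?thesis
  proof (rule that[of \<kappa> N])
    show "compact \<kappa>" unfolding \<kappa>_def
      by (rule compact_continuous_image[OF continuous_on_subset[OF Uc(5)] finite_dimensional_cball_compact[OF fd_h]])
        (use r(2) sub in blast)
    show "open N" unfolding N_def by (rule chart_preimage_open[OF Uc(1,4)]) simp
    show "\<iota> p \<in> N" using U(2) r(1) by (simp add: N_def)
    show "N \<subseteq> \<kappa>"
    proof
      fix h assume "h \<in> N"
      then have "h \<in> U" "\<phi> h \<in> cball (\<phi> (\<iota> p)) r" by (auto simp: N_def)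
      then show "h \<in> \<kappa>" unfolding \<kappa>_def using Uc(6)[of h] by (metis image_eqI)
    qed
    fix h assume "h \<in> \<kappa>"
    then obtain h' where "h' \<in> U1" "h = inv_into U \<phi> (\<phi> h')" using r(2) by (auto simp: \<kappa>_def)
    then have h: "h \<in> U" "\<iota> (\<alpha> h) \<in> U" using Uc(6)[of h'] by (auto simp: U1_def)
    let ?T = "{k\<in>U. \<alpha> k = \<alpha> h}"
    have "\<alpha> h \<in> V" using U(8) h(1) by blast
    then have "connected ?T"
      by (rule connected_fibre_in_chart[OF U(1) V(1) U(8) _ U(9) bounded_linear.linear[OF U(6)] U(5)])
    then have "?T \<subseteq> fibre_o (\<alpha> h)" by (rule fibre_o_maximal[of _ _ "\<iota> (\<alpha> h)"]) (use h in auto)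
    then show "h \<in> fibre_o (\<alpha> h)" using h(1) by blast
  qed
qed

text \<open>
  Countably many compact neighbourhoods of units cover all units. The arrows over \<open>x\<close> that are products of
  arrows from these neighbourhoods form a countable union of compact sets, because the composable pairs
  are closed over the Hausdorff base; this set is open and closed in the identity component.
\<close>

lemma sigma_compact_fibre_o: "sigma_compact (fibre_o x)"
proof -
  have "\<exists>\<kappa> N. compact \<kappa> \<and> open N \<and> \<iota> p \<in> N \<and> N \<subseteq> \<kappa> \<and> (\<forall>h\<in>\<kappa>. h \<in> fibre_o (\<alpha> h))" for p
    by (rule compact_unit_neighbourhood[of p]) blast
  then obtain \<kappa> N where \<kappa>: "\<And>p. compact (\<kappa> p)" "\<And>p. open (N p)" "\<And>p. \<iota> p \<in> N p" "\<And>p. N p \<subseteq> \<kappa> p"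
    "\<And>p h. h \<in> \<kappa> p \<Longrightarrow> h \<in> fibre_o (\<alpha> h)" by metis
  define Q where "Q p = {q\<in>UNIV. \<iota> q \<in> N p}" for p
  have oQ: "open (Q p)" for p unfolding Q_def by (rule chart_preimage_open[OF open_UNIV continuous_unit \<kappa>(2)])
  obtain \<Q> where \<Q>: "\<Q> \<subseteq> range Q" "countable \<Q>" "\<Union>\<Q> = \<Union>(range Q)" using Lindelof[of "range Q"] oQ by blast
  obtain P where P: "countable P" "\<Q> = Q ` P" using countable_subset_image[THEN iffD1, OF conjI[OF \<Q>(2,1)]] by blast
  define \<Omega> where "\<Omega> = (\<Union>p\<in>P. \<kappa> p)"
  define \<Omega>' where "\<Omega>' = (\<Union>p\<in>P. N p)"
  have \<Omega>': "open \<Omega>'" "\<Omega>' \<subseteq> \<Omega>" unfolding \<Omega>_def \<Omega>'_def using \<kappa>(2,4) by blast+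
  have unit\<Omega>: "\<iota> q \<in> \<Omega>'" for q
  proof -
    have "q \<in> \<Union>(range Q)" using \<kappa>(3)[of q] by (auto simp: Q_def)
    then have "q \<in> \<Union>(Q ` P)" using \<Q>(3) P(2) by simp
    then show ?thesis by (auto simp: Q_def \<Omega>'_def)
  qed
  \<comment> \<open>The arrows over x that are products of r arrows from the chosen neighbourhoods.\<close>
  define S where "S = rec_nat {\<iota> x} (\<lambda>_ T. {h \<cdot> g | h g. h \<in> \<Omega> \<and> g \<in> T \<and> \<alpha> h = \<beta> g})"
  have S: "S 0 = {\<iota> x}" "\<And>r. S (Suc r) = {h \<cdot> g | h g. h \<in> \<Omega> \<and> g \<in> S r \<and> \<alpha> h = \<beta> g}"
    by (simp_all add: S_def)
  have sub: "S r \<subseteq> fibre_o x" for r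
  proof (induction r)
    case (Suc r)
    have "h \<cdot> g \<in> fibre_o x" if "h \<in> \<Omega>" "g \<in> S r" "\<alpha> h = \<beta> g" for h g
    proof -
      obtain p where "h \<in> \<kappa> p" using \<open>h \<in> \<Omega>\<close> by (auto simp: \<Omega>_def)
      then have "h \<in> fibre_o (\<alpha> h)" by (rule \<kappa>(5))
      then show ?thesis using fibre_o_mul[of g x h] that(2,3) Suc by auto
    qed
    then show ?case unfolding S by blast
  qed (simp add: S)
  have "closed {(h, g). \<alpha> h = \<beta> g}"
  proof -
    have "closed {q. \<alpha> (fst q) = \<beta> (snd q)}"
      by (rule closed_Collect_eq; rule continuous_on_compose2[OF continuous_src] continuous_on_compose2[OF continuous_tgt])
        (auto intro: continuous_intros)
    then show ?thesis by (simp add: case_prod_beta')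
  qed
  note closed = this
  have sc: "sigma_compact (S r)" for r
  proof (induction r)
    case 0
    show ?case unfolding S by (rule sigma_compact_compact) simp
  next
    case (Suc r)
    obtain \<K> where \<K>: "countable \<K>" "\<And>K. K \<in> \<K> \<Longrightarrow> compact K" "S r = \<Union>\<K>"
      using Suc by (auto simp: sigma_compact_def)
    have eq: "S (Suc r) = (\<Union>(p, K)\<in>P \<times> \<K>. (\<lambda>(h, g). h \<cdot> g) ` (\<kappa> p \<times> K \<inter> {(h, g). \<alpha> h = \<beta> g}))"
      unfolding S \<Omega>_def \<K>(3) by (auto simp: image_iff)
    have "sigma_compact (case q of (p, K) \<Rightarrow> (\<lambda>(h, g). h \<cdot> g) ` (\<kappa> p \<times> K \<inter> {(h, g). \<alpha> h = \<beta> g}))"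
      if qP: "q \<in> P \<times> \<K>" for q
    proof -
      obtain p K where q: "q = (p, K)" "K \<in> \<K>" using qP by auto
      have "compact (\<kappa> p \<times> K \<inter> {(h, g). \<alpha> h = \<beta> g})"
        by (intro compact_Int_closed compact_Times \<kappa>(1) \<K>(2) q closed)
      then have "compact ((\<lambda>(h, g). h \<cdot> g) ` (\<kappa> p \<times> K \<inter> {(h, g). \<alpha> h = \<beta> g}))"
        by (rule compact_continuous_image[OF continuous_on_subset[OF continuous_mul Int_lower2]])
      then show ?thesis by (simp add: q sigma_compact_compact)
    qed
    moreover have "countable (P \<times> \<K>)" using P(1) \<K>(1) by blast
    ultimately show ?case unfolding eq by (intro sigma_compact_UN)
  qed
  define H where "H = (\<Union>r. S r)"
  have step: "b \<in> H" if "a \<in> H" "\<alpha> a = \<alpha> b" "b \<cdot> iv a \<in> \<Omega>'" for a b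
  proof -
    obtain r where r: "a \<in> S r" using \<open>a \<in> H\<close> by (auto simp: H_def)
    have "b \<cdot> iv a \<in> \<Omega>" "\<alpha> (b \<cdot> iv a) = \<beta> a" using \<Omega>'(2) that(2,3) by auto
    then have "(b \<cdot> iv a) \<cdot> a \<in> S (Suc r)" unfolding S using r by blast
    moreover have "(b \<cdot> iv a) \<cdot> a = b" using that(2) by simp
    ultimately show ?thesis unfolding H_def by (metis UN_iff UNIV_I)
  qed
  have "\<iota> x \<in> H \<longleftrightarrow> g \<in> H" if g: "g \<in> fibre_o x" for g
  proof (rule connected_equivalence_relation[OF connected_fibre_o[of x], where R = "\<lambda>a b. a \<in> H \<longleftrightarrow> b \<in> H"])
    fix a assume a: "a \<in> fibre_o x"
    note \<alpha>a = fibre_oD[OF a]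
    have c1: "continuous_on (fibre_o x) (\<lambda>b. b \<cdot> iv a)"
      by (rule continuous_on_subset[OF continuous_right_mul]) (use \<alpha>a fibre_oD in auto)
    have c2: "continuous_on (fibre_o x) (\<lambda>b. a \<cdot> iv b)"
      by (rule smooth_map_on_continuous_on[OF atlas_A atlas_A smooth_mul_compose[OF atlas_A smooth_map_on_const[OF atlas_A atlas_A]
          smooth_map_on_subset[OF smooth_iv]]]) (use \<alpha>a fibre_oD in auto)
    obtain N1 where N1: "open N1" "N1 \<inter> fibre_o x = (\<lambda>b. b \<cdot> iv a) -` \<Omega>' \<inter> fibre_o x"
      using c1 \<Omega>'(1) unfolding continuous_on_open_invariant by metis
    obtain N2 where N2: "open N2" "N2 \<inter> fibre_o x = (\<lambda>b. a \<cdot> iv b) -` \<Omega>' \<inter> fibre_o x"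
      using c2 \<Omega>'(1) unfolding continuous_on_open_invariant by metis
    have aN: "a \<in> N1 \<inter> fibre_o x" "a \<in> N2 \<inter> fibre_o x" unfolding N1(2) N2(2) using a unit\<Omega> by auto
    have "a \<in> H \<longleftrightarrow> b \<in> H" if b: "b \<in> fibre_o x \<inter> (N1 \<inter> N2)" for b
    proof -
      have "b \<in> N1 \<inter> fibre_o x" "b \<in> N2 \<inter> fibre_o x" using b by auto
      then have "b \<cdot> iv a \<in> \<Omega>'" "a \<cdot> iv b \<in> \<Omega>'" unfolding N1(2) N2(2) by auto
      then show ?thesis using step[of a b] step[of b a] \<alpha>a fibre_oD[of b x] b by auto
    qed
    then show "\<exists>T. openin (top_of_set (fibre_o x)) T \<and> a \<in> T \<and> (\<forall>b\<in>T. a \<in> H \<longleftrightarrow> b \<in> H)"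
      using aN N1(1) N2(1) a by (intro exI[of _ "fibre_o x \<inter> (N1 \<inter> N2)"]) (auto simp: openin_open)
  qed (use g in auto)
  moreover have "\<iota> x \<in> S 0" by (simp add: S)
  then have "\<iota> x \<in> H" unfolding H_def by blast
  ultimately have "fibre_o x = (\<Union>r. S r)" using sub unfolding H_def by blast
  then show ?thesis using sigma_compact_UN[of UNIV S] sc by simp
qed

section \<open>Sets covered by countably many curves\<close>

text \<open>
  Countable unions of smooth curves have this property, and unlike being such a union it is directly
  tested against submanifolds. Quantifying over all local smooth maps to the plane makes it invariant under
  smooth maps of the manifold.
\<close>

definition thin :: "'m set \<Rightarrow> bool" where
  "thin S \<longleftrightarrow> (\<forall>V f. open V \<and> smooth_map_on M flat_atlas V (f :: 'm \<Rightarrow> complex) \<longrightarrow> negligible (f ` (S \<inter> V)))"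

lemma flat_complex: "smooth_atlas (flat_atlas :: (complex, complex) chart set)"
  by (rule smooth_atlas_flat[OF finite_dimensional_euclidean])

lemma flat_real: "smooth_atlas (flat_atlas :: (real, real) chart set)"
  by (rule smooth_atlas_flat[OF finite_dimensional_euclidean])

lemma thinD: "thin S \<Longrightarrow> open V \<Longrightarrow> smooth_map_on M flat_atlas V (f :: 'm \<Rightarrow> complex) \<Longrightarrow> negligible (f ` (S \<inter> V))"
  unfolding thin_def by blast

lemma thin_mono: "thin S \<Longrightarrow> T \<subseteq> S \<Longrightarrow> thin T"
  unfolding thin_def by (meson Int_mono image_mono negligible_subset subset_refl)

lemma thin_UN:
  assumes "countable I" "\<And>i. i \<in> I \<Longrightarrow> thin (S i)"
  shows "thin (\<Union>i\<in>I. S i)"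
  unfolding thin_def
proof (intro allI impI, elim conjE)
  fix V and f :: "'m \<Rightarrow> complex"
  assume "open V" "smooth_map_on M flat_atlas V f"
  then have "negligible (\<Union>i\<in>I. f ` (S i \<inter> V))"
    using assms thinD by (intro negligible_countable_Union) auto
  moreover have "(\<Union>i\<in>I. f ` (S i \<inter> V)) = f ` ((\<Union>i\<in>I. S i) \<inter> V)" by auto
  ultimately show "negligible (f ` ((\<Union>i\<in>I. S i) \<inter> V))" by simp
qed

lemma thin_singleton: "thin {p}"
  unfolding thin_def by (auto intro!: negligible_finite)

lemma thin_image:
  assumes "thin S" "smooth_map M M k"
  shows "thin (k ` S)"
  unfolding thin_def
proof (intro allI impI, elim conjE)
  fix V and f :: "'m \<Rightarrow> complex"
  assume V: "open V" "smooth_map_on M flat_atlas V f"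
  have "open {q\<in>UNIV. k q \<in> V}"
    by (rule chart_preimage_open[OF open_UNIV smooth_map_on_continuous_on[OF atlas_M atlas_M assms(2)] V(1)])
  moreover have "smooth_map_on M flat_atlas {q\<in>UNIV. k q \<in> V} (\<lambda>q. f (k q))"
    by (rule smooth_map_on_compose[OF atlas_M atlas_M flat_complex smooth_map_on_subset[OF assms(2)] V(2)]) auto
  ultimately have "negligible ((\<lambda>q. f (k q)) ` (S \<inter> {q\<in>UNIV. k q \<in> V}))" by (rule thinD[OF assms(1)])
  moreover have "(\<lambda>q. f (k q)) ` (S \<inter> {q\<in>UNIV. k q \<in> V}) = f ` (k ` S \<inter> V)" by auto
  ultimately show "negligible (f ` (k ` S \<inter> V))" by simp
qed

lemma thin_curve:
  fixes c :: "real \<Rightarrow> 'm"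
  assumes "open J" "smooth_map_on flat_atlas M J c"
  shows "thin (c ` J)"
  unfolding thin_def
proof (intro allI impI, elim conjE)
  fix V and f :: "'m \<Rightarrow> complex"
  assume V: "open V" "smooth_map_on M flat_atlas V f"
  define J' where "J' = {s\<in>J. c s \<in> V}"
  have oJ: "open J'" unfolding J'_def
    by (rule chart_preimage_open[OF assms(1) smooth_map_on_continuous_on[OF flat_real atlas_M assms(2)] V(1)])
  have "smooth_map_on flat_atlas flat_atlas J' (\<lambda>s. f (c s))"
    by (rule smooth_map_on_compose[OF flat_real atlas_M flat_complex smooth_map_on_subset[OF assms(2)] V(2)])
      (auto simp: J'_def)
  then have "smooth_on J' (\<lambda>s. f (c s))" using smooth_map_on_flat_iff[OF oJ] by blast
  then have "(\<lambda>s. f (c s)) differentiable_on J'"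
    unfolding differentiable_on_def
    using smooth_on_has_derivative differentiableI differentiable_at_withinI by blast
  then have "negligible ((\<lambda>s. f (c s)) ` J')" by (rule negligible_differentiable_image_lowdim[rotated]) simp
  moreover have "(\<lambda>s. f (c s)) ` J' = f ` (c ` J \<inter> V)" by (auto simp: J'_def)
  ultimately show "negligible (f ` (c ` J \<inter> V))" by simp
qed

text \<open>
  A submanifold of dimension at least two has a chart and a linear projection to the plane under which its
  image contains an open set.
\<close>

lemma thin_leaf_dim:
  assumes "thin S" "p \<in> S" "leaf_dim_is M S k"
  shows "k < 2"
proof (rule ccontr)
  assume "\<not> k < 2"
  then have k: "k \<ge> 2" by simp
  obtain T where T: "topspace T = S" "immersed_submanifold M T k" using assms(3) by (auto simp: leaf_dim_is_def)
  obtain W where W: "openin T W" "p \<in> W" "embedded_submanifold M W k"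
    using T assms(2) unfolding immersed_submanifold_def by blast
  have WS: "W \<subseteq> S" using openin_subset[OF W(1)] T(1) by simp
  have "\<exists>(U, \<phi>)\<in>smooth_charts M. \<exists>E. p \<in> U \<and> subspace E \<and> dim E = k \<and> \<phi> ` (W \<inter> U) = \<phi> ` U \<inter> E"
    using W unfolding embedded_submanifold_def by blast
  then obtain U \<phi> E where U: "(U, \<phi>) \<in> smooth_charts M" "p \<in> U" "subspace E" "dim E = k" "\<phi> ` (W \<inter> U) = \<phi> ` U \<inter> E"
    by (elim bexE case_prodE) auto
  note Uc = is_chartD[OF smooth_chartsD(1)[OF U(1)]]
  obtain B where B: "B \<subseteq> E" "independent B" "E \<subseteq> span B" "card B = dim E" using basis_exists by blast
  have "card B \<ge> 2" using B(4) U(4) k by simp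
  then obtain B' where "B' \<subseteq> B" "card B' = 2" by (metis obtain_subset_with_card_n)
  then obtain u v where uv: "u \<in> B" "v \<in> B" "u \<noteq> v" by (auto simp: card_2_iff)
  obtain \<pi> :: "'e \<Rightarrow> complex" where \<pi>0: "linear \<pi>" "\<forall>w\<in>B. \<pi> w = (if w = u then 1 else \<i>)"
    using linear_independent_extend[OF B(2), of "\<lambda>w. if w = u then 1 else \<i>"] by blast
  have \<pi>: "bounded_linear \<pi>" by (rule finite_dimensional_bounded_linear[OF fd_e \<pi>0(1)])
  have \<pi>uv: "\<pi> u = 1" "\<pi> v = \<i>" using \<pi>0(2) uv by auto
  have "smooth_map_on M flat_atlas U (\<lambda>q. \<pi> (\<phi> q))"
    by (rule smooth_map_on_compose[OF atlas_M flat_e flat_complex smooth_map_on_chart[OF atlas_M U(1)]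
        smooth_map_on_flat_iff[THEN iffD2, OF open_UNIV smooth_on_bounded_linear[OF open_UNIV \<pi>]]]) simp
  from thinD[OF assms(1) Uc(1) this] have neg: "negligible ((\<lambda>q. \<pi> (\<phi> q)) ` (S \<inter> U))" .
  define y0 where "y0 = \<phi> p"
  have y0: "y0 \<in> \<phi> ` U" "y0 \<in> E"
  proof -
    show "y0 \<in> \<phi> ` U" using U(2) by (simp add: y0_def)
    have "\<phi> p \<in> \<phi> ` (W \<inter> U)" using U(2) W(2) by blast
    then show "y0 \<in> E" unfolding U(5) y0_def by blast
  qed
  define l where "l k = y0 + (Re (k - \<pi> y0) *\<^sub>R u + Im (k - \<pi> y0) *\<^sub>R v)" for k
  have \<pi>l: "\<pi> (l k) = k" for k
    by (simp add: l_def linear_add[OF \<pi>0(1)] linear_cmul[OF \<pi>0(1)] \<pi>uv complex_eq_iff)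
  have lE: "l k \<in> E" for k unfolding l_def using y0(2) U(3) uv B(1)
    by (intro subspace_add subspace_scale) auto
  have "continuous_on UNIV l" unfolding l_def by (intro continuous_intros)
  then have "open {k\<in>UNIV. l k \<in> \<phi> ` U}" by (rule chart_preimage_open[OF open_UNIV _ Uc(2)])
  moreover have "l (\<pi> y0) = y0" by (simp add: l_def)
  then have "\<pi> y0 \<in> {k\<in>UNIV. l k \<in> \<phi> ` U}" using y0(1) by simp
  moreover have "{k\<in>UNIV. l k \<in> \<phi> ` U} \<subseteq> (\<lambda>q. \<pi> (\<phi> q)) ` (S \<inter> U)"
  proof
    fix k assume "k \<in> {k\<in>UNIV. l k \<in> \<phi> ` U}"
    then have "l k \<in> \<phi> ` (W \<inter> U)" unfolding U(5) using lE by blast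
    then obtain q where q: "q \<in> W \<inter> U" "l k = \<phi> q" by blast
    show "k \<in> (\<lambda>q. \<pi> (\<phi> q)) ` (S \<inter> U)"
      by (rule image_eqI[of _ _ q]) (use q WS \<pi>l[of k] in auto)
  qed
  ultimately show False using open_not_negligible negligible_subset[OF neg] by blast
qed

lemma exists_real_coordinate:
  fixes w :: 'e
  assumes "w \<noteq> 0"
  obtains \<pi> :: "'e \<Rightarrow> real" where "bounded_linear \<pi>" "\<pi> w = 1"
proof -
  have "independent {w}" using assms by simp
  then obtain \<pi> :: "'e \<Rightarrow> real" where "linear \<pi>" "\<forall>w\<in>{w}. \<pi> w = 1"
    using linear_independent_extend[of "{w}" "\<lambda>_. 1::real"] by blast
  then show ?thesis using that finite_dimensional_bounded_linear[OF fd_e] by blast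
qed

section \<open>Leaves of dimension at least two\<close>

text \<open>
  The coordinate \<open>\<pi>\<close> of the target has nonzero derivative along the fibre, and the rank along the fibre is at
  most one because no arrow is punctured. So in coordinates where source and \<open>\<pi>\<close> are linear, the
  target depends on \<open>\<pi>\<close> only, and runs through the curve \<open>l\<close>.
\<close>

lemma rank_one_thin:
  assumes V: "(V, \<psi>) \<in> smooth_charts M" and U: "(U, \<phi>) \<in> smooth_charts A" "g \<in> U" "\<beta> ` U \<subseteq> V"
    and V1: "(V1, \<psi>1) \<in> smooth_charts M" "\<alpha> ` U \<subseteq> V1"
    and L: "bounded_linear L" "\<And>h. h \<in> U \<Longrightarrow> (\<psi>1 (\<alpha> h), (\<pi> (\<psi> (\<beta> h)) :: real)) = L (\<phi> h)" "surj L"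
    and \<pi>: "bounded_linear \<pi>" and ball: "\<phi> ` U = ball (\<phi> g) \<rho>" "\<rho> > 0"
    and np: "\<And>h. h \<in> fibre_o x \<Longrightarrow> \<not> punctured x h" and g: "g \<in> fibre_o x"
  obtains X where "open X" "g \<in> X" "thin (\<beta> ` {h\<in>X. \<alpha> h = x})"
proof -
  note Uc = is_chartD[OF smooth_chartsD(1)[OF U(1)]] and Vc = is_chartD[OF smooth_chartsD(1)[OF V]]
  have lin: "linear L" using L(1) by (rule bounded_linear.linear)
  define b where "b z = \<psi> (\<beta> (inv_into U \<phi> z))" for z
  let ?z = "\<phi> g"
  have smb: "smooth_on (ball ?z \<rho>) b" unfolding b_def ball(1)[symmetric] by (rule smooth_tgt_in_chart[OF U(1) V U(3)])
  have invU: "inv_into U \<phi> z \<in> U" "\<phi> (inv_into U \<phi> z) = z" if "z \<in> ball ?z \<rho>" for z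
    using that Uc(6) by (auto simp flip: ball(1))
  have sb: "snd (L z) = \<pi> (b z)" "fst (L z) = \<psi>1 (\<alpha> (inv_into U \<phi> z))" if "z \<in> ball ?z \<rho>" for z
    using arg_cong[OF L(2)[OF invU(1)[OF that]], of snd] arg_cong[OF L(2)[OF invU(1)[OF that]], of fst] invU(2)[OF that]
    by (simp_all add: b_def)
  have \<alpha>g: "\<alpha> g = x" by (rule fibre_oD[OF g])
  have xV: "x \<in> V1" using V1(2) U(2) \<alpha>g by auto
  have s: "\<psi>1 (\<alpha> h) = fst (L (\<phi> h))" if "h \<in> U" for h using arg_cong[OF L(2)[OF that], of fst] by simp
  note fib = fibre_in_chart[OF U(1) V1 xV s]
  have lin1: "linear (\<lambda>z. fst (L z))" using linear_compose[OF lin linear_fst] by (simp add: o_def)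
  have con: "connected {h\<in>U. \<alpha> h = x}" by (rule connected_fibre_in_chart[OF U(1) V1 xV s lin1 ball(1)])
  have Wo: "{h\<in>U. \<alpha> h = x} \<subseteq> fibre_o x" by (rule fibre_o_maximal[OF con _ _ g]) (use U(2) \<alpha>g in auto)
  obtain u where u: "L u = (0, 1)" using L(3) by (metis surjD)
  have der0: "D b z w = 0" if z: "z \<in> ball ?z \<rho>" "fst (L z) = \<psi>1 x" and w: "L w = 0" for z w
  proof -
    define h where "h = inv_into U \<phi> z"
    have h: "h \<in> U" "\<phi> h = z" using invU[OF z(1)] by (simp_all add: h_def)
    have "h \<in> inv_into U \<phi> ` {z \<in> \<phi> ` U. fst (L z) = \<psi>1 x \<and> True}" using z by (auto simp: h_def ball(1))
    then have "h \<in> {h\<in>U. \<alpha> h = x \<and> True}" using fib[of "\<lambda>_. True"] by blast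
    then have hx: "\<alpha> h = x" "h \<in> fibre_o x" using Wo by auto
    have bl: "bounded_linear (\<lambda>z. fst (L z))" by (rule bounded_linear_compose[OF bounded_linear_fst L(1)])
    have sj: "surj (\<lambda>z. fst (L z))" using L(3) unfolding surj_def by (metis fst_conv)
    have beq: "(\<lambda>z. \<psi> (\<beta> (inv_into U \<phi> z))) = b" by (rule ext) (simp add: b_def)
    have "\<not> (\<forall>c d::real. c *\<^sub>R D b z u + d *\<^sub>R D b z w = 0 \<longrightarrow> c = 0 \<and> d = 0)"
    proof
      assume ind: "\<forall>c d::real. c *\<^sub>R D b z u + d *\<^sub>R D b z w = 0 \<longrightarrow> c = 0 \<and> d = 0"
      have "punctured (\<alpha> h) h"
        by (rule rank_two_imp_punctured[OF U(1) h(1) V1 V U(3) bl sj s, of u w]) (use u w ind h(2) beq in auto)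
      then show False using np[OF hx(2)] hx(1) by simp
    qed
    then obtain c d :: real where cd: "c *\<^sub>R D b z u + d *\<^sub>R D b z w = 0" "\<not> (c = 0 \<and> d = 0)" by blast
    have db: "(b has_derivative D b z) (at z)" by (rule smooth_on_has_derivative[OF smb z(1)])
    have "((\<lambda>z. \<pi> (b z)) has_derivative (\<lambda>w. \<pi> (D b z w))) (at z)" by (rule bounded_linear.has_derivative[OF \<pi> db])
    moreover have "((\<lambda>z. \<pi> (b z)) has_derivative (\<lambda>w. snd (L w))) (at z)"
    proof (rule has_derivative_transform_within_open[OF _ open_ball z(1)])
      show "((\<lambda>z. snd (L z)) has_derivative (\<lambda>w. snd (L w))) (at z)"
        by (rule bounded_linear_imp_has_derivative[OF bounded_linear_compose[OF bounded_linear_snd L(1)]])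
    qed (rule sb(1))
    ultimately have "(\<lambda>w. \<pi> (D b z w)) = (\<lambda>w. snd (L w))" by (rule has_derivative_unique)
    then have e: "\<pi> (D b z w') = snd (L w')" for w' by (rule fun_cong)
    have "\<pi> (c *\<^sub>R D b z u + d *\<^sub>R D b z w) = c"
      using e[of u] e[of w] u w
      by (simp add: linear_add[OF bounded_linear.linear[OF \<pi>]] linear_cmul[OF bounded_linear.linear[OF \<pi>]])
    then have "c = 0" using cd(1) linear_0[OF bounded_linear.linear[OF \<pi>]] by simp
    then show ?thesis using cd by simp
  qed
  define s0 where "s0 = snd (L ?z)"
  define l where "l t = ?z + (t - s0) *\<^sub>R u" for t
  have fz: "fst (L ?z) = \<psi>1 x" using s[OF U(2)] \<alpha>g by simp
  have Ll: "L (l t) = (\<psi>1 x, t)" for t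
    using fz by (simp add: l_def linear_add[OF lin] linear_cmul[OF lin] u s0_def prod_eq_iff)
  define J where "J = {t\<in>UNIV. l t \<in> ball ?z \<rho>}"
  have "continuous_on UNIV l" unfolding l_def by (intro continuous_intros)
  then have oJ: "open J" unfolding J_def by (rule chart_preimage_open[OF open_UNIV _ open_ball])
  have bV: "b z \<in> \<psi> ` V" if "z \<in> ball ?z \<rho>" for z using invU(1)[OF that] U(3) by (auto simp: b_def)
  have sml: "smooth_on J l" unfolding l_def
    by (intro smooth_on_add smooth_on_const smooth_on_scaleR smooth_on_diff smooth_on_id oJ)
  have "smooth_on J (\<lambda>t. b (l t))"
    by (rule smooth_on_compose[OF fd_h smb sml]) (auto simp: J_def)
  then have "smooth_map_on flat_atlas flat_atlas J (\<lambda>t. b (l t))" using smooth_map_on_flat_iff[OF oJ] by blast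
  then have "smooth_map_on flat_atlas M J (\<lambda>t. inv_into V \<psi> (b (l t)))"
    by (rule smooth_map_on_compose[OF flat_real flat_e atlas_M _ smooth_map_on_inv_chart[OF atlas_M V]])
      (use bV in \<open>auto simp: J_def\<close>)
  then have th: "thin ((\<lambda>t. inv_into V \<psi> (b (l t))) ` J)" by (rule thin_curve[OF oJ])
  define X where "X = {h\<in>U. \<phi> h \<in> (\<lambda>z. l (snd (L z))) -` ball ?z \<rho>}"
  have "continuous_on UNIV (\<lambda>z. l (snd (L z)))" unfolding l_def
    by (intro continuous_intros linear_continuous_on L(1))
  then have oX: "open X" unfolding X_def by (intro chart_preimage_open[OF Uc(1,4)] open_vimage open_ball)
  have gX: "g \<in> X" using U(2) ball(2) by (simp add: X_def l_def s0_def)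
  have "\<beta> ` {h\<in>X. \<alpha> h = x} \<subseteq> (\<lambda>t. inv_into V \<psi> (b (l t))) ` J"
  proof
    fix m assume "m \<in> \<beta> ` {h\<in>X. \<alpha> h = x}"
    then obtain h where h: "h \<in> U" "\<phi> h \<in> (\<lambda>z. l (snd (L z))) -` ball ?z \<rho>" "\<alpha> h = x" "m = \<beta> h" by (auto simp: X_def)
    define t where "t = snd (L (\<phi> h))"
    have lt: "l t \<in> ball ?z \<rho>" using h(2) by (simp add: t_def)
    have \<phi>h: "\<phi> h \<in> ball ?z \<rho>" using h(1) ball(1) by blast
    have Lh: "L (\<phi> h) = (\<psi>1 x, t)" using s[OF h(1)] h(3) by (simp add: t_def prod_eq_iff)
    have "b (l t) = b (\<phi> h)"
      by (rule constant_along_kernel[OF smb lin _ lt Ll \<phi>h Lh]) (use der0 in auto)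
    also have "\<dots> = \<psi> m" using Uc(6)[OF h(1)] h(4) by (simp add: b_def)
    finally have "inv_into V \<psi> (b (l t)) = m" using Vc(6)[of m] U(3) h by auto
    then show "m \<in> (\<lambda>t. inv_into V \<psi> (b (l t))) ` J" using lt by (intro image_eqI[of _ _ t]) (auto simp: J_def)
  qed
  then show ?thesis using that[OF oX gX] thin_mono[OF th] by blast
qed

text \<open>
  Either the target is locally constant on the fibre near \<open>\<iota> x\<close>, or its derivative along the fibre is
  nonzero at some arrow close to \<open>\<iota> x\<close>, and there the rank is exactly one.
\<close>

lemma not_punctured_imp_locally_thin:
  assumes np: "\<And>h. h \<in> fibre_o x \<Longrightarrow> \<not> punctured x h"
  obtains g X where "g \<in> fibre_o x" "open X" "g \<in> X" "thin (\<beta> ` {h\<in>X. \<alpha> h = x})"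
proof -
  obtain V \<psi> U \<phi> \<rho> L where V: "(V, \<psi>) \<in> smooth_charts M" "x \<in> V" and
    U: "(U, \<phi>) \<in> smooth_charts A" "\<iota> x \<in> U" "\<beta> ` U \<subseteq> V" "\<rho> > 0" "\<phi> ` U = ball (\<phi> (\<iota> x)) \<rho>"
      "bounded_linear L" "surj L" "\<alpha> ` U \<subseteq> V" "\<And>h. h \<in> U \<Longrightarrow> \<psi> (\<alpha> h) = L (\<phi> h)"
    by (rule unit_chart[of x]) (rule that)
  note Vc = is_chartD[OF smooth_chartsD(1)[OF V(1)]]
  note Uc = is_chartD[OF smooth_chartsD(1)[OF U(1)]]
  have lin: "linear L" using U(6) by (rule bounded_linear.linear)
  note fib = fibre_in_chart[OF U(1) V(1) U(8) V(2) U(9)]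
  define b where "b = (\<lambda>z. \<psi> (\<beta> (inv_into U \<phi> z)))"
  let ?z = "\<phi> (\<iota> x)"
  have smb: "smooth_on (\<phi> ` U) b" unfolding b_def by (rule smooth_tgt_in_chart[OF U(1) V(1) U(3)])
  have con: "connected {h\<in>U. \<alpha> h = x}" by (rule connected_fibre_in_chart[OF U(1) V(1) U(8) V(2) U(9) lin U(5)])
  have Wo: "{h\<in>U. \<alpha> h = x} \<subseteq> fibre_o x" by (rule fibre_o_maximal[OF con, of _ "\<iota> x"]) (use U(2) in auto)
  show ?thesis
  proof (cases "\<forall>z\<in>ball ?z \<rho>. \<forall>w. L z = \<psi> x \<longrightarrow> L w = 0 \<longrightarrow> D b z w = 0")
    case True
    have "\<beta> h = x" if h: "h \<in> U" "\<alpha> h = x" for h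
    proof -
      have "b (\<phi> h) = b ?z"
        by (rule constant_along_kernel[OF smb[unfolded U(5)] lin, of "\<psi> x"])
          (use True h U(2,4,5) U(9)[OF h(1)] U(9)[OF U(2)] in auto)
      then have "\<psi> (\<beta> h) = \<psi> x" using Uc(6)[OF h(1)] Uc(6)[OF U(2)] by (simp add: b_def)
      then show ?thesis using Vc(3) V(2) h(1) U(3) by (auto simp: inj_on_def)
    qed
    then have "\<beta> ` {h\<in>U. \<alpha> h = x} \<subseteq> {x}" by blast
    then show ?thesis using that[of "\<iota> x" U] Uc(1) U(2) thin_mono[OF thin_singleton] by simp
  next
    case False
    then obtain z1 w where z1: "z1 \<in> ball ?z \<rho>" "L z1 = \<psi> x" "L w = 0" "D b z1 w \<noteq> 0" by blast
    then have z1U: "z1 \<in> \<phi> ` U" using U(5) by simp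
    define g where "g = inv_into U \<phi> z1"
    have g: "g \<in> U" "\<phi> g = z1" using z1U Uc(6) by (auto simp: g_def)
    have "g \<in> inv_into U \<phi> ` {z \<in> \<phi> ` U. L z = \<psi> x \<and> True}" using z1U z1(2) by (auto simp: g_def)
    then have "g \<in> {h\<in>U. \<alpha> h = x \<and> True}" using fib[of "\<lambda>_. True"] by blast
    then have gx: "g \<in> fibre_o x" using Wo by auto
    obtain \<pi> :: "'e \<Rightarrow> real" where \<pi>: "bounded_linear \<pi>" "\<pi> (D b z1 w) = 1" using exists_real_coordinate[OF z1(4)] by metis
    have lin2: "linear (\<lambda>w. \<pi> (D b z1 w))"
      using linear_compose[OF has_derivative_linear[OF smooth_on_has_derivative[OF smb z1U]] bounded_linear.linear[OF \<pi>(1)]]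
      by (simp add: o_def)
    have sj: "\<exists>v. (L v, \<pi> (D b (\<phi> g) v)) = y" for y
    proof -
      obtain r where r: "L r = fst y" using U(7) by (metis surjD)
      define k where "k = snd y - \<pi> (D b z1 r)"
      have "L (r + k *\<^sub>R w) = fst y" using r z1(3) by (simp add: linear_add[OF lin] linear_cmul[OF lin])
      moreover have "\<pi> (D b z1 (r + k *\<^sub>R w)) = snd y"
        using linear_add[OF lin2] linear_cmul[OF lin2] \<pi>(2) by (simp add: k_def)
      ultimately show ?thesis by (intro exI[of _ "r + k *\<^sub>R w"]) (simp add: prod_eq_iff g(2))
    qed
    obtain U' \<phi>' \<rho>' L' where U': "(U', \<phi>') \<in> smooth_charts A" "g \<in> U'" "U' \<subseteq> UNIV \<inter> U" "\<rho>' > 0"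
      "\<phi>' ` U' = ball (\<phi>' g) \<rho>'" "bounded_linear L'" "surj L'"
      "\<And>h. h \<in> U' \<Longrightarrow> (\<psi> (\<alpha> h), \<pi> (\<psi> (\<beta> h))) = L' (\<phi>' h)"
      by (rule tangential_chart[OF finite_dimensional_euclidean U(1) g(1) V(1) U(3,6,9) \<pi>(1) open_UNIV UNIV_I sj[unfolded b_def]]) (assumption | rule that)+
    have "\<beta> ` U' \<subseteq> V" "\<alpha> ` U' \<subseteq> V" using U'(3) U(3,8) by auto
    then obtain X where "open X" "g \<in> X" "thin (\<beta> ` {h\<in>X. \<alpha> h = x})"
      by (rule rank_one_thin[OF V(1) U'(1,2) _ V(1) _ U'(6) U'(8) U'(7) \<pi>(1) U'(5,4) np gx])
    then show ?thesis using that gx by blast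
  qed
qed

lemma thin_left_mul:
  assumes \<sigma>: "\<sigma> \<in> bisections \<Gamma>" and X: "open X" "g \<in> X" "thin (\<beta> ` {h\<in>X. \<alpha> h = x})"
  obtains Y where "open Y" "left_mul \<sigma> g \<in> Y" "thin (\<beta> ` {h\<in>Y. \<alpha> h = x})"
proof -
  note l = left_mul[OF \<sigma>] and c' = left_mul(1)[OF bis_inv_bisection[OF \<sigma>]]
  let ?Y = "{h\<in>UNIV. left_mul (bis_inv \<sigma>) h \<in> X}"
  have th: "thin ((\<beta> \<circ> \<sigma>) ` \<beta> ` {h\<in>X. \<alpha> h = x})"
    by (rule thin_image[OF X(3) bisectionsD(4)[OF \<sigma>]])
  have "\<beta> ` {h\<in>?Y. \<alpha> h = x} \<subseteq> (\<beta> \<circ> \<sigma>) ` \<beta> ` {h\<in>X. \<alpha> h = x}"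
  proof
    fix m assume "m \<in> \<beta> ` {h\<in>?Y. \<alpha> h = x}"
    then obtain h where h: "left_mul (bis_inv \<sigma>) h \<in> X" "\<alpha> h = x" "m = \<beta> h" by auto
    define k where "k = left_mul (bis_inv \<sigma>) h"
    have kh: "left_mul \<sigma> k = h" by (simp add: k_def l)
    have "\<alpha> k = x" "m = (\<beta> \<circ> \<sigma>) (\<beta> k)" using l(2)[of k] l(3)[of k] kh h by simp_all
    then show "m \<in> (\<beta> \<circ> \<sigma>) ` \<beta> ` {h\<in>X. \<alpha> h = x}" using h(1) k_def by blast
  qed
  then have "thin (\<beta> ` {h\<in>?Y. \<alpha> h = x})" by (rule thin_mono[OF th])
  moreover have "open ?Y" by (rule chart_preimage_open[OF open_UNIV c' X(1)])
  moreover have "left_mul \<sigma> g \<in> ?Y" using X(2) by (simp add: l)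
  ultimately show ?thesis using that by blast
qed

text \<open>
  If some arrow is not punctured, none is, by homogeneity; then the target map is locally thin at some arrow,
  hence at every arrow, and the leaf is thin as a countable union.
\<close>

lemma leaf_dim_imp_punctured:
  assumes dim: "leaf_dim_is M (leaf \<Gamma> x) k" "k \<ge> 2" and h: "h \<in> fibre_o x"
  shows "punctured x h"
proof (rule ccontr)
  assume nh: "\<not> punctured x h"
  have np: "\<not> punctured x g" if g: "g \<in> fibre_o x" for g
  proof
    assume p: "punctured x g"
    obtain \<sigma> where "\<sigma> \<in> bisections \<Gamma>" "left_mul \<sigma> g = h" using fibre_o_transitive[OF g h] by metis
    then show False using punctured_left_mul[OF _ p] nh by blast
  qed
  obtain g0 X0 where g0: "g0 \<in> fibre_o x" "open X0" "g0 \<in> X0" "thin (\<beta> ` {h\<in>X0. \<alpha> h = x})"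
    using not_punctured_imp_locally_thin[OF np] by metis
  have "\<exists>Y. open Y \<and> g \<in> Y \<and> thin (\<beta> ` {h\<in>Y. \<alpha> h = x})" if g: "g \<in> fibre_o x" for g
  proof -
    obtain \<sigma> where \<sigma>: "\<sigma> \<in> bisections \<Gamma>" "left_mul \<sigma> g0 = g" using fibre_o_transitive[OF g0(1) g] by metis
    show ?thesis using thin_left_mul[OF \<sigma>(1) g0(2-4)] \<sigma>(2) by metis
  qed
  then obtain Y where Y: "\<And>g. g \<in> fibre_o x \<Longrightarrow> open (Y g) \<and> g \<in> Y g"
    "\<And>g. g \<in> fibre_o x \<Longrightarrow> thin (\<beta> ` {h\<in>Y g. \<alpha> h = x})" by metis
  obtain C where C: "countable C" "C \<subseteq> fibre_o x" "fibre_o x \<subseteq> (\<Union>g\<in>C. Y g)"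
    by (rule sigma_compact_countable_subcover[OF sigma_compact_fibre_o Y(1)])
  have "thin (\<Union>g\<in>C. \<beta> ` {h\<in>Y g. \<alpha> h = x})" by (rule thin_UN[OF C(1)]) (use Y(2) C(2) in blast)
  moreover have "leaf \<Gamma> x \<subseteq> (\<Union>g\<in>C. \<beta> ` {h\<in>Y g. \<alpha> h = x})"
    unfolding leaf_def using C(3) fibre_oD by fastforce
  ultimately have "thin (leaf \<Gamma> x)" by (rule thin_mono)
  moreover have "\<beta> (\<iota> x) \<in> leaf \<Gamma> x" unfolding leaf_def by (rule imageI) simp
  ultimately show False using thin_leaf_dim[OF _ _ dim(1)] dim(2) by fastforce
qed

section \<open>Moving several points\<close>

text \<open>
  Induction on the number of arrows already attained. If the leaf of \<open>x\<^sub>k\<close> contained the target of an earlier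
  \<open>\<gamma>\<^sub>i\<close>, it would contain \<open>x\<^sub>i\<close>; so in the low-dimensional case the leaf misses all targets in \<open>F\<close>.
\<close>

lemma bisection_through_arrows:
  fixes n m :: nat and x :: "nat \<Rightarrow> 'm" and \<gamma> :: "nat \<Rightarrow> 'g"
  assumes inj: "inj_on x {1..n}"
    and dich: "\<And>i. i \<in> {1..n} \<Longrightarrow> (\<exists>k\<ge>2. leaf_dim_is M (leaf \<Gamma> (x i)) k) \<or> (\<forall>j\<in>{1..n}. j \<noteq> i \<longrightarrow> x j \<notin> leaf \<Gamma> (x i))"
    and \<gamma>: "\<And>i. i \<in> {1..n} \<Longrightarrow> \<gamma> i \<in> fibre_o (x i)"
    and dist: "\<And>i j. i \<in> {1..n} \<Longrightarrow> j \<in> {1..n} \<Longrightarrow> i \<noteq> j \<Longrightarrow> \<beta> (\<gamma> i) \<noteq> \<beta> (\<gamma> j)"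
    and X: "open X" "\<And>i. i \<in> {1..n} \<Longrightarrow> leaf \<Gamma> (x i) \<subseteq> X"
    and m: "m \<le> n"
  shows "\<exists>\<sigma>\<in>supported_bis X. \<forall>i\<in>{1..m}. \<sigma> (x i) = \<gamma> i"
  using m
proof (induction m)
  case 0
  have "\<iota> \<in> bisections \<Gamma>"
    by (rule bisectionsI[OF smooth_unit _ smooth_map_on_id[OF atlas_M]]) simp_all
  then have "\<iota> \<in> supported_bis X" by (auto simp: supported_bis_def)
  then show ?case by auto
next
  case (Suc m)
  then obtain \<sigma> where \<sigma>: "\<sigma> \<in> supported_bis X" "\<And>i. i \<in> {1..m} \<Longrightarrow> \<sigma> (x i) = \<gamma> i" by auto
  have b: "\<sigma> \<in> bisections \<Gamma>" and fo: "\<And>y. \<sigma> y \<in> fibre_o y" using \<sigma>(1) by (auto simp: supported_bis_def)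
  note s = bisectionsD[OF b]
  define k where "k = Suc m"
  have k: "k \<in> {1..n}" using Suc.prems by (simp add: k_def)
  \<comment> \<open>The targets that the correcting bisection has to leave alone.\<close>
  define F where "F = (\<lambda>i. \<beta> (\<gamma> i)) ` {1..m}"
  have iF: "i \<in> {1..n}" "i \<noteq> k" if "i \<in> {1..m}" for i using that Suc.prems by (auto simp: k_def)
  have "\<beta> (\<sigma> (x k)) \<notin> F"
  proof
    assume "\<beta> (\<sigma> (x k)) \<in> F"
    then obtain i where i0: "i \<in> {1..m}" "\<beta> (\<sigma> (x k)) = \<beta> (\<gamma> i)" unfolding F_def by blast
    then have i: "i \<in> {1..m}" "\<beta> (\<sigma> (x k)) = \<beta> (\<sigma> (x i))" by (simp_all only: \<sigma>(2)[OF i0(1)])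
    have "x k = x i" using arg_cong[OF i(2), of "inv_into UNIV (\<beta> \<circ> \<sigma>)"] unfolding s(6) .
    then show False using inj_onD[OF inj _ k iF(1)[OF i(1)]] iF(2)[OF i(1)] by auto
  qed
  moreover have "\<beta> (\<gamma> k) \<notin> F" 
  proof
    assume "\<beta> (\<gamma> k) \<in> F"
    then obtain i where i: "i \<in> {1..m}" "\<beta> (\<gamma> k) = \<beta> (\<gamma> i)" unfolding F_def by blast
    then show False using dist[OF iF(1)[OF i(1)] k iF(2)[OF i(1)]] by simp
  qed
  moreover have "(\<forall>h\<in>fibre_o (x k). punctured (x k) h) \<or> F \<inter> \<beta> ` fibre_o (x k) = {}"
  proof (cases "\<exists>j\<ge>2. leaf_dim_is M (leaf \<Gamma> (x k)) j")
    case True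
    then show ?thesis using leaf_dim_imp_punctured by blast
  next
    case False
    then have off: "\<And>j. j \<in> {1..n} \<Longrightarrow> j \<noteq> k \<Longrightarrow> x j \<notin> leaf \<Gamma> (x k)" using dich[OF k] by blast
    have "F \<inter> \<beta> ` fibre_o (x k) = {}"
    proof (rule ccontr)
      assume "F \<inter> \<beta> ` fibre_o (x k) \<noteq> {}"
      then obtain i h where i: "i \<in> {1..m}" "h \<in> fibre_o (x k)" "\<beta> (\<gamma> i) = \<beta> h" unfolding F_def by blast
      have gi: "\<gamma> i \<in> fibre_o (x i)" by (rule \<gamma>[OF iF(1)[OF i(1)]])
      have "iv (\<gamma> i) \<cdot> h \<in> fibre_o (x k)"
        by (rule fibre_o_mul[OF i(2)]) (use fibre_o_iv[OF gi] i(3) in simp)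
      moreover have "\<beta> (iv (\<gamma> i) \<cdot> h) = x i" using i(3) fibre_oD[OF gi] by simp
      ultimately have "x i \<in> leaf \<Gamma> (x k)" unfolding leaf_def by (metis imageI)
      then show False using off[OF iF[OF i(1)]] by blast
    qed
    then show ?thesis ..
  qed
  ultimately have "reach (X - F) (\<sigma> (x k)) (\<gamma> k)"
    by (intro reach_avoiding[OF X(1) _ _ fo _ \<gamma>[OF k]]) (use X(2)[OF k] in \<open>auto simp: leaf_def F_def\<close>)
  then obtain \<tau> where \<tau>: "\<tau> \<in> supported_bis (X - F)" "\<tau> (\<beta> (\<sigma> (x k))) \<cdot> \<sigma> (x k) = \<gamma> k" by (auto simp: reach_def)
  have \<tau>X: "\<tau> \<in> supported_bis X" using \<tau>(1) supported_bis_mono[of "X - F" X] by blast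
  have "bis_mul \<tau> \<sigma> (x i) = \<gamma> i" if i: "i \<in> {1..Suc m}" for i
  proof (cases "i = k")
    case True
    then show ?thesis using \<tau>(2) by (simp add: bis_mul_def)
  next
    case False
    then have i: "i \<in> {1..m}" using i by (auto simp: k_def)
    then have "\<beta> (\<gamma> i) \<notin> X - F" by (auto simp: F_def)
    then have "\<tau> (\<beta> (\<gamma> i)) = \<iota> (\<beta> (\<gamma> i))" by (rule supported_bis_outside[OF \<tau>(1)])
    then show ?thesis by (simp add: bis_mul_def \<sigma>(2)[OF i])
  qed
  then show ?case using supported_bis_mul[OF \<tau>X \<sigma>(1)] by blast
qed

lemma supported_bis_diffeo_supp:
  assumes "\<sigma> \<in> supported_bis X"
  shows "diffeo_supp (\<beta> \<circ> \<sigma>) \<subseteq> X"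
proof -
  have "{y. (\<beta> \<circ> \<sigma>) y \<noteq> y} \<subseteq> {y. \<sigma> y \<noteq> \<iota> y}" by auto
  then have "diffeo_supp (\<beta> \<circ> \<sigma>) \<subseteq> bisection_supp \<Gamma> \<sigma>"
    unfolding diffeo_supp_def bisection_supp_def by (rule closure_mono)
  then show ?thesis using supported_bis_supp(2)[OF assms] by blast
qed

lemma supported_bis_Bis_c: "\<sigma> \<in> supported_bis X \<Longrightarrow> \<sigma> \<in> carrier (Bis_c \<Gamma>)"
  using supported_bis_supp(1) by (auto simp: Bis_c_def supported_bis_def)

end

theorem corollary4p2:
  fixes \<Gamma> :: "('g::topological_space, 'm::{t2_space, second_countable_topology},
               'h::real_normed_vector, 'e::real_normed_vector) groupoid_data"
  assumes "lie_groupoid \<Gamma>"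
  shows
    "(\<forall>\<G>\<in>{Bis_c \<Gamma>, Bis \<Gamma>}. \<forall>(n::nat) (x::nat \<Rightarrow> 'm) (\<gamma>::nat \<Rightarrow> 'g) (V::nat \<Rightarrow> 'm set).
        inj_on x {1..n} \<and>
        (\<forall>i\<in>{1..n}. (\<exists>k\<ge>2. leaf_dim_is (unit_atlas \<Gamma>) (leaf \<Gamma> (x i)) k) \<or>
                    (\<forall>j\<in>{1..n}. j \<noteq> i \<longrightarrow> x j \<notin> leaf \<Gamma> (x i))) \<and>
        \<gamma> \<in> arrow_tuples \<Gamma> n x \<and>
        (\<forall>i\<in>{1..n}. open (V i) \<and> leaf \<Gamma> (x i) \<subseteq> V i)
        \<longrightarrow> (\<exists>\<sigma>\<in>carrier \<G>. (\<forall>i\<in>{1..n}. \<sigma> (x i) = \<gamma> i) \<and>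
               diffeo_supp (tgt \<Gamma> \<circ> \<sigma>) \<subseteq> (\<Union>i\<in>{1..n}. V i)))
     \<and>
     (\<forall>\<gamma>\<in>arrows_o \<Gamma>. \<forall>V. open V \<and> leaf \<Gamma> (src \<Gamma> \<gamma>) \<subseteq> V
        \<longrightarrow> (\<exists>\<sigma>\<in>carrier (Bis_c \<Gamma>). \<sigma> (src \<Gamma> \<gamma>) = \<gamma> \<and> diffeo_supp (tgt \<Gamma> \<circ> \<sigma>) \<subseteq> V))"
proof -
  interpret lie_gpd \<Gamma> by unfold_locales (rule assms)
  have main: "\<exists>\<sigma>\<in>carrier (Bis_c \<Gamma>). (\<forall>i\<in>{1..n}. \<sigma> (x i) = \<gamma> i) \<and> diffeo_supp (tgt \<Gamma> \<circ> \<sigma>) \<subseteq> (\<Union>i\<in>{1..n}. V i)"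
    if inj: "inj_on x {1..n}"
      and dich: "\<forall>i\<in>{1..n}. (\<exists>k\<ge>2. leaf_dim_is (unit_atlas \<Gamma>) (leaf \<Gamma> (x i)) k) \<or>
                    (\<forall>j\<in>{1..n}. j \<noteq> i \<longrightarrow> x j \<notin> leaf \<Gamma> (x i))"
      and \<gamma>: "\<gamma> \<in> arrow_tuples \<Gamma> n x"
      and V: "\<forall>i\<in>{1..n}. open (V i) \<and> leaf \<Gamma> (x i) \<subseteq> V i"
    for n :: nat and x :: "nat \<Rightarrow> 'm" and \<gamma> :: "nat \<Rightarrow> 'g" and V :: "nat \<Rightarrow> 'm set"
  proof -
    have "\<exists>\<sigma>\<in>supported_bis (\<Union>i\<in>{1..n}. V i). \<forall>i\<in>{1..n}. \<sigma> (x i) = \<gamma> i"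
    proof (rule bisection_through_arrows[OF inj])
      show "(\<exists>k\<ge>2. leaf_dim_is (unit_atlas \<Gamma>) (leaf \<Gamma> (x i)) k) \<or> (\<forall>j\<in>{1..n}. j \<noteq> i \<longrightarrow> x j \<notin> leaf \<Gamma> (x i))"
        if "i \<in> {1..n}" for i using dich that by blast
      show "\<gamma> i \<in> src_fibre_o \<Gamma> (x i)" if "i \<in> {1..n}" for i using \<gamma> that unfolding arrow_tuples_def by blast
      show "tgt \<Gamma> (\<gamma> i) \<noteq> tgt \<Gamma> (\<gamma> j)" if "i \<in> {1..n}" "j \<in> {1..n}" "i \<noteq> j" for i j
        using \<gamma> that unfolding arrow_tuples_def by blast
      show "open (\<Union>i\<in>{1..n}. V i)" using V by blast
      show "leaf \<Gamma> (x i) \<subseteq> (\<Union>i\<in>{1..n}. V i)" if "i \<in> {1..n}" for i using V that by blast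
    qed simp
    then show ?thesis using supported_bis_Bis_c supported_bis_diffeo_supp by blast
  qed
  have "carrier (Bis_c \<Gamma>) \<subseteq> carrier \<G>" if "\<G> \<in> {Bis_c \<Gamma>, Bis \<Gamma>}" for \<G>
    using that by (auto simp: Bis_c_def Bis_def)
  then have first: "\<exists>\<sigma>\<in>carrier \<G>. (\<forall>i\<in>{1..n}. \<sigma> (x i) = \<gamma> i) \<and> diffeo_supp (tgt \<Gamma> \<circ> \<sigma>) \<subseteq> (\<Union>i\<in>{1..n}. V i)"
    if "\<G> \<in> {Bis_c \<Gamma>, Bis \<Gamma>}" "inj_on x {1..n} \<and>
        (\<forall>i\<in>{1..n}. (\<exists>k\<ge>2. leaf_dim_is (unit_atlas \<Gamma>) (leaf \<Gamma> (x i)) k) \<or>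
                    (\<forall>j\<in>{1..n}. j \<noteq> i \<longrightarrow> x j \<notin> leaf \<Gamma> (x i))) \<and>
        \<gamma> \<in> arrow_tuples \<Gamma> n x \<and> (\<forall>i\<in>{1..n}. open (V i) \<and> leaf \<Gamma> (x i) \<subseteq> V i)" for \<G> n x \<gamma> V
    using main[of x n \<gamma> V] that by blast
  have second: "\<exists>\<sigma>\<in>carrier (Bis_c \<Gamma>). \<sigma> (src \<Gamma> \<gamma>) = \<gamma> \<and> diffeo_supp (tgt \<Gamma> \<circ> \<sigma>) \<subseteq> V"
    if \<gamma>: "\<gamma> \<in> arrows_o \<Gamma>" and V: "open V \<and> leaf \<Gamma> (src \<Gamma> \<gamma>) \<subseteq> V" for \<gamma> V
  proof -
    obtain y where y: "\<gamma> \<in> src_fibre_o \<Gamma> y" using \<gamma> by (auto simp: arrows_o_def)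
    have "src \<Gamma> \<gamma> = y" by (rule fibre_oD[OF y])
    then have "(\<lambda>_. \<gamma>) \<in> arrow_tuples \<Gamma> 1 (\<lambda>_. src \<Gamma> \<gamma>)" using y by (simp add: arrow_tuples_def)
    then show ?thesis using main[of "\<lambda>_. src \<Gamma> \<gamma>" 1 "\<lambda>_. \<gamma>" "\<lambda>_. V"] V by auto
  qed
  show ?thesis
    by (intro conjI ballI allI impI) (erule (1) first, erule (1) second)
qed

end
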